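(* Let $\epsilon>0$ and let $\mathcal{L}_\epsilon^{-1}$ be the operator mapping the ($\theta$-independent) fiber velocity to the force density for the Stokes equations outside the straight periodic cylinder $\mathcal{C}_\epsilon$ of radius $\epsilon$ (defined in the context). Then for every integer $k$ with $|k|=1,2,3,\dots$, the eigenvalue $\lambda_k^{\mathrm t}$ in the tangential direction (i.e. $\mathcal{L}_\epsilon^{-1}[e^{i\pi kz}\bm e_z]=\lambda_k^{\mathrm t}e^{i\pi kz}\bm e_z$) and the eigenvalue $\lambda_k^{\mathrm n}$ in the normal directions (i.e. $\mathcal{L}_\epsilon^{-1}[e^{i\pi kz}\bm e_j]=\lambda_k^{\mathrm n}e^{i\pi kz}\bm e_j$ for $j=x,y$) are given by $$\lambda^{\mathrm t}_k = \frac{ 4\pi^2\epsilon |k| K_1^2}{2K_0K_1 + \pi\epsilon |k| \left( K_0^2 - K_1^2 \right) },$$ $$\lambda^{\mathrm n}_k = 2\pi^2\epsilon |k|\,\frac{4K_1^2K_2+\pi\epsilon |k| K_1(K_1^2-K_0K_2)}{2K_0K_1K_2 + \pi\epsilon |k| \left(K_1^2(K_0+K_2)-2K_0^2K_2 \right)},$$ where each $K_j=K_j(\pi\epsilon|k|)$, $j=0,1,2$, is the $j$-th order modified Bessel function of the second kind. Furthermore, for $|k|=1,2,3,\dots$, $$4\pi^2\epsilon |k| < \lambda^{\mathrm t}_k < 4\pi^2\epsilon |k| + 2\pi ,\qquad 3\pi^2\epsilon |k| < \lambda^{\mathrm n}_k < 3\pi^2\epsilon |k| + 3\pi .$$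
   Context: Let $\mathbb{T}=\mathbb{R}/2\mathbb{Z}$. In cylindrical coordinates $(r,\theta,z)$, let $\mathcal{C}_\epsilon=\{(r,\theta,z): 0\le r\le\epsilon,\ 0\le\theta<2\pi,\ z\in\mathbb{T}\}\subset\mathbb{R}^2\times\mathbb{T}$, with Cartesian basis $\bm e_x,\bm e_y,\bm e_z$ ($\bm e_z$ along the cylinder axis), and let $\Omega_\epsilon=(\mathbb{R}^2\times\mathbb{T})\setminus\overline{\mathcal{C}_\epsilon}$. For $\overline{\bm u}\in H^{1/2}(\mathbb{T})$ (three-component vector valued) with zero mean, $\int_{\mathbb{T}}\overline{\bm u}\,dz=0$, let $(\bm u,p)$ be the unique solution of the Stokes Dirichlet problem $-\Delta\bm u+\nabla p=0$, $\operatorname{div}\bm u=0$ in $\Omega_\epsilon$, $\bm u=\overline{\bm u}(z)$ on $\partial\mathcal{C}_\epsilon$ (boundary data independent of $\theta$), with $\bm u\to0$ and $p\to 0$ as $r\to\infty$. Let $\bm\sigma=\nabla\bm u+(\nabla\bm u)^{\mathrm T}-p\,\mathbf I$ and let $\bm n$ be the unit normal on $\partial\mathcal{C}_\epsilon$ pointing into $\mathcal{C}_\epsilon$. The operator $\mathcal{L}_\epsilon^{-1}:H^{1/2}(\mathbb{T})\to H^{-1/2}(\mathbb{T})$ (on zero-mean functions) is $$\mathcal{L}_\epsilon^{-1}[\overline{\bm u}](z)=\int_0^{2\pi}(\bm\sigma\bm n)\,\epsilon\,d\theta .$$ *)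

theory Defs
  imports "HOL-Analysis.Analysis"
begin

text \<open>
  Functions on the circle \<open>\<real>/2\<int>\<close> are 2-periodic functions on the real line; functions on
  \<open>\<real>\<^sup>2 \<times> \<real>/2\<int>\<close> are functions on \<open>real^3\<close> that are 2-periodic in the third coordinate.
  Velocities and pressures are complex valued, since the operator is applied to complex
  exponentials.
\<close>

text \<open>The integral representation, valid for \<open>x > 0\<close>.\<close>

definition bessel_K :: "nat \<Rightarrow> real \<Rightarrow> real" where
  "bessel_K n x = (LINT t:{0..}|lborel. exp (- x * cosh t) * cosh (real n * t))"

definition fourier_mode :: "int \<Rightarrow> complex^3 \<Rightarrow> real \<Rightarrow> complex^3" where
  "fourier_mode k v z = cis (pi * of_int k * z) *s v"

definition fourier_coeff :: "(real \<Rightarrow> complex^3) \<Rightarrow> int \<Rightarrow> complex^3" where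
  "fourier_coeff f m = (1/2) *\<^sub>R (LINT z:{-1..1}|lborel. cis (- pi * of_int m * z) *s f z)"

text \<open>Smoothness is measured by the decay of the Fourier coefficients; functions that agree almost
  everywhere are not identified, and every class has a Borel representative.\<close>

definition H_half :: "(real \<Rightarrow> complex^3) set" where
  "H_half = {f. (\<forall>z. f (z + 2) = f z) \<and> f \<in> borel_measurable borel \<and>
     set_integrable lborel {-1..1} (\<lambda>z. (norm (f z))\<^sup>2) \<and>
     (\<lambda>m::int. sqrt (1 + (of_int m)\<^sup>2) * (norm (fourier_coeff f m))\<^sup>2) summable_on UNIV}"

definition H_half_0 :: "(real \<Rightarrow> complex^3) set" where
  "H_half_0 = {f \<in> H_half. (LINT z:{-1..1}|lborel. f z) = 0}"

text \<open>
  \<open>H\<^sup>-\<^sup>1\<^sup>/\<^sup>2\<close> is the dual of \<open>H\<^sup>1\<^sup>/\<^sup>2\<close>: its elements are functionals on \<open>H_half\<close>, and a function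
  is identified with the functional it induces through the bilinear pairing.
\<close>

definition pairing :: "(real \<Rightarrow> complex^3) \<Rightarrow> (real \<Rightarrow> complex^3) \<Rightarrow> complex" where
  "pairing f \<phi> = (LINT z:{-1..1}|lborel. (\<Sum>i\<in>UNIV. f z $ i * \<phi> z $ i))"

definition functional_of :: "(real \<Rightarrow> complex^3) \<Rightarrow> (real \<Rightarrow> complex^3) \<Rightarrow> complex" where
  "functional_of f = (\<lambda>\<phi>\<in>H_half. pairing f \<phi>)"

definition radius :: "real^3 \<Rightarrow> real" where
  "radius x = sqrt ((x $ 1)\<^sup>2 + (x $ 2)\<^sup>2)"

definition cyl :: "real \<Rightarrow> real \<Rightarrow> real \<Rightarrow> real^3" where
  "cyl r \<theta> z = vector [r * cos \<theta>, r * sin \<theta>, z]"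

definition Omega :: "real \<Rightarrow> (real^3) set" where
  "Omega \<epsilon> = {x. radius x > \<epsilon>}"

definition Omega_cell :: "real \<Rightarrow> (real^3) set" where
  "Omega_cell \<epsilon> = {x \<in> Omega \<epsilon>. -1 \<le> x $ 3 \<and> x $ 3 < 1}"

definition pderiv_at :: "3 \<Rightarrow> (real^3 \<Rightarrow> 'b::real_normed_vector) \<Rightarrow> real^3 \<Rightarrow> 'b" where
  "pderiv_at j f x = frechet_derivative f (at x) (axis j 1)"

text \<open>Meant for open \<open>S\<close>; differentiability gives the continuity at the intermediate orders.\<close>

primrec Ck_on :: "nat \<Rightarrow> (real^3) set \<Rightarrow> (real^3 \<Rightarrow> 'b::real_normed_vector) \<Rightarrow> bool" where
  "Ck_on 0 S f \<longleftrightarrow> continuous_on S f"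
| "Ck_on (Suc k) S f \<longleftrightarrow> f differentiable_on S \<and> (\<forall>j. Ck_on k S (pderiv_at j f))"

definition gradient :: "(real^3 \<Rightarrow> complex) \<Rightarrow> real^3 \<Rightarrow> complex^3" where
  "gradient p x = (\<chi> i. pderiv_at i p x)"

definition jacobian :: "(real^3 \<Rightarrow> complex^3) \<Rightarrow> real^3 \<Rightarrow> complex^3^3" where
  "jacobian u x = (\<chi> i j. pderiv_at j u x $ i)"

definition divergence :: "(real^3 \<Rightarrow> complex^3) \<Rightarrow> real^3 \<Rightarrow> complex" where
  "divergence u x = (\<Sum>i\<in>UNIV. pderiv_at i u x $ i)"

definition laplacian :: "(real^3 \<Rightarrow> complex^3) \<Rightarrow> real^3 \<Rightarrow> complex^3" where
  "laplacian u x = (\<Sum>j\<in>UNIV. pderiv_at j (pderiv_at j u) x)"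

text \<open>
  For \<open>H\<^sup>1\<^sup>/\<^sup>2\<close> data the solution is the finite-energy one: \<open>\<nabla>u\<close> and \<open>p\<close> are square integrable over
  a period cell, and the boundary values are attained as traces, i.e. as \<open>L\<^sup>2\<close> limits along
  the coaxial cylinders \<open>r \<rightarrow> \<epsilon>+\<close>. By interior regularity such a solution satisfies the equations
  classically in the open domain. The filter in the decay conditions makes the limits
  \<open>r \<rightarrow> \<infinity>\<close> uniform in \<open>\<theta>\<close> and \<open>z\<close>. Values off the domain are normalised to zero, so that
  uniqueness of the solution is uniqueness of the pair of total functions.
\<close>

definition stokes_solution ::
  "real \<Rightarrow> (real \<Rightarrow> complex^3) \<Rightarrow> (real^3 \<Rightarrow> complex^3) \<Rightarrow> (real^3 \<Rightarrow> complex) \<Rightarrow> bool" where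
  "stokes_solution \<epsilon> ubar u p \<longleftrightarrow>
     (\<forall>x. u (x + axis 3 2) = u x \<and> p (x + axis 3 2) = p x) \<and>
     (\<forall>x. x \<notin> Omega \<epsilon> \<longrightarrow> u x = 0 \<and> p x = 0) \<and>
     Ck_on 2 (Omega \<epsilon>) u \<and> Ck_on 1 (Omega \<epsilon>) p \<and>
     (\<forall>x\<in>Omega \<epsilon>. - laplacian u x + gradient p x = 0) \<and>
     (\<forall>x\<in>Omega \<epsilon>. divergence u x = 0) \<and>
     (\<forall>j. set_integrable lborel (Omega_cell \<epsilon>) (\<lambda>x. (norm (pderiv_at j u x))\<^sup>2)) \<and>
     set_integrable lborel (Omega_cell \<epsilon>) (\<lambda>x. (norm (p x))\<^sup>2) \<and>
     ((\<lambda>r. \<integral>\<^sup>+q\<in>{0..2*pi} \<times> {-1..1}.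
             ennreal ((norm (u (cyl r (fst q) (snd q)) - ubar (snd q)))\<^sup>2) \<partial>lborel)
        \<longlongrightarrow> 0) (at_right \<epsilon>) \<and>
     (u \<longlongrightarrow> 0) (filtercomap radius at_top) \<and>
     (p \<longlongrightarrow> 0) (filtercomap radius at_top)"

definition stress :: "(real^3 \<Rightarrow> complex^3) \<Rightarrow> (real^3 \<Rightarrow> complex) \<Rightarrow> real^3 \<Rightarrow> complex^3^3" where
  "stress u p x = jacobian u x + transpose (jacobian u x) - mat (p x)"

text \<open>The unit normal pointing towards the axis.\<close>

definition inner_normal :: "real \<Rightarrow> complex^3" where
  "inner_normal \<theta> = vector [- of_real (cos \<theta>), - of_real (sin \<theta>), 0]"

text \<open>The angle-integrated traction, with the stress evaluated on the cylinder of radius \<open>r\<close>.\<close>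

definition force_density ::
  "real \<Rightarrow> (real^3 \<Rightarrow> complex^3) \<Rightarrow> (real^3 \<Rightarrow> complex) \<Rightarrow> real \<Rightarrow> real \<Rightarrow> complex^3" where
  "force_density \<epsilon> u p r z =
     (LINT \<theta>:{0..2*pi}|lborel. \<epsilon> *\<^sub>R (stress u p (cyl r \<theta> z) *v inner_normal \<theta>))"

text \<open>
  For \<open>H\<^sup>1\<^sup>/\<^sup>2\<close> data the traction on the boundary is only an element of \<open>H\<^sup>-\<^sup>1\<^sup>/\<^sup>2\<close>: it is the
  limit, tested against functions in \<open>H\<^sup>1\<^sup>/\<^sup>2\<close>, of the tractions on the cylinders \<open>r \<rightarrow> \<epsilon>+\<close>.
  Where the stress is continuous up to the boundary, this is the pointwise integral of the
  traction over the boundary circle.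
\<close>

definition L_inv ::
  "real \<Rightarrow> (real \<Rightarrow> complex^3) \<Rightarrow> ((real \<Rightarrow> complex^3) \<Rightarrow> complex)" where
  "L_inv \<epsilon> = (\<lambda>ubar\<in>H_half_0.
     let (u, p) = (THE (u, p). stokes_solution \<epsilon> ubar u p)
     in (\<lambda>\<phi>\<in>H_half. Lim (at_right \<epsilon>) (\<lambda>r. pairing (force_density \<epsilon> u p r) \<phi>)))"

end

theory Submission
  imports Defs
begin

text \<open>
  For a single Fourier mode the Stokes problem is solved explicitly by polynomials in the cross
  section times \<open>K\<^sub>n(\<kappa>r) / r\<^sup>n\<close> with \<open>\<kappa> = \<pi>|k|\<close>; these products are closed under
  differentiation because \<open>(x\<^sup>-\<^sup>n K\<^sub>n)' = - x\<^sup>-\<^sup>n K\<^bsub>n+1\<^esub>\<close>. Integrating the traction over \<open>\<theta>\<close> gives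
  the eigenvalues.

  Uniqueness reduces to one variable. For the difference \<open>(w, q)\<close> of two solutions, let \<open>\<Phi>(r)\<close> be the
  flux of \<open>\<nabla>|w|\<^sup>2 - 2 Re(q w)\<close> (with \<open>w\<close> conjugated) through the cylinder of radius \<open>r\<close>. By the equations \<open>\<Phi>'\<close> is
  twice the integral of \<open>|\<nabla>w|\<^sup>2\<close>, so \<open>\<Phi>\<close> is nondecreasing. A positive value would make the energy density
  at radius \<open>r\<close> at least of order \<open>1/r\<close> at infinity, a negative value at least of order
  \<open>1/(r - \<epsilon>)\<close> near the boundary; both contradict finite energy, so \<open>\<Phi> = 0\<close> and \<open>\<nabla>w = 0\<close>.

  The eigenvalue bounds are inequalities for \<open>y = K\<^sub>0/K\<^sub>1\<close>. They follow from two sharp inequalities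
  between \<open>2y - x(1 - y\<^sup>2)\<close> and rational functions of \<open>x\<close>, obtained by monotonicity from infinity of
  \<open>2xK\<^sub>0K\<^sub>1 + x\<^sup>2(K\<^sub>0\<^sup>2 - K\<^sub>1\<^sup>2)\<close>, whose derivative is \<open>-2xK\<^sub>1\<^sup>2\<close>.
\<close>

section \<open>Modified Bessel functions of the second kind\<close>

text \<open>The operator picks its solution by \<open>THE\<close>, so an explicit field yields an
  eigenvalue only together with uniqueness in the whole finite-energy class. There the boundary
  values are mere L2 traces and nothing controls gradient or pressure pointwise at the wall, so no
  integration by parts up to r = \<epsilon> is available. Fluxes through interior cylinders replace
  it; the trace enters only through M(r), the integral of |w|^2 over the parameter cell at radius r,
  which finite energy forces to vanish at least linearly at the wall. For the explicit fields, write
  a_n for K_n(\<kappa>r)/r^n times exp(i pi k z). The cross-sectional gradient of a_n is -\<kappa>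
  (x_1, x_2) a_{n+1} and its Laplacian is 2 n \<kappa> a_{n+1}, so a_0 is harmonic, as a pressure
  must be, and the Stokes system becomes linear relations between coefficients, closed by the Bessel
  recurrence. The denominators of the eigenvalues appear when the boundary velocity is normalised to
  1. For the bounds, s = x (1 - y^2) satisfies 2y - 1 < s < y; multiplying by positive factors turns
  the normal bounds into polynomial inequalities in s and y on that region.\<close>

lemma exp_neg_le_inverse_power:
  fixes v :: real assumes "v > 0" shows "exp (- v) \<le> fact m / v ^ m"
proof -
  have s: "(\<lambda>n. v ^ n / fact n) sums exp v"
    using exp_converges[of v] by (simp add: divide_inverse mult.commute)
  have "v ^ m / fact m = (\<Sum>n\<in>{m}. v ^ n / fact n)" by simp
  also have "\<dots> \<le> exp v"
    unfolding sums_unique[OF s]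
    by (rule sum_le_suminf) (use s assms in \<open>auto simp: sums_iff\<close>)
  finally show ?thesis using assms
    by (simp add: exp_minus field_simps)
qed

lemma divide_mult_power_inverse:
  fixes f x y :: real shows "f / (x * y / 2) ^ k = f * (2 / x) ^ k * inverse (y ^ k)"
  unfolding divide_inverse power_mult_distrib power_inverse inverse_mult_distrib inverse_inverse_eq
  by (simp only: mult_ac)

text \<open>Since cosh t >= exp t / 2, the kernel decays faster than any power of exp(-t). Spending
  m + 1 such powers absorbs the growth of \<open>g\<close> and leaves a spare exp(-t) as integrable
  majorant.\<close>

lemma bessel_kernel_integrable:
  fixes g :: "real \<Rightarrow> real"
  assumes "x > 0" and [measurable]: "g \<in> borel_measurable borel"
    and bd: "\<And>t. t \<ge> 0 \<Longrightarrow> \<bar>g t\<bar> \<le> C * exp (real m * t)"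
  shows "set_integrable lborel {0..} (\<lambda>t. exp (- x * cosh t) * g t)"
proof -
  define A where "A = \<bar>C\<bar> * (fact (Suc m) * (2 / x) ^ Suc m)"
  have int: "set_integrable lborel {0..} (\<lambda>t. A * exp (- 1 * t))"
  proof -
    have "(\<lambda>t. exp (- 1 * t)) absolutely_integrable_on {0::real..}"
      by (intro nonnegative_absolutely_integrable_1 integrable_on_exp_minus_to_infinity) auto
    then have "set_integrable lborel {0..} (\<lambda>t::real. exp (- 1 * t))"
      unfolding set_integrable_def by (subst (asm) integrable_completion) auto
    then show ?thesis by simp
  qed
  show ?thesis
  proof (rule set_integrable_bound[OF int])
    show "set_borel_measurable lborel {0..} (\<lambda>t. exp (- x * cosh t) * g t)"
      unfolding set_borel_measurable_def cosh_def by measurable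
    have "norm (exp (- x * cosh t) * g t) \<le> norm (A * exp (- 1 * t))" if t: "t \<ge> 0" for t
    proof -
      have c: "cosh t \<ge> exp t / 2" by (simp add: cosh_def)
      then have "exp (- x * cosh t) \<le> exp (- (x * exp t / 2))"
        using \<open>x > 0\<close> by (simp add: mult_left_mono flip: times_divide_eq_right)
      also have "\<dots> \<le> fact (Suc m) / (x * exp t / 2) ^ Suc m"
        using \<open>x > 0\<close> by (intro exp_neg_le_inverse_power) simp
      finally have 0: "exp (- x * cosh t) \<le> fact (Suc m) / (x * exp t / 2) ^ Suc m" .
      have "exp (- (1 + real m) * t) = inverse (exp t ^ Suc m)"
        by (simp add: exp_of_nat_mult[symmetric] exp_minus[symmetric] algebra_simps del: power_Suc)
      then have "fact (Suc m) / (x * exp t / 2) ^ Suc m = fact (Suc m) * (2 / x) ^ Suc m * exp (- (1 + real m) * t)"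
        by (simp only: divide_mult_power_inverse)
      with 0 have 1: "exp (- x * cosh t) \<le> fact (Suc m) * (2 / x) ^ Suc m * exp (- (1 + real m) * t)"
        by (simp only:)
      have "\<bar>g t\<bar> \<le> \<bar>C\<bar> * exp (real m * t)"
        using bd[OF t] by (rule order.trans) (intro mult_right_mono, auto)
      then have "\<bar>exp (- x * cosh t) * g t\<bar>
          \<le> (fact (Suc m) * (2 / x) ^ Suc m * exp (- (1 + real m) * t)) * (\<bar>C\<bar> * exp (real m * t))"
        unfolding abs_mult using order.trans[OF exp_ge_zero 1] 1 by (intro mult_mono) (simp_all only: abs_exp_cancel abs_ge_zero)
      also have "\<dots> = A * (exp (- (1 + real m) * t) * exp (real m * t))"
        by (simp only: A_def mult_ac)
      also have "\<dots> = A * exp (- 1 * t)"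
        by (simp add: exp_add[symmetric] algebra_simps)
      also have "\<dots> \<le> norm (A * exp (- 1 * t))"
        unfolding real_norm_def by (rule abs_ge_self)
      finally show ?thesis unfolding real_norm_def .
    qed
    then show "AE t in lborel. t \<in> {0..} \<longrightarrow> norm (exp (- x * cosh t) * g t) \<le> norm (A * exp (- 1 * t))"
      by simp
  qed
qed

lemma cosh_le_exp: "t \<ge> 0 \<Longrightarrow> cosh (t::real) \<le> exp t"
  by (simp add: cosh_def)

lemma abs_sinh_le_exp: assumes "t \<ge> 0" shows "\<bar>sinh (t::real)\<bar> \<le> exp t"
proof -
  have "- exp (- t) \<le> exp t" by (rule order.trans[of _ 0]) simp_all
  then show ?thesis using assms by (simp add: sinh_def abs_le_iff)
qed

lemma exp_taylor1_abs: fixes u :: real shows "\<bar>exp u - 1 - u\<bar> \<le> u\<^sup>2 * exp \<bar>u\<bar>"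
proof -
  obtain t where t: "\<bar>t\<bar> \<le> \<bar>u\<bar>" "exp u = (\<Sum>m<2. u ^ m / fact m) + exp t / fact 2 * u ^ 2"
    using Maclaurin_exp_le[of u 2] by blast
  then have "\<bar>exp u - 1 - u\<bar> = exp t / 2 * u\<^sup>2"
    by (simp add: numeral_2_eq_2 abs_mult)
  also have "\<dots> \<le> exp \<bar>u\<bar> * u\<^sup>2"
  proof (rule mult_right_mono)
    have "exp t \<le> exp \<bar>u\<bar>" using t(1) by simp
    then show "exp t / 2 \<le> exp \<bar>u\<bar>" using exp_gt_zero[of t] by linarith
  qed simp
  finally show ?thesis by (simp add: mult.commute)
qed

text \<open>Differentiation under the integral with an explicit quadratic error. The Taylor
  remainder at u = -h cosh t costs a factor exp(|h| cosh t), which half of the decay of the kernel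
  pays for as long as |h| < x/2; the other half bounds the error by h^2 times
  \<open>?B\<close>.\<close>

lemma bessel_kernel_derivative:
  fixes g :: "real \<Rightarrow> real"
  assumes "x > 0" and [measurable]: "g \<in> borel_measurable borel"
    and bd: "\<And>t. t \<ge> 0 \<Longrightarrow> \<bar>g t\<bar> \<le> C * exp (real m * t)"
  shows "((\<lambda>x. LINT t:{0..}|lborel. exp (- x * cosh t) * g t) has_real_derivative
           - (LINT t:{0..}|lborel. exp (- x * cosh t) * (cosh t * g t))) (at x)"
proof -
  let ?I = "\<lambda>x. LINT t:{0..}|lborel. exp (- x * cosh t) * g t"
  let ?D = "LINT t:{0..}|lborel. exp (- x * cosh t) * (cosh t * g t)"
  let ?B = "LINT t:{0..}|lborel. exp (- (x/2) * cosh t) * ((cosh t)\<^sup>2 * \<bar>g t\<bar>)"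
  have [measurable]: "(cosh :: real \<Rightarrow> real) \<in> borel_measurable borel"
    by (intro borel_measurable_continuous_onI continuous_intros)
  have C: "C \<ge> 0" using bd[of 0] by auto
  have b1: "\<bar>cosh t * g t\<bar> \<le> C * exp (real (m+1) * t)" if "t \<ge> 0" for t
  proof -
    have "\<bar>cosh t * g t\<bar> \<le> exp t * (C * exp (real m * t))"
      unfolding abs_mult using bd[OF that] cosh_le_exp[OF that] C by (intro mult_mono) auto
    also have "\<dots> = C * exp (real (m+1) * t)"
      by (simp add: exp_add[symmetric] algebra_simps)
    finally show ?thesis .
  qed
  have b2: "\<bar>(cosh t)\<^sup>2 * \<bar>g t\<bar>\<bar> \<le> C * exp (real (m+2) * t)" if "t \<ge> 0" for t
  proof -
    have "\<bar>cosh t * \<bar>cosh t * g t\<bar>\<bar> \<le> exp t * (C * exp (real (m+1) * t))"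
      unfolding abs_mult[of "cosh t" "\<bar>cosh t * g t\<bar>"]
      using b1[OF that] cosh_le_exp[OF that] C by (intro mult_mono) auto
    also have "\<dots> = C * exp (real (m+2) * t)"
      by (simp add: exp_add[symmetric] algebra_simps)
    finally show ?thesis by (simp add: abs_mult power2_eq_square)
  qed
  have iB: "set_integrable lborel {0..} (\<lambda>t. exp (- (x/2) * cosh t) * ((cosh t)\<^sup>2 * \<bar>g t\<bar>))"
    using \<open>x > 0\<close> by (intro bessel_kernel_integrable[where m="m+2" and C=C] b2) auto
  have iD: "set_integrable lborel {0..} (\<lambda>t. exp (- x * cosh t) * (cosh t * g t))"
    using \<open>x > 0\<close> by (intro bessel_kernel_integrable[where m="m+1" and C=C] b1) auto
  have iI: "set_integrable lborel {0..} (\<lambda>t. exp (- y * cosh t) * g t)" if "y > 0" for y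
    using that by (intro bessel_kernel_integrable[where m=m and C=C] bd) auto
  have est: "\<bar>?I (x + h) - ?I x + h * ?D\<bar> \<le> h\<^sup>2 * ?B" if h: "\<bar>h\<bar> < x / 2" for h
  proof -
    have i1: "set_integrable lborel {0..} (\<lambda>t. exp (- (x + h) * cosh t) * g t)"
      using h \<open>x > 0\<close> by (intro iI) auto
    have i2: "set_integrable lborel {0..} (\<lambda>t. exp (- x * cosh t) * g t)"
      by (rule iI) fact
    have i3: "set_integrable lborel {0..} (\<lambda>t. h * (exp (- x * cosh t) * (cosh t * g t)))"
      using iD by simp
    note i4 = set_integral_add(1)[OF set_integral_diff(1)[OF i1 i2] i3]
    have e: "?I (x + h) - ?I x + h * ?D = (LINT t:{0..}|lborel. exp (- (x + h) * cosh t) * g t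
        - exp (- x * cosh t) * g t + h * (exp (- x * cosh t) * (cosh t * g t)))"
      using i1 i2 i3 by (simp add: set_integral_diff set_integral_add)
    have "norm (LINT t:{0..}|lborel. exp (- (x + h) * cosh t) * g t
        - exp (- x * cosh t) * g t + h * (exp (- x * cosh t) * (cosh t * g t)))
      \<le> (LINT t:{0..}|lborel. h\<^sup>2 * (exp (- (x/2) * cosh t) * ((cosh t)\<^sup>2 * \<bar>g t\<bar>)))"
    proof (rule order.trans[OF set_integral_norm_bound set_integral_mono])
      fix t :: real assume "t \<in> {0..}"
      let ?c = "cosh t"
      have "exp (- (x + h) * ?c) * g t - exp (- x * ?c) * g t + h * (exp (- x * ?c) * (?c * g t))
        = exp (- x * ?c) * (exp (- h * ?c) - 1 - (- h * ?c)) * g t"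
        by (simp add: algebra_simps exp_diff exp_minus exp_add divide_inverse)
      also have "\<bar>\<dots>\<bar> \<le> exp (- x * ?c) * ((- h * ?c)\<^sup>2 * exp \<bar>- h * ?c\<bar>) * \<bar>g t\<bar>"
        unfolding abs_mult[of _ "g t"] abs_mult[of "exp _"]
        by (intro mult_right_mono mult_mono exp_taylor1_abs) auto
      also have "\<dots> = h\<^sup>2 * ((exp (- x * ?c) * exp \<bar>h * ?c\<bar>) * (?c\<^sup>2 * \<bar>g t\<bar>))"
        by (simp add: power_mult_distrib mult_ac)
      also have "\<dots> \<le> h\<^sup>2 * (exp (- (x/2) * ?c) * (?c\<^sup>2 * \<bar>g t\<bar>))"
      proof (intro mult_left_mono mult_right_mono)
        have "\<bar>h * ?c\<bar> = \<bar>h\<bar> * ?c" by (simp add: abs_mult)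
        also have "\<dots> \<le> x/2 * ?c" using h by (intro mult_right_mono) auto
        finally show "exp (- x * ?c) * exp \<bar>h * ?c\<bar> \<le> exp (- (x/2) * ?c)"
          unfolding exp_add[symmetric] by simp
      qed auto
      finally show "norm (exp (- (x + h) * ?c) * g t - exp (- x * ?c) * g t + h * (exp (- x * ?c) * (?c * g t)))
          \<le> h\<^sup>2 * (exp (- (x/2) * ?c) * (?c\<^sup>2 * \<bar>g t\<bar>))" by simp
    qed (use i4 set_integrable_abs[OF i4] set_integrable_mult_right[of "h\<^sup>2", OF iB]
      in \<open>simp_all only: real_norm_def\<close>)
    then show ?thesis by (simp only: e real_norm_def set_integral_mult_right)
  qed
  show ?thesis
    unfolding has_field_derivative_def
  proof (rule has_derivativeI_sandwich[where e = "x/2" and H = "\<lambda>y. \<bar>y - x\<bar> * ?B"])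
    show "bounded_linear ((*) (- ?D))" by (rule bounded_linear_mult_right)
    show "((\<lambda>y. \<bar>y - x\<bar> * ?B) \<longlongrightarrow> 0) (at x)"
      by (auto intro!: tendsto_eq_intros)
    fix y assume y: "y \<in> UNIV" "y \<noteq> x" "dist y x < x / 2"
    have "\<bar>?I (x + (y - x)) - ?I x + (y - x) * ?D\<bar> \<le> (y - x)\<^sup>2 * ?B"
      using y by (intro est) (simp add: dist_real_def)
    also have "(y - x)\<^sup>2 * ?B = \<bar>y - x\<bar> * ?B * norm (y - x)"
    proof -
      have "(y - x)\<^sup>2 = \<bar>y - x\<bar> * \<bar>y - x\<bar>" by (simp add: power2_eq_square)
      then show ?thesis by (simp only: real_norm_def mult_ac)
    qed
    finally show "norm (?I y - ?I x - - ?D * (y - x)) / norm (y - x) \<le> \<bar>y - x\<bar> * ?B"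
      using y by (subst pos_divide_le_eq) (simp_all add: mult.commute[of _ "y - x"])
  qed (use \<open>x > 0\<close> in auto)
qed

lemma set_integral_mono_subset:
  fixes f :: "'a \<Rightarrow> real"
  assumes int: "set_integrable M A f" and "B \<in> sets M" "B \<subseteq> A" "\<And>t. t \<in> A \<Longrightarrow> 0 \<le> f t"
  shows "(LINT t:B|M. f t) \<le> (LINT t:A|M. f t)"
  using int set_integrable_subset[OF int assms(2,3)] assms(3,4)
  unfolding set_integrable_def set_lebesgue_integral_def
  by (intro integral_mono) (auto split: split_indicator)

lemma bessel_kernel_cosh_bound: "t \<ge> 0 \<Longrightarrow> \<bar>cosh (real n * t)\<bar> \<le> 1 * exp (real n * t)"
  by (simp add: cosh_le_exp)

lemma measurable_cosh_mult [measurable]: "(\<lambda>t. cosh (c * t :: real)) \<in> borel_measurable borel"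
  by (intro borel_measurable_continuous_onI continuous_intros)

lemma measurable_sinh_mult [measurable]: "(\<lambda>t. sinh (c * t :: real)) \<in> borel_measurable borel"
  by (intro borel_measurable_continuous_onI continuous_intros)

lemma bessel_K_integrable:
  "x > 0 \<Longrightarrow> set_integrable lborel {0..} (\<lambda>t. exp (- x * cosh t) * cosh (real n * t))"
  by (rule bessel_kernel_integrable[OF _ _ bessel_kernel_cosh_bound]) auto

text \<open>Integrate the derivative of exp(-x cosh t) sinh((n+1) t) over the half line. Both
  boundary values vanish, and the product of two sinh factors from differentiating the exponential
  splits into cosh((n+2) t) - cosh(n t).\<close>

lemma bessel_K_recurrence:
  assumes "x > 0"
  shows "bessel_K (Suc (Suc n)) x = bessel_K n x + 2 * real (Suc n) / x * bessel_K (Suc n) x"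
proof -
  let ?F = "\<lambda>t. exp (- x * cosh t) * sinh (real (Suc n) * t)"
  let ?f = "\<lambda>t. real (Suc n) * (exp (- x * cosh t) * cosh (real (Suc n) * t))
     - x / 2 * (exp (- x * cosh t) * cosh (real (Suc (Suc n)) * t) - exp (- x * cosh t) * cosh (real n * t))"
  have split: "cosh (real (Suc (Suc n)) * t) - cosh (real n * t) = 2 * sinh (real (Suc n) * t) * sinh t" for t :: real
  proof -
    have a: "real (Suc (Suc n)) * t = real (Suc n) * t + t" and b: "real n * t = real (Suc n) * t - t"
      by (simp_all add: algebra_simps)
    show ?thesis unfolding a b cosh_add cosh_diff by simp
  qed
  have deriv: "(?F has_real_derivative ?f t) (at t)" for t
  proof -
    have "(?F has_real_derivative exp (- x * cosh t) * (- x * sinh t) * sinh (real (Suc n) * t)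
        + exp (- x * cosh t) * (cosh (real (Suc n) * t) * real (Suc n))) (at t)"
      by (auto intro!: derivative_eq_intros)
    also have "exp (- x * cosh t) * (- x * sinh t) * sinh (real (Suc n) * t)
        + exp (- x * cosh t) * (cosh (real (Suc n) * t) * real (Suc n))
        = real (Suc n) * (exp (- x * cosh t) * cosh (real (Suc n) * t))
          - x / 2 * (exp (- x * cosh t) * (2 * sinh (real (Suc n) * t) * sinh t))"
      by (simp add: algebra_simps)
    finally show ?thesis unfolding split[symmetric] by (simp only: right_diff_distrib)
  qed
  have int: "set_integrable lborel {0..} ?f"
    using bessel_K_integrable[OF assms, of "Suc n"] bessel_K_integrable[OF assms, of n]
      bessel_K_integrable[OF assms, of "Suc (Suc n)"]
    by (intro set_integral_diff(1) set_integrable_mult_right) auto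
  have lim: "((\<lambda>b. LINT t:{0..b}|lborel. ?f t) \<longlongrightarrow> (LINT t:{0..}|lborel. ?f t)) at_top"
    by (rule tendsto_set_lebesgue_integral_at_top[OF _ int]) auto
  have eq: "(LINT t:{0..b}|lborel. ?f t) = ?F b" if "b \<ge> 0" for b
  proof -
    have "(LINT t:{0..b}|lborel. ?f t) = integral {0..b} ?f"
      by (rule set_borel_integral_eq_integral(2)) (rule set_integrable_subset[OF int], use that in auto)
    also have "\<dots> = ?F b - ?F 0"
      using that deriv
      by (intro integral_unique fundamental_theorem_of_calculus)
         (auto intro: has_field_derivative_at_within simp flip: has_real_derivative_iff_has_vector_derivative)
    finally show ?thesis by simp
  qed
  have "(?F \<longlongrightarrow> 0) at_top"
  proof (rule Lim_null_comparison)
    let ?G = "\<lambda>t. fact (Suc (Suc n)) * (2 / x) ^ Suc (Suc n) * exp (- t)"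
    show "\<forall>\<^sub>F t in at_top. norm (?F t) \<le> ?G t"
      using eventually_ge_at_top[of 0]
    proof eventually_elim
      case (elim t)
      have c: "cosh t \<ge> exp t / 2" by (simp add: cosh_def)
      then have "exp (- x * cosh t) \<le> exp (- (x * exp t / 2))"
        using \<open>x > 0\<close> by (simp add: mult_left_mono flip: times_divide_eq_right)
      also have "\<dots> \<le> fact (Suc (Suc n)) / (x * exp t / 2) ^ Suc (Suc n)"
        using \<open>x > 0\<close> by (intro exp_neg_le_inverse_power) simp
      finally have "exp (- x * cosh t) * \<bar>sinh (real (Suc n) * t)\<bar>
         \<le> fact (Suc (Suc n)) / (x * exp t / 2) ^ Suc (Suc n) * exp (real (Suc n) * t)"
        using elim by (intro mult_mono abs_sinh_le_exp) (use \<open>x > 0\<close> in auto)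
      also have "\<dots> = ?G t"
      proof -
        have "exp (real (Suc n) * t) = exp t ^ Suc n" by (rule exp_of_nat_mult)
        moreover have "inverse (exp t ^ Suc (Suc n)) * exp t ^ Suc n = exp (- t)"
          by (simp add: exp_minus field_simps)
        ultimately show ?thesis by (simp only: divide_mult_power_inverse mult.assoc)
      qed
      finally show ?case by (simp only: real_norm_def abs_mult abs_exp_cancel)
    qed
    show "(?G \<longlongrightarrow> 0) at_top"
      by (intro tendsto_mult_right_zero filterlim_compose[OF exp_at_bot] filterlim_uminus_at_bot_at_top)
  qed
  then have "((\<lambda>b. LINT t:{0..b}|lborel. ?f t) \<longlongrightarrow> 0) at_top"
    by (rule Lim_transform_eventually) (use eventually_ge_at_top[of 0] in \<open>eventually_elim, simp only: eq\<close>)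
  with lim have "(LINT t:{0..}|lborel. ?f t) = 0"
    using tendsto_unique trivial_limit_at_top_linorder by blast
  moreover have "(LINT t:{0..}|lborel. ?f t) = real (Suc n) * bessel_K (Suc n) x
      - x / 2 * (bessel_K (Suc (Suc n)) x - bessel_K n x)"
    unfolding bessel_K_def
    using bessel_K_integrable[OF assms, of "Suc n"] bessel_K_integrable[OF assms, of n]
      bessel_K_integrable[OF assms, of "Suc (Suc n)"]
    by (simp add: set_integral_diff set_integrable_mult_right del: of_nat_Suc)
  ultimately show ?thesis using assms by (simp add: field_simps)
qed

lemma bessel_K_pos: assumes "x > 0" shows "bessel_K n x > 0"
proof -
  let ?f = "\<lambda>t. exp (- x * cosh t) * cosh (real n * t)"
  have "0 < (LINT t:{0..1::real}|lborel. exp (- x * cosh 1))"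
    by (simp add: set_lebesgue_integral_def)
  also have "\<dots> \<le> (LINT t:{0..1}|lborel. ?f t)"
  proof (rule set_integral_mono)
    show "set_integrable lborel {0..1} ?f"
      by (rule set_integrable_subset[OF bessel_K_integrable[OF assms]]) auto
    fix t :: real assume t: "t \<in> {0..1}"
    have "exp (- x * cosh 1) * 1 \<le> ?f t"
      using t assms by (intro mult_mono) (auto simp: cosh_real_ge_1 cosh_real_nonneg_le_iff)
    then show "exp (- x * cosh 1) \<le> ?f t" by simp
  qed (simp add: set_integrable_def)
  also have "\<dots> \<le> bessel_K n x"
    unfolding bessel_K_def
    by (rule set_integral_mono_subset[OF bessel_K_integrable[OF assms]]) auto
  finally show ?thesis .
qed

text \<open>Because cosh t >= 1, raising the argument from \<open>x0\<close> to \<open>x\<close>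
  gains the factor exp(-(x - x0)) uniformly in t.\<close>

lemma bessel_K_exp_decay:
  assumes "x0 > 0" "x0 \<le> x"
  shows "bessel_K n x \<le> exp (- (x - x0)) * bessel_K n x0"
proof -
  have "bessel_K n x \<le> (LINT t:{0..}|lborel. exp (- (x - x0)) * (exp (- x0 * cosh t) * cosh (real n * t)))"
    unfolding bessel_K_def
  proof (rule set_integral_mono)
    show "set_integrable lborel {0..} (\<lambda>t. exp (- x * cosh t) * cosh (real n * t))"
      using assms by (intro bessel_K_integrable) auto
    show "set_integrable lborel {0..} (\<lambda>t. exp (- (x - x0)) * (exp (- x0 * cosh t) * cosh (real n * t)))"
      using assms bessel_K_integrable[of x0 n] by simp
    fix t :: real
    have "(x - x0) * 1 \<le> (x - x0) * cosh t"
      using assms by (intro mult_left_mono cosh_real_ge_1) auto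
    then have "exp (- x * cosh t) \<le> exp (- (x - x0)) * exp (- x0 * cosh t)"
      unfolding exp_add[symmetric] by (simp add: algebra_simps)
    then show "exp (- x * cosh t) * cosh (real n * t) \<le> exp (- (x - x0)) * (exp (- x0 * cosh t) * cosh (real n * t))"
      by (simp add: mult.assoc[symmetric])
  qed
  also have "\<dots> = exp (- (x - x0)) * bessel_K n x0"
    by (simp add: bessel_K_def)
  finally show ?thesis .
qed

text \<open>The difference of the integrands is exp(-x cosh t) (cosh t - 1). Strictness comes from
  the interval [1, 2], where the second factor is at least cosh 1 - 1.\<close>

lemma bessel_K0_less_K1: assumes "x > 0" shows "bessel_K 0 x < bessel_K 1 x"
proof -
  have i: "set_integrable lborel {0..} (\<lambda>t. exp (- x * cosh t) * cosh (real 1 * t) - exp (- x * cosh t) * cosh (real 0 * t))"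
    by (intro set_integral_diff(1) bessel_K_integrable assms)
  have "0 < (LINT t:{1..2::real}|lborel. exp (- x * cosh 2) * (cosh 1 - 1))"
    using cosh_real_nonneg_less_iff[of 0 1] by (simp add: set_lebesgue_integral_def)
  also have "\<dots> \<le> (LINT t:{1..2}|lborel. exp (- x * cosh t) * cosh (real 1 * t) - exp (- x * cosh t) * cosh (real 0 * t))"
  proof (rule set_integral_mono)
    show "set_integrable lborel {1..2} (\<lambda>t. exp (- x * cosh t) * cosh (real 1 * t) - exp (- x * cosh t) * cosh (real 0 * t))"
      by (rule set_integrable_subset[OF i]) auto
    fix t :: real assume t: "t \<in> {1..2}"
    have "exp (- x * cosh 2) * (cosh 1 - 1) \<le> exp (- x * cosh t) * (cosh t - 1)"
      using t assms by (intro mult_mono) (auto simp: cosh_real_ge_1 cosh_real_nonneg_le_iff)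
    then show "exp (- x * cosh 2) * (cosh 1 - 1) \<le> exp (- x * cosh t) * cosh (real 1 * t) - exp (- x * cosh t) * cosh (real 0 * t)"
      by (simp add: algebra_simps)
  qed (simp add: set_integrable_def)
  also have "\<dots> \<le> (LINT t:{0..}|lborel. exp (- x * cosh t) * cosh (real 1 * t) - exp (- x * cosh t) * cosh (real 0 * t))"
    by (rule set_integral_mono_subset[OF i]) (auto simp: cosh_real_ge_1)
  also have "\<dots> = bessel_K 1 x - bessel_K 0 x"
    unfolding bessel_K_def by (intro set_integral_diff(2) bessel_K_integrable assms)
  finally show ?thesis by simp
qed

lemma bessel_K_has_derivative_aux:
  assumes "x > 0"
  shows "(bessel_K n has_real_derivative
     - (LINT t:{0..}|lborel. exp (- x * cosh t) * (cosh t * cosh (real n * t)))) (at x)"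
  unfolding bessel_K_def[abs_def]
  by (rule bessel_kernel_derivative[OF assms _ bessel_kernel_cosh_bound]) auto

lemma bessel_K_has_derivative_0:
  assumes "x > 0" shows "(bessel_K 0 has_real_derivative - bessel_K 1 x) (at x)"
  using bessel_K_has_derivative_aux[OF assms, of 0] by (simp add: bessel_K_def)

lemma bessel_K_has_derivative_Suc:
  assumes "x > 0"
  shows "(bessel_K (Suc n) has_real_derivative - (bessel_K n x + bessel_K (Suc (Suc n)) x) / 2) (at x)"
proof -
  have split: "cosh t * cosh (real (Suc n) * t) = cosh (real n * t) / 2 + cosh (real (Suc (Suc n)) * t) / 2" for t :: real
  proof -
    have a: "real (Suc (Suc n)) * t = real (Suc n) * t + t" and b: "real n * t = real (Suc n) * t - t"
      by (simp_all add: algebra_simps)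
    show ?thesis unfolding a b cosh_add cosh_diff by (simp add: field_simps)
  qed
  have "(LINT t:{0..}|lborel. exp (- x * cosh t) * (cosh t * cosh (real (Suc n) * t)))
    = (LINT t:{0..}|lborel. (exp (- x * cosh t) * cosh (real n * t)) / 2 + (exp (- x * cosh t) * cosh (real (Suc (Suc n)) * t)) / 2)"
    unfolding split by (simp add: algebra_simps)
  also have "\<dots> = bessel_K n x / 2 + bessel_K (Suc (Suc n)) x / 2"
    using bessel_K_integrable[OF assms, of n] bessel_K_integrable[OF assms, of "Suc (Suc n)"]
    by (simp add: set_integral_add bessel_K_def del: of_nat_Suc)
  finally show ?thesis using bessel_K_has_derivative_aux[OF assms, of "Suc n"]
    by (simp only: minus_add_distrib add_divide_distrib minus_divide_left)
qed

text \<open>In this form the term n/x is exactly what differentiating r^(-n) cancels in K_n(c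
  r)/r^n, so that only the next order survives there.\<close>

lemma bessel_K_has_derivative:
  assumes "x > 0"
  shows "(bessel_K n has_real_derivative real n / x * bessel_K n x - bessel_K (Suc n) x) (at x)"
proof (cases n)
  case 0
  then show ?thesis using bessel_K_has_derivative_0[OF assms] by simp
next
  case (Suc m)
  have "- (bessel_K m x + bessel_K (Suc (Suc m)) x) / 2
      = real (Suc m) / x * bessel_K (Suc m) x - bessel_K (Suc (Suc m)) x"
    using bessel_K_recurrence[OF assms, of m] by (simp add: field_simps)
  with bessel_K_has_derivative_Suc[OF assms, of m] show ?thesis unfolding Suc by (simp only:)
qed

section \<open>Inequalities between Bessel functions\<close>

lemma bessel_K1_has_derivative:
  assumes "x > 0" shows "(bessel_K 1 has_real_derivative - bessel_K 0 x - bessel_K 1 x / x) (at x)"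
proof -
  have e: "real 1 / x * bessel_K 1 x - bessel_K (Suc 1) x = - bessel_K 0 x - bessel_K 1 x / x"
    using bessel_K_recurrence[OF assms, of 0] by (simp add: field_simps)
  show ?thesis using bessel_K_has_derivative[OF assms, of 1] unfolding e .
qed

lemma power_bessel_K_tendsto_0: "((\<lambda>x. x ^ m * bessel_K n x) \<longlongrightarrow> 0) at_top"
proof (rule Lim_null_comparison)
  show "\<forall>\<^sub>F x in at_top. norm (x ^ m * bessel_K n x) \<le> (x ^ m / exp x) * (exp 1 * bessel_K n 1)"
    using eventually_ge_at_top[of 1]
  proof eventually_elim
    case (elim x)
    have "x ^ m * bessel_K n x \<le> x ^ m * (exp (- (x - 1)) * bessel_K n 1)"
      using elim by (intro mult_left_mono bessel_K_exp_decay) auto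
    moreover have "0 \<le> x ^ m * bessel_K n x"
      using elim bessel_K_pos[of x n] by simp
    ultimately show ?case by (simp add: exp_diff)
  qed
  show "((\<lambda>x. (x ^ m / exp x) * (exp 1 * bessel_K n 1)) \<longlongrightarrow> 0) at_top"
    by (intro tendsto_mult_left_zero tendsto_power_div_exp_0)
qed

text \<open>Comparison from infinity. The value at \<open>x + 1\<close> is at most the limit 0, and
  one unit step to the left makes the inequality strict.\<close>

lemma neg_if_increasing_to_0:
  fixes F :: "real \<Rightarrow> real"
  assumes der: "\<And>y. y \<ge> x \<Longrightarrow> (F has_real_derivative F' y) (at y)"
    and pos: "\<And>y. y \<ge> x \<Longrightarrow> F' y > 0" and lim: "(F \<longlongrightarrow> 0) at_top"
  shows "F x < 0"
proof -
  have mono: "F a < F b" if "x \<le> a" "a < b" for a b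
    using that der pos by (intro DERIV_pos_imp_increasing[OF that(2)]) (meson order.trans)
  have "F (x + 1) \<le> 0"
  proof (rule tendsto_lowerbound[OF lim])
    show "\<forall>\<^sub>F y in at_top. F (x + 1) \<le> F y"
      using eventually_gt_at_top[of "x + 1"]
      by eventually_elim (rule less_imp_le, rule mono, auto)
  qed simp
  then show ?thesis using mono[of x "x + 1"] by simp
qed

text \<open>For g = 2y (K_1 - K_0) - K_1 one finds g' - g = K_1 - K_0 + K_1/y > 0, so the
  integrating factor exp(-y) yields monotonicity. The constant 2 matches K_0/K_1 = 1 - 1/(2x) + ...
  at infinity.\<close>

lemma bessel_K_first_bound:
  assumes "x > 0" shows "2 * x * (bessel_K 1 x - bessel_K 0 x) < bessel_K 1 x"
proof -
  let ?g = "\<lambda>y. 2 * y * (bessel_K 1 y - bessel_K 0 y) - bessel_K 1 y"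
  have "?g x * exp (- x) < 0"
  proof (rule neg_if_increasing_to_0[where F = "\<lambda>y. ?g y * exp (- y)"
      and F' = "\<lambda>y. (bessel_K 1 y - bessel_K 0 y + bessel_K 1 y / y) * exp (- y)"])
    fix y :: real assume "y \<ge> x"
    with assms have y: "y > 0" by simp
    show "((\<lambda>y. ?g y * exp (- y)) has_real_derivative
        (bessel_K 1 y - bessel_K 0 y + bessel_K 1 y / y) * exp (- y)) (at y)"
      using y by (auto intro!: derivative_eq_intros bessel_K_has_derivative_0 bessel_K1_has_derivative
          simp: field_simps simp del: One_nat_def)
    show "0 < (bessel_K 1 y - bessel_K 0 y + bessel_K 1 y / y) * exp (- y)"
      using bessel_K0_less_K1[OF y] bessel_K_pos[OF y, of 1] y by (simp add: add_pos_pos)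
  next
    have "((\<lambda>y. (2 * (y ^ 1 * bessel_K 1 y) - 2 * (y ^ 1 * bessel_K 0 y) - y ^ 0 * bessel_K 1 y) * exp (- y))
        \<longlongrightarrow> (2 * 0 - 2 * 0 - 0) * 0) at_top"
      by (intro tendsto_intros power_bessel_K_tendsto_0 filterlim_compose[OF exp_at_bot]
          filterlim_uminus_at_bot_at_top)
    then show "((\<lambda>y. ?g y * exp (- y)) \<longlongrightarrow> 0) at_top"
      by (simp add: algebra_simps)
  qed
  then show ?thesis by (simp add: mult_less_0_iff)
qed

text \<open>\<open>bessel_N\<close> is \<open>2 \<integral>\<^sub>x\<^sup>\<infinity> s K\<^sub>1(s)\<^sup>2 ds\<close>.\<close>

definition bessel_N :: "real \<Rightarrow> real" where
  "bessel_N x = 2 * x * bessel_K 0 x * bessel_K 1 x + x\<^sup>2 * ((bessel_K 0 x)\<^sup>2 - (bessel_K 1 x)\<^sup>2)"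

lemma bessel_N_has_derivative:
  assumes "x > 0" shows "(bessel_N has_real_derivative - 2 * x * (bessel_K 1 x)\<^sup>2) (at x)"
  unfolding bessel_N_def[abs_def] using assms
  by (auto intro!: derivative_eq_intros bessel_K_has_derivative_0 bessel_K1_has_derivative
      simp: field_simps power2_eq_square simp del: One_nat_def)

lemma power_bessel_KK_tendsto_0: "((\<lambda>x. x ^ m * (bessel_K n x * bessel_K l x)) \<longlongrightarrow> 0) at_top"
  using tendsto_mult[OF power_bessel_K_tendsto_0[of m n] power_bessel_K_tendsto_0[of 0 l]]
  by (simp add: mult.assoc)

lemma power_bessel_N_tendsto_0: "((\<lambda>x. x ^ m * bessel_N x) \<longlongrightarrow> 0) at_top"
proof -
  have "((\<lambda>x. 2 * (x ^ (m+1) * (bessel_K 0 x * bessel_K 1 x)) + x ^ (m+2) * (bessel_K 0 x * bessel_K 0 x)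
       - x ^ (m+2) * (bessel_K 1 x * bessel_K 1 x)) \<longlongrightarrow> 2 * 0 + 0 - 0) at_top"
    by (intro tendsto_intros power_bessel_KK_tendsto_0)
  then show ?thesis by (simp add: bessel_N_def algebra_simps power2_eq_square)
qed

text \<open>The derivative of the difference is K_1 (K_1 - 2y (K_1 - K_0)), and its sign is
  precisely \<open>bessel_K_first_bound\<close>.\<close>

lemma bessel_N_upper:
  assumes "x > 0" shows "bessel_N x < x * (bessel_K 1 x)\<^sup>2"
proof -
  have "bessel_N x - x * (bessel_K 1 x)\<^sup>2 < 0"
  proof (rule neg_if_increasing_to_0[where F = "\<lambda>y. bessel_N y - y * (bessel_K 1 y)\<^sup>2"
      and F' = "\<lambda>y. bessel_K 1 y * (bessel_K 1 y - 2 * y * (bessel_K 1 y - bessel_K 0 y))"])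
    fix y :: real assume "y \<ge> x"
    with assms have y: "y > 0" by simp
    let ?d = "bessel_K 1 y * (bessel_K 1 y - 2 * y * (bessel_K 1 y - bessel_K 0 y))"
    show "((\<lambda>y. bessel_N y - y * (bessel_K 1 y)\<^sup>2) has_real_derivative ?d) (at y)"
      using y by (auto intro!: derivative_eq_intros bessel_N_has_derivative bessel_K1_has_derivative
          simp: field_simps power2_eq_square simp del: One_nat_def)
    show "0 < ?d"
      using bessel_K_first_bound[OF y] bessel_K_pos[OF y, of 1] by simp
  next
    have "((\<lambda>y. y ^ 0 * bessel_N y - y ^ 1 * (bessel_K 1 y * bessel_K 1 y)) \<longlongrightarrow> 0 - 0) at_top"
      by (intro tendsto_intros power_bessel_KK_tendsto_0 power_bessel_N_tendsto_0)
    then show "((\<lambda>y. bessel_N y - y * (bessel_K 1 y)\<^sup>2) \<longlongrightarrow> 0) at_top"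
      by (simp add: power2_eq_square)
  qed
  then show ?thesis by simp
qed

text \<open>The derivative of the difference splits into two positive parts, one by K_0 < K_1 and
  the other by \<open>bessel_N_upper\<close>.\<close>

lemma bessel_N_lower:
  assumes "x > 0" shows "2 * x\<^sup>2 * (bessel_K 1 x)\<^sup>2 < (2 * x + 1) * bessel_N x"
proof -
  have "2 * x\<^sup>2 * (bessel_K 1 x)\<^sup>2 - (2 * x + 1) * bessel_N x < 0"
  proof (rule neg_if_increasing_to_0[where F = "\<lambda>y. 2 * y\<^sup>2 * (bessel_K 1 y)\<^sup>2 - (2 * y + 1) * bessel_N y"
      and F' = "\<lambda>y. 4 * y\<^sup>2 * bessel_K 1 y * (bessel_K 1 y - bessel_K 0 y) + 2 * (y * (bessel_K 1 y)\<^sup>2 - bessel_N y)"])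
    fix y :: real assume "y \<ge> x"
    with assms have y: "y > 0" by simp
    let ?d = "4 * y\<^sup>2 * bessel_K 1 y * (bessel_K 1 y - bessel_K 0 y) + 2 * (y * (bessel_K 1 y)\<^sup>2 - bessel_N y)"
    have "((\<lambda>y. 2 * y\<^sup>2 * (bessel_K 1 y)\<^sup>2 - (2 * y + 1) * bessel_N y) has_real_derivative
        4 * y * (bessel_K 1 y)\<^sup>2 + 4 * y\<^sup>2 * bessel_K 1 y * (- bessel_K 0 y - bessel_K 1 y / y)
        - (2 * bessel_N y + (2 * y + 1) * (- 2 * y * (bessel_K 1 y)\<^sup>2))) (at y)"
      using y by (auto intro!: derivative_eq_intros bessel_N_has_derivative bessel_K1_has_derivative
          simp del: One_nat_def)
    moreover have "4 * y * (bessel_K 1 y)\<^sup>2 + 4 * y\<^sup>2 * bessel_K 1 y * (- bessel_K 0 y - bessel_K 1 y / y)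
        - (2 * bessel_N y + (2 * y + 1) * (- 2 * y * (bessel_K 1 y)\<^sup>2)) = ?d"
      using y by (simp add: field_simps power2_eq_square)
    ultimately show "((\<lambda>y. 2 * y\<^sup>2 * (bessel_K 1 y)\<^sup>2 - (2 * y + 1) * bessel_N y) has_real_derivative ?d) (at y)"
      by (simp only:)
    show "0 < ?d"
      using bessel_N_upper[OF y] bessel_K_pos[OF y, of 1] bessel_K0_less_K1[OF y] y
      by (intro add_pos_pos mult_pos_pos) auto
  next
    have "((\<lambda>y. 2 * (y ^ 2 * (bessel_K 1 y * bessel_K 1 y)) - 2 * (y ^ 1 * bessel_N y) - y ^ 0 * bessel_N y)
        \<longlongrightarrow> 2 * 0 - 2 * 0 - 0) at_top"
      by (intro tendsto_intros power_bessel_KK_tendsto_0 power_bessel_N_tendsto_0)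
    then show "((\<lambda>y. 2 * y\<^sup>2 * (bessel_K 1 y)\<^sup>2 - (2 * y + 1) * bessel_N y) \<longlongrightarrow> 0) at_top"
      by (simp add: power2_eq_square algebra_simps)
  qed
  then show ?thesis by simp
qed

text \<open>Here \<open>d\<close>, the denominator of the tangential eigenvalue, is
  \<open>bessel_N\<close> divided by x; divided by K_1^2 it is 2y - x (1 - y^2) with y = K_0/K_1.
  Its positivity falls out of the lower bound.\<close>

lemma tangential_ratio_bounds:
  assumes x: "x > 0"
  defines "k0 \<equiv> bessel_K 0 x" and "k1 \<equiv> bessel_K 1 x"
  defines "d \<equiv> 2 * k0 * k1 + x * (k0\<^sup>2 - k1\<^sup>2)"
  shows "0 < d" "d < k1\<^sup>2" "2 * x * k1\<^sup>2 < (2 * x + 1) * d"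
proof -
  have N: "bessel_N x = x * d"
    by (simp add: bessel_N_def d_def k0_def k1_def algebra_simps power2_eq_square)
  show "d < k1\<^sup>2" using bessel_N_upper[OF x] x by (simp add: N k1_def)
  have "x * (2 * x * k1\<^sup>2) < x * ((2 * x + 1) * d)"
    using bessel_N_lower[OF x] by (simp add: N k1_def algebra_simps power2_eq_square)
  then show l: "2 * x * k1\<^sup>2 < (2 * x + 1) * d" using x by simp
  have "0 \<le> 2 * x * k1\<^sup>2" using x by simp
  with l have "0 < (2 * x + 1) * d" by linarith
  then show "0 < d" using x by (simp add: zero_less_mult_iff)
qed

text \<open>A positivity certificate: the polynomial is regrouped into products of quantities that
  have a sign on the region, such as s - (2y - 1), y - s and 1 - y^2. The factor 6y - 2 changes sign
  at y = 1/3, hence the case distinction.\<close>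

lemma normal_ratio_polynomial_lower:
  fixes s y :: real
  assumes "0 < s" "2 * y - 1 < s" "s < y" "y < 1"
  shows "0 < 2 * s\<^sup>2 + 4 * s * y + 16 * (1 - y\<^sup>2) - 6 * s * (1 - y\<^sup>2) - 6 * s\<^sup>2 * y - 12 * (1 - y\<^sup>2) * y"
    (is "0 < ?P")
proof (cases "y \<ge> 1/3")
  case True
  have "?P = (6*y - 2) * (s - 2*y + 1) * (y - s) + 6 * (4 - 3*y) * (y - s) + (16 - 2*y - 12*y\<^sup>2) * (s - 2*y + 1)"
    by (simp add: algebra_simps power2_eq_square)
  moreover have "0 \<le> (6*y - 2) * (s - 2*y + 1) * (y - s)"
    using True assms by (intro mult_nonneg_nonneg) auto
  moreover have "0 < 6 * (4 - 3*y) * (y - s)" using assms by simp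
  moreover have "y\<^sup>2 \<le> 1" using assms by (simp add: power_le_one_iff)
  then have "0 \<le> (16 - 2*y - 12*y\<^sup>2) * (s - 2*y + 1)" using assms by (intro mult_nonneg_nonneg) auto
  ultimately show ?thesis by linarith
next
  case False
  have "?P = (2 - 6*y) * s\<^sup>2 + 4 * s * y + (1 - y\<^sup>2) * (6 * (y - s) + (16 - 18*y))"
    by (simp add: algebra_simps power2_eq_square)
  moreover have "0 \<le> (2 - 6*y) * s\<^sup>2" using False by simp
  moreover have "0 < 4 * s * y" using assms by simp
  moreover have "y\<^sup>2 \<le> 1" using assms by (simp add: power_le_one_iff)
  then have "0 \<le> (1 - y\<^sup>2) * (6 * (y - s) + (16 - 18*y))" using assms False by (intro mult_nonneg_nonneg) auto
  ultimately show ?thesis by linarith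
qed

text \<open>In both cases the certificate is a nonnegative term with factor s^2 plus (1 - y) times a
  positive expression.\<close>

lemma normal_ratio_polynomial_upper:
  fixes s y :: real
  assumes "0 < s" "2 * y - 1 < s" "s < y" "y < 1"
  defines "q \<equiv> 1 - y\<^sup>2"
  shows "0 < 6 * s * (s + q) * (q + s * y) + 12 * (s + q) * y * q - 2 * s^3 - 4 * s\<^sup>2 * y - 16 * q * s"
    (is "0 < ?R")
proof (cases "y \<ge> 1/3")
  case True
  have "?R = (6*y-2) * s\<^sup>2 * (s - (2*y - 1)) + (1-y) * (s * (8+6*y\<^sup>2)*(s - (2*y - 1)) + 6 * s * y^3 + 18*(1-y)*(y-s)
      + (1-y)*y*(12*(1+y)\<^sup>2 - 18))"
    unfolding q_def by (simp add: algebra_simps power2_eq_square power3_eq_cube)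
  moreover have "0 \<le> (6*y-2) * s\<^sup>2 * (s - (2*y - 1))"
    using True assms by (intro mult_nonneg_nonneg) auto
  \<comment> \<open>With y >= 1/3 this makes 12 (1 + y)^2 - 18 positive, the one coefficient whose
    sign is not evident.\<close>
  moreover have "(4/3)\<^sup>2 \<le> (1 + y)\<^sup>2" using True by (intro power_mono) auto
  then have "3 < 2 * (1 + y)\<^sup>2" by (simp add: power2_eq_square)
  then have "0 < s * (8+6*y\<^sup>2)*(s - (2*y - 1)) + 6 * s * y^3 + 18*(1-y)*(y-s) + (1-y)*y*(12*(1+y)\<^sup>2 - 18)"
    using assms by (intro mult_pos_pos add_pos_pos) auto
  then have "0 < (1-y) * (s * (8+6*y\<^sup>2)*(s - (2*y - 1)) + 6 * s * y^3 + 18*(1-y)*(y-s) + (1-y)*y*(12*(1+y)\<^sup>2 - 18))"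
    using assms by (intro mult_pos_pos[of "1 - y"]) auto
  ultimately show ?thesis by linarith
next
  case False
  have R: "?R = (2-6*y) * s\<^sup>2*(y-s) + (1-y)*(6*(1+y+y\<^sup>2) * s\<^sup>2 + (1+y)*((10-12*y+6*y\<^sup>2)*(y-s) + y*(2+(12-18*y)*y)))"
    unfolding q_def by (simp add: algebra_simps power2_eq_square power3_eq_cube)
  have l: "0 \<le> (2-6*y) * s\<^sup>2*(y-s)"
    using False assms by (intro mult_nonneg_nonneg) auto
  have "0 < (10-12*y+6*y\<^sup>2)*(y-s)" using False assms by (intro mult_pos_pos add_pos_nonneg) auto
  moreover have "0 < y*(2+(12-18*y)*y)" using False assms by (intro mult_pos_pos add_pos_pos) auto
  ultimately have "0 < (1-y)*(6*(1+y+y\<^sup>2) * s\<^sup>2 + (1+y)*((10-12*y+6*y\<^sup>2)*(y-s) + y*(2+(12-18*y)*y)))"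
    using assms False by (intro mult_pos_pos add_nonneg_pos) auto
  with R l show ?thesis by linarith
qed

text \<open>\<open>n\<close> and \<open>d\<close> are homogeneous of degree 3 in the Bessel values.
  Dividing by K_1^3 and eliminating K_2 by the recurrence leaves \<open>nn\<close> and
  \<open>dd\<close>, which depend on x and y alone.\<close>

lemma normal_ratio_bounds:
  assumes x: "x > 0"
  defines "k0 \<equiv> bessel_K 0 x" and "k1 \<equiv> bessel_K 1 x" and "k2 \<equiv> bessel_K 2 x"
  defines "n \<equiv> 4 * k1\<^sup>2 * k2 + x * k1 * (k1\<^sup>2 - k0 * k2)"
    and "d \<equiv> 2 * k0 * k1 * k2 + x * (k1\<^sup>2 * (k0 + k2) - 2 * k0\<^sup>2 * k2)"
  shows "0 < d" "3 * d < 2 * n" "2 * x * n < 3 * (x + 1) * d"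
proof -
  have k: "0 < k0" "0 < k1" "k0 < k1"
    using bessel_K_pos[OF x] bessel_K0_less_K1[OF x] by (auto simp: k0_def k1_def)
  define y where "y = k0 / k1"
  have y: "0 < y" "y < 1" and k0: "k0 = y * k1" using k by (auto simp: y_def)
  have k2: "k2 = (y + 2 / x) * k1"
    using bessel_K_recurrence[OF x, of 0] k
    by (simp add: k0_def k1_def k2_def y_def numeral_2_eq_2 algebra_simps)
  define q where "q = 1 - y\<^sup>2"
  define s where "s = x * q"
  have q: "q > 0" unfolding q_def using y by (simp add: power_less_one_iff)
  then have s: "s > 0" using x by (simp add: s_def)
  have T: "2 * k0 * k1 + x * (k0\<^sup>2 - k1\<^sup>2) = k1\<^sup>2 * (2 * y - s)"
    by (simp add: k0 s_def q_def algebra_simps power2_eq_square)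
  have k1sq: "k1\<^sup>2 > 0" using k by simp
  have "k1\<^sup>2 * (2 * y - s) < k1\<^sup>2 * 1"
    using tangential_ratio_bounds(2)[OF x] unfolding k0_def[symmetric] k1_def[symmetric] T by simp
  then have s1: "2 * y - 1 < s" using k1sq by (subst (asm) mult_less_cancel_left_pos) auto
  have "k1\<^sup>2 * (2 * x) < k1\<^sup>2 * ((2 * x + 1) * (2 * y - s))"
    using tangential_ratio_bounds(3)[OF x] unfolding k0_def[symmetric] k1_def[symmetric] T
    by (simp add: algebra_simps)
  then have "2 * x < (2 * x + 1) * (2 * y - s)" using k1sq by (subst (asm) mult_less_cancel_left_pos) auto
  then have "q * (2 * x) < q * ((2 * x + 1) * (2 * y - s))" using q by simp
  then have s2: "2 * s < (2 * s + q) * (2 * y - s)" by (simp add: s_def algebra_simps)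
  \<comment> \<open>The lower bound enters the polynomial inequalities only through this
    consequence: for s >= y the difference displayed below would be nonnegative, against
    \<open>s2\<close>.\<close>
  have sy: "s < y"
  proof (rule ccontr)
    assume "\<not> s < y"
    then have "0 \<le> (s - y) * (2 * s + (1 - y) * (3 + y))" "0 \<le> y * (1 - y)\<^sup>2"
      using s y by auto
    moreover have "2 * s - (2 * s + q) * (2 * y - s) = (s - y) * (2 * s + (1 - y) * (3 + y)) + y * (1 - y)\<^sup>2"
      by (simp add: q_def algebra_simps power2_eq_square)
    ultimately show False using s2 by linarith
  qed
  define nn where "nn = s + 2 * y + 8 / x"
  define dd where "dd = 2 * q * (1 + x * y) + 4 * y / x"
  have n: "n = k1 ^ 3 * nn" and d: "d = k1 ^ 3 * dd"
    unfolding n_def d_def k0 k2 nn_def dd_def s_def q_def using x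
    by (simp_all add: field_simps power2_eq_square power3_eq_cube)
  have k13: "k1 ^ 3 > 0" using k by simp
  have dd: "dd > 0" unfolding dd_def using x y q by (intro add_pos_pos mult_pos_pos divide_pos_pos) auto
  then show "0 < d" using k13 by (simp add: d)
  \<comment> \<open>The positive factor x q trades every x for s = x q, leaving a polynomial in s
    and y; in the upper bound s q does the same.\<close>
  have "x * q * (2 * nn - 3 * dd)
      = 2 * s\<^sup>2 + 4 * s * y + 16 * q - 6 * s * q - 6 * s\<^sup>2 * y - 12 * q * y"
    unfolding nn_def dd_def s_def using x by (simp add: field_simps power2_eq_square)
  also have "\<dots> > 0" using normal_ratio_polynomial_lower[OF s s1 sy y(2)] by (simp only: q_def)
  finally have "0 < 2 * nn - 3 * dd" by (rule zero_less_mult_pos) (use x q in simp)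
  then have "k1 ^ 3 * (3 * dd) < k1 ^ 3 * (2 * nn)" using k13 by simp
  then show "3 * d < 2 * n" by (simp add: n d algebra_simps)
  have "s * q * (3 * (x + 1) * dd - 2 * x * nn)
      = 6 * s * (s + q) * (q + s * y) + 12 * (s + q) * y * q - 2 * s^3 - 4 * s\<^sup>2 * y - 16 * q * s"
    unfolding nn_def dd_def s_def using x by (simp add: field_simps power2_eq_square power3_eq_cube)
  also have "\<dots> > 0" using normal_ratio_polynomial_upper[OF s s1 sy y(2)] by (simp only: q_def)
  finally have "0 < 3 * (x + 1) * dd - 2 * x * nn" by (rule zero_less_mult_pos) (use s q in simp)
  then have "k1 ^ 3 * (2 * x * nn) < k1 ^ 3 * (3 * (x + 1) * dd)" using k13 by simp
  then show "2 * x * n < 3 * (x + 1) * d" by (simp add: n d algebra_simps)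
qed

section \<open>Partial derivatives of Fourier modes with Bessel profiles\<close>

lemma radius_le: "\<bar>x $ 1\<bar> \<le> radius x" "\<bar>x $ 2\<bar> \<le> radius x"
  unfolding radius_def by (auto intro: real_le_rsqrt simp: power2_eq_square)

lemma radius_square: "(radius x)\<^sup>2 = (x $ 1)\<^sup>2 + (x $ 2)\<^sup>2"
  by (simp add: radius_def)

lemma continuous_on_radius [continuous_intros]: "continuous_on S radius"
  unfolding radius_def[abs_def] by (intro continuous_intros)

lemma open_Omega: "open (Omega \<epsilon>)"
proof -
  have "open {x. \<epsilon> < radius x}"
    by (intro open_Collect_less continuous_intros)
  then show ?thesis by (simp add: Omega_def)
qed

lemma radius_cyl: "r \<ge> 0 \<Longrightarrow> radius (cyl r \<theta> z) = r"
  by (simp add: radius_def cyl_def power_mult_distrib flip: distrib_left)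

lemma cyl_components: "cyl r \<theta> z $ 1 = r * cos \<theta>" "cyl r \<theta> z $ 2 = r * sin \<theta>" "cyl r \<theta> z $ 3 = z"
  by (simp_all add: cyl_def)

lemma cyl_in_Omega: "0 \<le> \<epsilon> \<Longrightarrow> \<epsilon> < r \<Longrightarrow> cyl r \<theta> z \<in> Omega \<epsilon>"
  by (simp add: Omega_def radius_cyl)

lemma UNIV_3_cases: "(j::3) = 1 \<or> j = 2 \<or> j = 3"
  by (rule exhaust_3)

lemma frechet_derivative_eq: "(f has_derivative f') (at x) \<Longrightarrow> frechet_derivative f (at x) = f'"
  by (rule frechet_derivative_at[symmetric])

text \<open>The differential operators are built on \<open>frechet_derivative\<close>, which has a
  value even where no derivative exists. This predicate couples differentiability with the values of
  the partials, so both pass together through sums, products and restrictions.\<close>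

definition has_partials :: "(real^3 \<Rightarrow> 'b::real_normed_vector) \<Rightarrow> (3 \<Rightarrow> 'b) \<Rightarrow> real^3 \<Rightarrow> bool" where
  "has_partials f D x \<longleftrightarrow> (f has_derivative (\<lambda>h. \<Sum>j\<in>UNIV. h $ j *\<^sub>R D j)) (at x)"

lemma has_partials_pderiv: "has_partials f D x \<Longrightarrow> pderiv_at j f x = D j"
  unfolding has_partials_def pderiv_at_def
  by (drule frechet_derivative_eq) (simp add: axis_def if_distrib[of "\<lambda>c. c *\<^sub>R _"] cong: if_cong)

lemma has_partials_differentiable: "has_partials f D x \<Longrightarrow> f differentiable at x"
  unfolding has_partials_def differentiable_def by blast

lemma has_partials_iff_differentiable:
  "f differentiable at x \<longleftrightarrow> has_partials f (\<lambda>j. pderiv_at j f x) x"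
proof
  assume d: "f differentiable at x"
  let ?f = "frechet_derivative f (at x)"
  have f: "(f has_derivative ?f) (at x)" using d by (simp add: frechet_derivative_works)
  have "?f h = (\<Sum>j\<in>UNIV. h $ j *\<^sub>R pderiv_at j f x)" for h
  proof -
    interpret linear ?f using f by (rule has_derivative_linear)
    have "?f h = ?f (\<Sum>j\<in>UNIV. h $ j *\<^sub>R axis j 1)"
      by (subst basis_expansion[symmetric]) (simp add: scalar_mult_eq_scaleR)
    also have "\<dots> = (\<Sum>j\<in>UNIV. h $ j *\<^sub>R pderiv_at j f x)"
      by (simp add: sum scale pderiv_at_def)
    finally show ?thesis .
  qed
  then have "?f = (\<lambda>h. \<Sum>j\<in>UNIV. h $ j *\<^sub>R pderiv_at j f x)" by (rule ext)
  with f show "has_partials f (\<lambda>j. pderiv_at j f x) x" by (simp add: has_partials_def)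
qed (rule has_partials_differentiable)

text \<open>Lets a field that is cut off to zero outside the open domain inherit the derivatives of
  the uncut field inside.\<close>

lemma has_partials_cong:
  assumes "has_partials f D x" "open S" "x \<in> S" "\<And>y. y \<in> S \<Longrightarrow> f y = g y"
  shows "has_partials g D x"
  using assms has_derivative_transform_within_open[of f _ x UNIV S g]
  unfolding has_partials_def by auto

lemma has_partials_add:
  "has_partials f D x \<Longrightarrow> has_partials g D' x \<Longrightarrow> has_partials (\<lambda>x. f x + g x) (\<lambda>j. D j + D' j) x"
  unfolding has_partials_def
  by (drule (1) has_derivative_add) (simp add: scaleR_add_right sum.distrib)

lemma has_partials_cmult:
  fixes f :: "real^3 \<Rightarrow> complex"
  shows "has_partials f D x \<Longrightarrow> has_partials (\<lambda>x. c * f x) (\<lambda>j. c * D j) x"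
  unfolding has_partials_def
  by (drule has_derivative_mult_right[of _ _ _ c]) (simp add: sum_distrib_left mult_ac)

lemma has_partials_coord:
  fixes f :: "real^3 \<Rightarrow> complex"
  assumes "has_partials f D x"
  shows "has_partials (\<lambda>x. complex_of_real (x $ i) * f x)
    (\<lambda>j. (if j = i then f x else 0) + complex_of_real (x $ i) * D j) x"
proof -
  have d: "((\<lambda>x. complex_of_real (x $ i)) has_derivative (\<lambda>h. complex_of_real (h $ i))) (at x)"
    by (intro bounded_linear_imp_has_derivative bounded_linear_compose[OF bounded_linear_of_real]
        bounded_linear_vec_nth)
  have "(\<Sum>j\<in>UNIV. h $ j *\<^sub>R ((if j = i then f x else 0) + complex_of_real (x $ i) * D j))
     = complex_of_real (x $ i) * (\<Sum>j\<in>UNIV. h $ j *\<^sub>R D j) + complex_of_real (h $ i) * f x" for h :: "real^3"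
    by (simp add: distrib_left sum.distrib sum_distrib_left if_distrib[of "\<lambda>c. _ * c"] scaleR_conv_of_real
        mult_ac cong: if_cong)
  then show ?thesis
    unfolding has_partials_def
    using has_derivative_mult[OF d, of f] assms[unfolded has_partials_def] by simp
qed

text \<open>A tuple is the finite sum of its entries embedded by bounded linear maps, and such maps
  commute with differentiation.\<close>

lemma has_derivative_vec_lambda_complex:
  fixes f :: "'a::real_normed_vector \<Rightarrow> 'n::finite \<Rightarrow> complex"
  assumes "\<And>i. ((\<lambda>x. f x i) has_derivative f' i) F"
  shows "((\<lambda>x. \<chi> i. f x i) has_derivative (\<lambda>h. \<chi> i. f' i h)) F"
proof -
  have e: "(\<chi> i. c i) = (\<Sum>i\<in>UNIV. \<chi> j. if j = i then c i else 0)" for c :: "'n \<Rightarrow> complex"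
    by (simp add: vec_eq_iff)
  have B: "bounded_linear (\<lambda>c::complex. (\<chi> j. if j = i then c else 0) :: complex^'n)" for i
    unfolding linear_conv_bounded_linear[symmetric] by (rule linearI) (auto simp: vec_eq_iff)
  have "((\<lambda>x. \<Sum>i\<in>UNIV. \<chi> j. if j = i then f x i else 0) has_derivative
      (\<lambda>h. \<Sum>i\<in>UNIV. \<chi> j. if j = i then f' i h else 0)) F"
    by (rule has_derivative_sum) (rule bounded_linear.has_derivative[OF B assms])
  then show ?thesis unfolding e[of "f _"] e[of "\<lambda>i. f' i _"] .
qed

lemma has_partials_vec:
  fixes U :: "3 \<Rightarrow> real^3 \<Rightarrow> complex"
  assumes "\<And>i. has_partials (U i) (D i) x"
  shows "has_partials (\<lambda>x. \<chi> i. U i x) (\<lambda>j. \<chi> i. D i j) x"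
proof -
  have "((\<lambda>x. \<chi> i. U i x) has_derivative (\<lambda>h. \<chi> i. \<Sum>j\<in>UNIV. h $ j *\<^sub>R D i j)) (at x)"
    using assms unfolding has_partials_def by (intro has_derivative_vec_lambda_complex)
  moreover have "(\<lambda>h. \<chi> i. \<Sum>j\<in>UNIV. h $ j *\<^sub>R D i j) = (\<lambda>h::real^3. \<Sum>j\<in>UNIV. h $ j *\<^sub>R (\<chi> i. D i j))"
    by (auto simp: vec_eq_iff)
  ultimately show ?thesis unfolding has_partials_def by simp
qed

section \<open>Fourier modes with profile K_n(\<kappa>r)/r^n\<close>

definition radial_bessel :: "nat \<Rightarrow> real \<Rightarrow> real^3 \<Rightarrow> real" where
  "radial_bessel n c x = bessel_K n (c * radius x) / radius x ^ n"

text \<open>These are the a_n of the explicit solutions. Dividing K_n by r^n keeps all derivatives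
  of the form polynomial in x_1, x_2 times atoms, so that no angular variable ever appears.\<close>

definition atom :: "int \<Rightarrow> nat \<Rightarrow> real^3 \<Rightarrow> complex" where
  "atom k n x = complex_of_real (radial_bessel n (pi * \<bar>real_of_int k\<bar>) x) * cis (pi * of_int k * x $ 3)"

lemma radius_has_derivative:
  assumes "radius x > 0"
  shows "(radius has_derivative (\<lambda>h. (x $ 1 * h $ 1 + x $ 2 * h $ 2) / radius x)) (at x)"
proof -
  have d: "((\<lambda>x::real^3. x $ i) has_derivative (\<lambda>h. h $ i)) (at x)" for i
    by (intro bounded_linear_imp_has_derivative bounded_linear_vec_nth)
  have p: "(x $ 1)\<^sup>2 + (x $ 2)\<^sup>2 > 0" using assms by (simp add: radius_def)
  then have s: "sqrt ((x $ 1)\<^sup>2 + (x $ 2)\<^sup>2) \<noteq> 0" using real_sqrt_gt_zero by fastforce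
  have "((\<lambda>x::real^3. (x $ 1)\<^sup>2 + (x $ 2)\<^sup>2) has_derivative (\<lambda>h. 2 * (x $ 1 * h $ 1 + x $ 2 * h $ 2))) (at x)"
    by (auto intro!: derivative_eq_intros d simp: algebra_simps)
  from has_derivative_compose[OF this DERIV_real_sqrt[OF p, unfolded has_field_derivative_def]]
  show ?thesis
    unfolding radius_def[abs_def] by (rule has_derivative_eq_rhs) (use s in \<open>simp add: fun_eq_iff field_simps\<close>)
qed

lemma radial_bessel_has_derivative:
  assumes "c > 0" "radius x > 0"
  shows "(radial_bessel n c has_derivative
     (\<lambda>h. - c * radial_bessel (Suc n) c x * (x $ 1 * h $ 1 + x $ 2 * h $ 2))) (at x)"
proof -
  let ?r = "radius x"
  let ?d = "c * (real n / (c * ?r) * bessel_K n (c * ?r) - bessel_K (Suc n) (c * ?r)) / ?r ^ n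
     - bessel_K n (c * ?r) * (real n * ?r ^ (n - 1)) / (?r ^ n)\<^sup>2"
  have "((\<lambda>r. bessel_K n (c * r) / r ^ n) has_real_derivative ?d) (at ?r)"
    using assms
    by (auto intro!: derivative_eq_intros DERIV_chain2[OF bessel_K_has_derivative] simp: field_simps power2_eq_square)
  also have "?d = - c * bessel_K (Suc n) (c * ?r) / ?r ^ n"
    using assms by (cases n) (simp_all add: field_simps power2_eq_square)
  finally have D: "((\<lambda>r. bessel_K n (c * r) / r ^ n) has_derivative
      (*) (- c * bessel_K (Suc n) (c * ?r) / ?r ^ n)) (at ?r)"
    by (simp add: has_field_derivative_def)
  show ?thesis
    unfolding radial_bessel_def[abs_def]
    using has_derivative_compose[OF radius_has_derivative[OF assms(2)] D] assms(2)
    by (simp add: field_simps)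
qed

lemma radial_bessel_recurrence:
  assumes "c > 0" "radius x > 0"
  shows "(radius x)\<^sup>2 * radial_bessel (Suc (Suc n)) c x
    = radial_bessel n c x + 2 * real (Suc n) / c * radial_bessel (Suc n) c x"
  using bessel_K_recurrence[of "c * radius x" n] assms
  by (simp add: radial_bessel_def field_simps power2_eq_square)

lemma has_partials_atom:
  assumes "k \<noteq> 0" "radius x > 0"
  shows "has_partials (atom k n)
    (\<lambda>j. if j = 3 then \<i> * of_real (pi * of_int k) * atom k n x
         else - of_real (pi * \<bar>real_of_int k\<bar>) * of_real (x $ j) * atom k (Suc n) x) x"
proof -
  let ?c = "pi * \<bar>real_of_int k\<bar>"
  have c: "?c > 0" using assms by simp
  have 1: "((\<lambda>x. complex_of_real (radial_bessel n ?c x)) has_derivative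
     (\<lambda>h. complex_of_real (- ?c * radial_bessel (Suc n) ?c x * (x $ 1 * h $ 1 + x $ 2 * h $ 2)))) (at x)"
    by (rule bounded_linear.has_derivative[OF bounded_linear_of_real radial_bessel_has_derivative[OF c assms(2)]])
  have 2: "((\<lambda>x::real^3. cis (pi * of_int k * x $ 3)) has_derivative
     (\<lambda>h. of_real (pi * of_int k * h $ 3) * (\<i> * cis (pi * of_int k * x $ 3)))) (at x)"
  proof -
    have d: "((\<lambda>x::real^3. pi * of_int k * x $ 3) has_derivative (\<lambda>h. pi * of_int k * h $ 3)) (at x)"
      by (intro has_derivative_mult_right bounded_linear_imp_has_derivative bounded_linear_vec_nth)
    from has_derivative_cis[OF d] show ?thesis
      by (simp add: scaleR_conv_of_real)
  qed
  show ?thesis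
    unfolding has_partials_def atom_def[abs_def]
    by (rule has_derivative_eq_rhs[OF has_derivative_mult[OF 1 2]])
       (auto simp: fun_eq_iff sum_3 scaleR_conv_of_real algebra_simps)
qed

text \<open>\<open>L\<close> stands for the Laplacian of \<open>f\<close>.\<close>

definition pd2 :: "(real^3 \<Rightarrow> complex) \<Rightarrow> (3 \<Rightarrow> real^3 \<Rightarrow> complex) \<Rightarrow> (real^3 \<Rightarrow> complex) \<Rightarrow> bool" where
  "pd2 f D L \<longleftrightarrow> (\<exists>DD. \<forall>x\<in>Omega 0. has_partials f (\<lambda>j. D j x) x \<and>
     (\<forall>j. has_partials (D j) (\<lambda>l. DD j l x) x) \<and> L x = (\<Sum>j\<in>UNIV. DD j j x))"

lemma pd2_add:
  assumes "pd2 f D L" "pd2 g D' L'"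
  shows "pd2 (\<lambda>x. f x + g x) (\<lambda>j x. D j x + D' j x) (\<lambda>x. L x + L' x)"
proof -
  from assms obtain DD DD' where
    "\<forall>x\<in>Omega 0. has_partials f (\<lambda>j. D j x) x \<and>
     (\<forall>j. has_partials (D j) (\<lambda>l. DD j l x) x) \<and> L x = (\<Sum>j\<in>UNIV. DD j j x)"
    "\<forall>x\<in>Omega 0. has_partials g (\<lambda>j. D' j x) x \<and>
     (\<forall>j. has_partials (D' j) (\<lambda>l. DD' j l x) x) \<and> L' x = (\<Sum>j\<in>UNIV. DD' j j x)"
    unfolding pd2_def by blast
  then show ?thesis unfolding pd2_def
    by (intro exI[of _ "\<lambda>j l x. DD j l x + DD' j l x"]) (auto intro!: has_partials_add simp: sum.distrib)
qed

lemma pd2_cmult: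
  assumes "pd2 f D L"
  shows "pd2 (\<lambda>x. c * f x) (\<lambda>j x. c * D j x) (\<lambda>x. c * L x)"
proof -
  from assms obtain DD where
    "\<forall>x\<in>Omega 0. has_partials f (\<lambda>j. D j x) x \<and>
     (\<forall>j. has_partials (D j) (\<lambda>l. DD j l x) x) \<and> L x = (\<Sum>j\<in>UNIV. DD j j x)"
    unfolding pd2_def by blast
  then show ?thesis unfolding pd2_def
    by (intro exI[of _ "\<lambda>j l x. c * DD j l x"]) (auto intro!: has_partials_cmult simp: sum_distrib_left)
qed

text \<open>A coordinate is harmonic and its gradient is a unit vector, so the product rule adds
  only the cross term to \<open>x $ i\<close> times the Laplacian.\<close>

lemma pd2_coord:
  assumes "pd2 f D L"
  shows "pd2 (\<lambda>x. complex_of_real (x $ i) * f x)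
     (\<lambda>j x. (if j = i then f x else 0) + complex_of_real (x $ i) * D j x)
     (\<lambda>x. complex_of_real (x $ i) * L x + 2 * D i x)"
proof -
  from assms obtain DD where D:
    "\<forall>x\<in>Omega 0. has_partials f (\<lambda>j. D j x) x \<and>
     (\<forall>j. has_partials (D j) (\<lambda>l. DD j l x) x) \<and> L x = (\<Sum>j\<in>UNIV. DD j j x)"
    unfolding pd2_def by blast
  have z: "has_partials (\<lambda>x. 0::complex) (\<lambda>l. 0) x" for x
    by (simp add: has_partials_def)
  have "has_partials (\<lambda>x. (if j = i then f x else 0) + complex_of_real (x $ i) * D j x)
      (\<lambda>l. (if j = i then D l x else 0) + ((if l = i then D j x else 0) + complex_of_real (x $ i) * DD j l x)) x"
    if "x \<in> Omega 0" for x j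
  proof (intro has_partials_add has_partials_coord)
    show "has_partials (\<lambda>x. if j = i then f x else 0) (\<lambda>l. if j = i then D l x else 0) x"
      using D[rule_format, OF that] z by (cases "j = i") simp_all
  qed (use D[rule_format, OF that] in blast)
  moreover have "(\<Sum>j\<in>UNIV. (if j = i then D j x else 0) + ((if j = i then D j x else 0) + complex_of_real (x $ i) * DD j j x))
     = complex_of_real (x $ i) * L x + 2 * D i x" if "x \<in> Omega 0" for x
    using D[rule_format, OF that] by (simp add: sum.distrib flip: sum_distrib_left)
  ultimately show ?thesis unfolding pd2_def using D
    by (intro exI[of _ "\<lambda>j l x. (if j = i then D l x else 0) + ((if l = i then D j x else 0) + complex_of_real (x $ i) * DD j l x)"])
       (auto intro!: has_partials_coord)
qed

definition atom_partial :: "int \<Rightarrow> nat \<Rightarrow> 3 \<Rightarrow> real^3 \<Rightarrow> complex" where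
  "atom_partial k n j x = (if j = 3 then \<i> * of_real (pi * of_int k) * atom k n x
     else - of_real (pi * \<bar>real_of_int k\<bar>) * (of_real (x $ j) * atom k (Suc n) x))"

text \<open>The Bessel recurrence read as a rule for removing the factor r^2; it closes the algebra
  when Laplacians and divergences are computed.\<close>

lemma atom_recurrence:
  assumes "k \<noteq> 0" "x \<in> Omega 0"
  shows "of_real ((x $ 1)\<^sup>2 + (x $ 2)\<^sup>2) * atom k (Suc (Suc n)) x
    = atom k n x + of_real (2 * real (Suc n) / (pi * \<bar>real_of_int k\<bar>)) * atom k (Suc n) x"
proof -
  have "(radius x)\<^sup>2 * radial_bessel (Suc (Suc n)) (pi * \<bar>real_of_int k\<bar>) x
    = radial_bessel n (pi * \<bar>real_of_int k\<bar>) x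
      + 2 * real (Suc n) / (pi * \<bar>real_of_int k\<bar>) * radial_bessel (Suc n) (pi * \<bar>real_of_int k\<bar>) x"
    using assms by (intro radial_bessel_recurrence) (auto simp: Omega_def)
  then have "complex_of_real ((x $ 1)\<^sup>2 + (x $ 2)\<^sup>2) * of_real (radial_bessel (Suc (Suc n)) (pi * \<bar>real_of_int k\<bar>) x)
    = of_real (radial_bessel n (pi * \<bar>real_of_int k\<bar>) x)
      + of_real (2 * real (Suc n) / (pi * \<bar>real_of_int k\<bar>)) * of_real (radial_bessel (Suc n) (pi * \<bar>real_of_int k\<bar>) x)"
    unfolding radius_square of_real_mult[symmetric] of_real_add[symmetric] by (simp only:)
  then show ?thesis
    unfolding atom_def mult.assoc[symmetric] by (simp only: distrib_right)
qed

text \<open>The second derivatives add up to -2 \<kappa> a_{n+1} + \<kappa>^2 r^2 a_{n+2} -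
  \<kappa>^2 a_n, and the recurrence turns the middle term into \<kappa>^2 a_n + 2 (n+1) \<kappa>
  a_{n+1}. For n = 0 the result is zero.\<close>

lemma pd2_atom:
  assumes "k \<noteq> 0"
  shows "pd2 (atom k n) (atom_partial k n)
     (\<lambda>x. of_real (2 * real n * (pi * \<bar>real_of_int k\<bar>)) * atom k (Suc n) x)"
proof -
  let ?c = "complex_of_real (pi * \<bar>real_of_int k\<bar>)"
  let ?DD = "\<lambda>j l x. if j = 3 then \<i> * of_real (pi * of_int k) * atom_partial k n l x
     else - ?c * ((if l = j then atom k (Suc n) x else 0) + of_real (x $ j) * atom_partial k (Suc n) l x)"
  have p: "has_partials (atom k m) (\<lambda>j. atom_partial k m j x) x" if "x \<in> Omega 0" for x m
    using has_partials_atom[OF assms, of x m] that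
    by (simp add: atom_partial_def Omega_def mult.assoc cong: if_cong)
  have "has_partials (atom_partial k n j) (\<lambda>l. ?DD j l x) x" if "x \<in> Omega 0" for x j
  proof (cases "j = 3")
    case True
    then show ?thesis
      using has_partials_cmult[OF p[OF that], of "\<i> * of_real (pi * of_int k)" n]
      by (simp add: atom_partial_def[abs_def])
  next
    case False
    have e: "atom_partial k n j = (\<lambda>x. - ?c * (of_real (x $ j) * atom k (Suc n) x))"
      using False by (simp add: atom_partial_def fun_eq_iff)
    show ?thesis
      using has_partials_cmult[OF has_partials_coord[OF p[OF that], of j], of "- ?c" "Suc n"] False
      unfolding e by simp
  qed
  moreover have "of_real (2 * real n * (pi * \<bar>real_of_int k\<bar>)) * atom k (Suc n) x = (\<Sum>j\<in>UNIV. ?DD j j x)"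
    if x: "x \<in> Omega 0" for x
  proof -
    have c0: "?c \<noteq> 0" using assms by simp
    have "?c * of_real (2 * real (Suc n) / (pi * \<bar>real_of_int k\<bar>)) = of_real (2 * real (Suc n))"
      using assms unfolding of_real_mult[symmetric] by (simp del: of_nat_Suc)
    then have R: "?c * (of_real ((x $ 1)\<^sup>2 + (x $ 2)\<^sup>2) * atom k (Suc (Suc n)) x)
      = ?c * atom k n x + of_real (2 * real (Suc n)) * atom k (Suc n) x"
      unfolding atom_recurrence[OF assms x, of n] distrib_left mult.assoc[symmetric] by (simp only:)
    have k2: "(complex_of_real (pi * of_int k))\<^sup>2 = ?c\<^sup>2"
      unfolding of_real_power[symmetric] by (simp add: power_mult_distrib)
    have "(\<Sum>j\<in>UNIV. ?DD j j x) = - 2 * ?c * atom k (Suc n) x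
       + ?c * (?c * (of_real ((x $ 1)\<^sup>2 + (x $ 2)\<^sup>2) * atom k (Suc (Suc n)) x))
       - (complex_of_real (pi * of_int k))\<^sup>2 * atom k n x"
      by (simp add: sum_3 atom_partial_def algebra_simps power2_eq_square)
    also have "\<dots> = of_real (2 * real n * (pi * \<bar>real_of_int k\<bar>)) * atom k (Suc n) x"
      unfolding R k2 by (simp add: algebra_simps power2_eq_square)
    finally show ?thesis by simp
  qed
  ultimately show ?thesis unfolding pd2_def
    by (intro exI[of _ ?DD] ballI conjI allI p) assumption+
qed

text \<open>A class that contains the explicit fields and is closed under differentiation on r > 0,
  so regularity, decay and periodicity are settled once by induction. Multiplication by the third
  coordinate is left out because it would destroy periodicity.\<close>

inductive_set modes :: "int \<Rightarrow> (real^3 \<Rightarrow> complex) set" for k where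
  atom: "atom k n \<in> modes k"
| coord: "f \<in> modes k \<Longrightarrow> i \<noteq> 3 \<Longrightarrow> (\<lambda>x. complex_of_real (x $ i) * f x) \<in> modes k"
| add: "f \<in> modes k \<Longrightarrow> g \<in> modes k \<Longrightarrow> (\<lambda>x. f x + g x) \<in> modes k"
| cmult: "f \<in> modes k \<Longrightarrow> (\<lambda>x. c * f x) \<in> modes k"

lemma modes_partials:
  assumes "k \<noteq> 0" "f \<in> modes k"
  shows "\<exists>D. (\<forall>j. D j \<in> modes k) \<and> (\<forall>x\<in>Omega 0. has_partials f (\<lambda>j. D j x) x)"
  using assms(2)
proof induction
  case (atom n)
  have "atom_partial k n j \<in> modes k" for j
  proof (cases "j = 3")
    case True
    then show ?thesis using modes.cmult[OF modes.atom] by (simp add: atom_partial_def[abs_def])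
  next
    case False
    then have e: "atom_partial k n j = (\<lambda>x. - of_real (pi * \<bar>real_of_int k\<bar>) * (of_real (x $ j) * atom k (Suc n) x))"
      by (simp add: atom_partial_def fun_eq_iff)
    show ?thesis unfolding e by (intro modes.cmult modes.coord modes.atom False)
  qed
  moreover have "has_partials (atom k n) (\<lambda>j. atom_partial k n j x) x" if "x \<in> Omega 0" for x
    using has_partials_atom[OF assms(1), of x n] that
    by (simp add: atom_partial_def Omega_def mult.assoc cong: if_cong)
  ultimately show ?case by blast
next
  case (coord f i)
  then obtain D where D: "\<forall>j. D j \<in> modes k" "\<forall>x\<in>Omega 0. has_partials f (\<lambda>j. D j x) x" by blast
  have "(\<lambda>x. (if j = i then f x else 0) + complex_of_real (x $ i) * D j x) \<in> modes k" for j
  proof (cases "j = i")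
    case True
    then show ?thesis using modes.add[OF coord.hyps(1) modes.coord[OF D(1)[rule_format] coord.hyps(2)]] by simp
  next
    case False
    then show ?thesis using modes.coord[OF D(1)[rule_format] coord.hyps(2)] by simp
  qed
  moreover have "has_partials (\<lambda>x. complex_of_real (x $ i) * f x)
      (\<lambda>j. (if j = i then f x else 0) + complex_of_real (x $ i) * D j x) x" if "x \<in> Omega 0" for x
    using D(2) that by (intro has_partials_coord) auto
  ultimately show ?case
    by (intro exI[of _ "\<lambda>j x. (if j = i then f x else 0) + complex_of_real (x $ i) * D j x"] conjI allI ballI)
next
  case (add f g)
  then obtain D D' where "\<forall>j. D j \<in> modes k" "\<forall>x\<in>Omega 0. has_partials f (\<lambda>j. D j x) x"
    "\<forall>j. D' j \<in> modes k" "\<forall>x\<in>Omega 0. has_partials g (\<lambda>j. D' j x) x" by blast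
  then show ?case
    by (intro exI[of _ "\<lambda>j x. D j x + D' j x"]) (auto intro: modes.add has_partials_add)
next
  case (cmult f c)
  then obtain D where "\<forall>j. D j \<in> modes k" "\<forall>x\<in>Omega 0. has_partials f (\<lambda>j. D j x) x" by blast
  then show ?case
    by (intro exI[of _ "\<lambda>j x. c * D j x"]) (auto intro: modes.cmult has_partials_cmult)
qed

lemma modes_continuous_on:
  assumes "k \<noteq> 0" "f \<in> modes k" shows "continuous_on (Omega 0) f"
  using modes_partials[OF assms] has_partials_differentiable
  by (metis continuous_at_imp_continuous_on differentiable_imp_continuous_within)

lemma Omega_mono: "0 \<le> \<epsilon> \<Longrightarrow> Omega \<epsilon> \<subseteq> Omega 0"
  by (auto simp: Omega_def)

text \<open>Partials of a mode are modes, so the induction on the order never leaves the class.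
  Agreement of \<open>g\<close> with \<open>f\<close> is asked only on the domain, since the
  solutions are set to zero outside it.\<close>

lemma modes_Ck_on:
  assumes k: "k \<noteq> 0" and \<epsilon>: "0 \<le> \<epsilon>" and "f \<in> modes k" "\<And>x. x \<in> Omega \<epsilon> \<Longrightarrow> g x = f x"
  shows "Ck_on m (Omega \<epsilon>) g"
  using assms(3,4)
proof (induction m arbitrary: f g)
  case 0
  then have "continuous_on (Omega \<epsilon>) f"
    using modes_continuous_on[OF k] Omega_mono[OF \<epsilon>] continuous_on_subset by blast
  then show ?case using 0 by (simp cong: continuous_on_cong)
next
  case (Suc m)
  obtain D where D: "\<And>j. D j \<in> modes k" "\<And>x. x \<in> Omega 0 \<Longrightarrow> has_partials f (\<lambda>j. D j x) x"
    using modes_partials[OF k Suc.prems(1)] by blast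
  have g: "has_partials g (\<lambda>j. D j x) x" if x: "x \<in> Omega \<epsilon>" for x
    using Suc.prems(2) x Omega_mono[OF \<epsilon>] by (intro has_partials_cong[OF D(2) open_Omega x]) auto
  have "Ck_on m (Omega \<epsilon>) (pderiv_at j g)" for j
    using Suc.IH[OF D(1)] g has_partials_pderiv by blast
  moreover have "g differentiable_on Omega \<epsilon>"
    using g has_partials_differentiable differentiable_at_withinI
    unfolding differentiable_on_def by blast
  ultimately show ?case by simp
qed

lemma modes_Ck_on_vec:
  fixes g :: "real^3 \<Rightarrow> complex^3"
  assumes k: "k \<noteq> 0" and \<epsilon>: "0 \<le> \<epsilon>" and "\<And>i. U i \<in> modes k" "\<And>x. x \<in> Omega \<epsilon> \<Longrightarrow> g x = (\<chi> i. U i x)"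
  shows "Ck_on m (Omega \<epsilon>) g"
  using assms(3,4)
proof (induction m arbitrary: U g)
  case 0
  have "continuous_on (Omega \<epsilon>) (U i)" for i
    using modes_continuous_on[OF k 0(1)] Omega_mono[OF \<epsilon>] continuous_on_subset by blast
  then have "continuous_on (Omega \<epsilon>) (\<lambda>x. \<chi> i. U i x)"
    by (intro continuous_on_vec_lambda)
  then show ?case using 0(2) by (simp cong: continuous_on_cong)
next
  case (Suc m)
  have "\<forall>i. \<exists>D. (\<forall>j. D j \<in> modes k) \<and> (\<forall>x\<in>Omega 0. has_partials (U i) (\<lambda>j. D j x) x)"
    using modes_partials[OF k Suc.prems(1)] by blast
  then obtain D where D: "\<And>i j. D i j \<in> modes k" "\<And>i x. x \<in> Omega 0 \<Longrightarrow> has_partials (U i) (\<lambda>j. D i j x) x"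
    by metis
  have g: "has_partials g (\<lambda>j. \<chi> i. D i j x) x" if x: "x \<in> Omega \<epsilon>" for x
    using Suc.prems(2) x Omega_mono[OF \<epsilon>]
    by (intro has_partials_cong[OF has_partials_vec[OF D(2)] open_Omega x]) auto
  have "Ck_on m (Omega \<epsilon>) (pderiv_at j g)" for j
    by (rule Suc.IH[of "\<lambda>i. D i j"]) (use D(1) g has_partials_pderiv in blast)+
  moreover have "g differentiable_on Omega \<epsilon>"
    using g has_partials_differentiable differentiable_at_withinI
    unfolding differentiable_on_def by blast
  ultimately show ?case by simp
qed

lemma linear_le_exp: assumes "a > 0" shows "r \<le> exp (a * r) / (a::real)"
proof -
  have "a * r \<le> exp (a * r)" using exp_ge_add_one_self[of "a * r"] by linarith
  then show ?thesis using assms by (simp add: field_simps)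
qed

text \<open>Factors x_1, x_2 consume an arbitrarily small part of the decay rate \<kappa>, so every
  smaller rate is reached. For this the rate has to stay general in the induction.\<close>

lemma modes_exp_decay:
  assumes k: "k \<noteq> 0" and r0: "r0 > 0" and "f \<in> modes k" and "c < pi * \<bar>real_of_int k\<bar>"
  shows "\<exists>C\<ge>0. \<forall>x. r0 \<le> radius x \<longrightarrow> norm (f x) \<le> C * exp (- c * radius x)"
  using assms(3,4)
proof (induction arbitrary: c)
  case (atom n)
  let ?\<kappa> = "pi * \<bar>real_of_int k\<bar>"
  have \<kappa>: "?\<kappa> > 0" using k by simp
  let ?C = "exp (?\<kappa> * r0) * bessel_K n (?\<kappa> * r0) / r0 ^ n"
  have K: "bessel_K n (?\<kappa> * r0) > 0" using \<kappa> r0 by (intro bessel_K_pos) auto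
  have "norm (atom k n x) \<le> ?C * exp (- c * radius x)" if x: "r0 \<le> radius x" for x
  proof -
    have rx: "radius x > 0" using x r0 by simp
    have "norm (atom k n x) = bessel_K n (?\<kappa> * radius x) / radius x ^ n"
      using bessel_K_pos[of "?\<kappa> * radius x" n] \<kappa> rx
      by (simp add: atom_def norm_mult norm_divide norm_power radial_bessel_def)
    also have "\<dots> \<le> exp (- (?\<kappa> * radius x - ?\<kappa> * r0)) * bessel_K n (?\<kappa> * r0) / r0 ^ n"
      using \<kappa> x r0 K by (intro frac_le bessel_K_exp_decay power_mono mult_left_mono) auto
    also have "\<dots> = ?C * exp (- ?\<kappa> * radius x)"
      by (simp add: exp_diff exp_minus field_simps)
    also have "\<dots> \<le> ?C * exp (- c * radius x)"
      using atom rx K r0 by (intro mult_left_mono) auto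
    finally show ?thesis .
  qed
  moreover have "?C \<ge> 0" using K r0 by simp
  ultimately show ?case by blast
next
  case (coord f i)
  \<comment> \<open>The induction hypothesis is used at the rate halfway between \<open>c\<close>
    and \<kappa>; the gap \<open>?c - c\<close> absorbs the linear growth of the coordinate.\<close>
  let ?c = "(c + pi * \<bar>real_of_int k\<bar>) / 2"
  have c: "?c < pi * \<bar>real_of_int k\<bar>" "?c > c" using coord.prems by auto
  obtain C where C: "C \<ge> 0" "\<And>x. r0 \<le> radius x \<Longrightarrow> norm (f x) \<le> C * exp (- ?c * radius x)"
    using coord.IH[OF c(1)] by blast
  have "norm (complex_of_real (x $ i) * f x) \<le> C / (?c - c) * exp (- c * radius x)" if x: "r0 \<le> radius x" for x
  proof -
    have "i = 1 \<or> i = 2" using UNIV_3_cases[of i] coord.hyps by auto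
    then have "\<bar>x $ i\<bar> \<le> radius x" using radius_le[of x] by auto
    also have "\<dots> \<le> exp ((?c - c) * radius x) / (?c - c)" using c by (intro linear_le_exp) simp
    finally have "norm (complex_of_real (x $ i) * f x)
        \<le> (exp ((?c - c) * radius x) / (?c - c)) * (C * exp (- ?c * radius x))"
      unfolding norm_mult norm_of_real using C x c by (intro mult_mono) auto
    also have "\<dots> = C / (?c - c) * (exp ((?c - c) * radius x) * exp (- ?c * radius x))"
      by (simp only: times_divide_eq_left times_divide_eq_right mult_ac)
    also have "exp ((?c - c) * radius x) * exp (- ?c * radius x) = exp (- c * radius x)"
      unfolding exp_add[symmetric] by (simp add: algebra_simps)
    finally show ?thesis .
  qed
  moreover have "C / (?c - c) \<ge> 0" using C c by simp
  ultimately show ?case by blast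
next
  case (add f g)
  obtain C C' where C: "C \<ge> 0" "\<And>x. r0 \<le> radius x \<Longrightarrow> norm (f x) \<le> C * exp (- c * radius x)"
    "C' \<ge> 0" "\<And>x. r0 \<le> radius x \<Longrightarrow> norm (g x) \<le> C' * exp (- c * radius x)"
    using add.IH[OF add.prems] by blast
  have "norm (f x + g x) \<le> (C + C') * exp (- c * radius x)" if "r0 \<le> radius x" for x
    using norm_triangle_mono[OF C(2)[OF that] C(4)[OF that]] by (simp add: algebra_simps)
  then show ?case using C(1,3) by (intro exI[of _ "C + C'"]) auto
next
  case (cmult f d)
  obtain C where C: "C \<ge> 0" "\<And>x. r0 \<le> radius x \<Longrightarrow> norm (f x) \<le> C * exp (- c * radius x)"
    using cmult.IH[OF cmult.prems] by blast
  have "norm (d * f x) \<le> (norm d * C) * exp (- c * radius x)" if "r0 \<le> radius x" for x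
    unfolding norm_mult using mult_left_mono[OF C(2)[OF that], of "norm d"] by (simp add: mult.assoc)
  then show ?case using C(1) by (intro exI[of _ "norm d * C"]) auto
qed

lemma modes_periodic:
  assumes "f \<in> modes k" shows "f (x + axis 3 2) = f x"
  using assms
proof induction
  case (atom n)
  have "radius (x + axis 3 2) = radius x" by (simp add: radius_def axis_def)
  moreover have "cis (pi * of_int k * (x $ 3 + 2)) = cis (pi * of_int k * x $ 3)"
    using cis_multiple_2pi[of "of_int k"] by (simp add: distrib_left mult_ac flip: cis_mult)
  ultimately show ?case by (simp add: atom_def radial_bessel_def axis_def)
next
  case (coord f i)
  then show ?case by (simp add: axis_def)
qed simp_all

section \<open>Mode functions as finite-energy Stokes solutions\<close>

definition vec3 :: "real \<times> real \<times> real \<Rightarrow> real^3" where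
  "vec3 q = vector [fst q, fst (snd q), snd (snd q)]"

lemma vec3_components: "vec3 (a, b, c) $ 1 = a" "vec3 (a, b, c) $ 2 = b" "vec3 (a, b, c) $ 3 = c"
  by (simp_all add: vec3_def)

lemma continuous_on_vec3: "continuous_on S vec3"
proof -
  have e: "vec3 = (\<lambda>q. \<chi> i. if i = 1 then fst q else if i = 2 then fst (snd q) else snd (snd q))"
    by (auto simp: vec3_def fun_eq_iff vec_eq_iff forall_3)
  have c: "continuous_on S (\<lambda>q. if i = 1 then fst q else if i = 2 then fst (snd q) else snd (snd q))" for i :: 3
    by (cases "i = 1"; cases "i = 2") (auto intro!: continuous_intros)
  show ?thesis unfolding e by (rule continuous_on_vec_lambda) (rule c)
qed

lemma measurable_vec3 [measurable]: "vec3 \<in> borel_measurable borel"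
  by (intro borel_measurable_continuous_onI continuous_on_vec3)

text \<open>Both measures agree on boxes. This makes iterated integration in the three coordinates
  available.\<close>

lemma lborel_real3: "(lborel :: (real^3) measure) = distr lborel borel vec3"
proof (rule lborel_eqI)
  fix l u :: "real^3" assume le: "\<And>b. b \<in> Basis \<Longrightarrow> l \<bullet> b \<le> u \<bullet> b"
  have le': "l $ i \<le> u $ i" for i
    using le[of "axis i 1"] by (simp add: inner_axis axis_in_Basis_iff)
  have "vec3 -` box l u = {l $ 1<..<u $ 1} \<times> {l $ 2<..<u $ 2} \<times> {l $ 3<..<u $ 3}"
    by (auto simp: mem_box_cart vec3_def forall_3)
  then have e1: "emeasure (distr lborel borel vec3) (box l u)
     = emeasure lborel ({l $ 1<..<u $ 1} \<times> ({l $ 2<..<u $ 2} \<times> {l $ 3<..<u $ 3}))"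
    by (simp add: emeasure_distr)
  have e2: "emeasure lborel ({l $ 1<..<u $ 1} \<times> ({l $ 2<..<u $ 2} \<times> {l $ 3<..<u $ 3}))
    = emeasure lborel {l $ 1<..<u $ 1} * emeasure lborel ({l $ 2<..<u $ 2} \<times> {l $ 3<..<u $ 3})"
    by (subst lborel_prod[symmetric], rule lborel.emeasure_pair_measure_Times) (auto simp: borel_Times)
  have e3: "emeasure lborel ({l $ 2<..<u $ 2} \<times> {l $ 3<..<u $ 3})
      = emeasure lborel {l $ 2<..<u $ 2} * emeasure lborel {l $ 3<..<u $ 3}"
    by (subst lborel_prod[symmetric], rule lborel.emeasure_pair_measure_Times) auto
  have p: "(\<Prod>i\<in>UNIV. u $ i - l $ i) = (u $ 1 - l $ 1) * ((u $ 2 - l $ 2) * (u $ 3 - l $ 3))"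
    unfolding UNIV_3 by simp
  have "emeasure (distr lborel borel vec3) (box l u) = ennreal (\<Prod>i\<in>UNIV. u $ i - l $ i)"
    unfolding e1 e2 e3 p using le'[of 1] le'[of 2] le'[of 3] by (simp add: ennreal_mult)
  moreover have "(\<Prod>i\<in>UNIV. u $ i - l $ i) = measure lborel (cbox l u)"
    using le' by (subst content_cbox_cart) (simp_all add: interval_ne_empty_cart)
  moreover have "measure lborel (cbox l u) = (\<Prod>b\<in>Basis. (u - l) \<bullet> b)"
    using le by (simp add: measure_lborel_cbox_eq)
  ultimately show "emeasure (distr lborel borel vec3) (box l u) = (\<Prod>b\<in>Basis. (u - l) \<bullet> b)"
    by (simp only:)
qed simp

lemma nn_integral_lborel_prod:
  fixes f :: "'a::euclidean_space \<times> 'b::euclidean_space \<Rightarrow> ennreal"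
  assumes "f \<in> borel_measurable borel"
  shows "(\<integral>\<^sup>+q. f q \<partial>lborel) = (\<integral>\<^sup>+a. \<integral>\<^sup>+b. f (a, b) \<partial>lborel \<partial>lborel)"
  using lborel.nn_integral_fst[of f lborel] assms by (simp add: lborel_prod)

lemma nn_integral_exp_abs: assumes "c > 0" shows "(\<integral>\<^sup>+t. ennreal (exp (- c * \<bar>t\<bar>)) \<partial>lborel) < \<infinity>"
proof -
  have h: "(\<integral>\<^sup>+t. ennreal (exp (- c * t)) * indicator {0..} t \<partial>lborel) < \<infinity>"
  proof -
    have "(\<lambda>t. exp (- c * t)) absolutely_integrable_on {0::real..}"
      using assms by (intro nonnegative_absolutely_integrable_1 integrable_on_exp_minus_to_infinity) auto
    then have "set_integrable lborel {0..} (\<lambda>t::real. exp (- c * t))"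
      unfolding set_integrable_def by (subst (asm) integrable_completion) auto
    then have "(\<integral>\<^sup>+t. ennreal (norm (indicator {0..} t *\<^sub>R exp (- c * t))) \<partial>lborel) < \<infinity>"
      unfolding set_integrable_def integrable_iff_bounded by simp
    also have "(\<lambda>t. ennreal (norm (indicator {0..} t *\<^sub>R exp (- c * t))))
        = (\<lambda>t. ennreal (exp (- c * t)) * indicator {0..} t)"
      by (auto simp: indicator_def)
    finally show ?thesis .
  qed
  have "(\<integral>\<^sup>+t. ennreal (exp (- c * \<bar>t\<bar>)) \<partial>lborel)
    \<le> (\<integral>\<^sup>+t. ennreal (exp (- c * t)) * indicator {0..} t + ennreal (exp (- c * (- t))) * indicator {0..} (- t) \<partial>lborel)"
    by (intro nn_integral_mono) (auto simp: indicator_def)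
  also have "\<dots> = (\<integral>\<^sup>+t. ennreal (exp (- c * t)) * indicator {0..} t \<partial>lborel)
      + (\<integral>\<^sup>+t. ennreal (exp (- c * (- t))) * indicator {0..} (- t) \<partial>lborel)"
    by (intro nn_integral_add) auto
  also have "(\<integral>\<^sup>+t. ennreal (exp (- c * (- t))) * indicator {0..} (- t) \<partial>lborel)
      = (\<integral>\<^sup>+t. ennreal (exp (- c * t)) * indicator {0..} t \<partial>lborel)"
    using nn_integral_real_affine[of "\<lambda>t. ennreal (exp (- c * t)) * indicator {0..} t" "-1" 0] by simp
  finally show ?thesis using h by (auto simp: less_top[symmetric] ennreal_add_eq_top top_unique)
qed

lemma Omega_cell_measurable [measurable]: "Omega_cell \<epsilon> \<in> sets borel"
proof -
  have "Omega_cell \<epsilon> = Omega \<epsilon> \<inter> {x. -1 \<le> x $ 3} \<inter> {x. x $ 3 < 1}"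
    by (auto simp: Omega_cell_def)
  moreover have "closed {x::real^3. -1 \<le> x $ 3}" "open {x::real^3. x $ 3 < 1}"
    by (auto intro!: closed_Collect_le open_Collect_less continuous_intros)
  ultimately show ?thesis using open_Omega by (simp add: borel_open borel_closed)
qed

text \<open>The radius is at least (|x_1| + |x_2|)/2, which bounds the exponential by a product of
  one-dimensional ones; the third coordinate runs over a bounded interval.\<close>

lemma exp_radius_integrable:
  assumes "c > 0" shows "set_integrable lborel (Omega_cell \<epsilon>) (\<lambda>x. exp (- c * radius x))"
proof -
  let ?e = "\<lambda>t. ennreal (exp (- (c/2) * \<bar>t\<bar>))"
  have [measurable]: "radius \<in> borel_measurable borel"
    by (intro borel_measurable_continuous_onI continuous_intros)
  have m1: "(\<lambda>y::real\<times>real. ?e (fst y) * indicator {-1..1} (snd y)) \<in> borel_measurable borel"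
    unfolding borel_prod[symmetric] by measurable
  have m0: "(\<lambda>q::real\<times>real\<times>real. ?e (fst q) * (?e (fst (snd q)) * indicator {-1..1} (snd (snd q)))) \<in> borel_measurable borel"
    unfolding borel_prod[symmetric] by measurable
  have "(\<integral>\<^sup>+x. ennreal (norm (indicator (Omega_cell \<epsilon>) x *\<^sub>R exp (- c * radius x))) \<partial>lborel)
    = (\<integral>\<^sup>+q. ennreal (norm (indicator (Omega_cell \<epsilon>) (vec3 q) *\<^sub>R exp (- c * radius (vec3 q)))) \<partial>lborel)"
    by (subst lborel_real3, rule nn_integral_distr) measurable
  also have "\<dots> \<le> (\<integral>\<^sup>+(q :: real \<times> real \<times> real). ?e (fst q) * (?e (fst (snd q)) * indicator {-1..1} (snd (snd q))) \<partial>lborel)"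
  proof (rule nn_integral_mono)
    fix q :: "real \<times> real \<times> real"
    obtain a b d where q: "q = (a, b, d)" by (cases q) auto
    have "\<bar>a\<bar> \<le> radius (vec3 q)" "\<bar>b\<bar> \<le> radius (vec3 q)"
      using radius_le[of "vec3 q"] by (simp_all add: q vec3_components)
    then have "(\<bar>a\<bar> + \<bar>b\<bar>) / 2 \<le> radius (vec3 q)" by simp
    then have "c * ((\<bar>a\<bar> + \<bar>b\<bar>) / 2) \<le> c * radius (vec3 q)" using assms by (intro mult_left_mono) auto
    then have "exp (- c * radius (vec3 q)) \<le> exp (- (c/2) * \<bar>a\<bar>) * exp (- (c/2) * \<bar>b\<bar>)"
      unfolding exp_add[symmetric] by (simp add: field_simps)
    then show "ennreal (norm (indicator (Omega_cell \<epsilon>) (vec3 q) *\<^sub>R exp (- c * radius (vec3 q))))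
        \<le> ?e (fst q) * (?e (fst (snd q)) * indicator {-1..1} (snd (snd q)))"
      by (auto simp: q indicator_def Omega_cell_def vec3_components ennreal_mult[symmetric] ennreal_leI)
  qed
  also have "\<dots> = (\<integral>\<^sup>+a. \<integral>\<^sup>+(y::real\<times>real). ?e a * (?e (fst y) * indicator {-1..1} (snd y)) \<partial>lborel \<partial>lborel)"
    by (subst nn_integral_lborel_prod[OF m0]) simp
  also have "\<dots> = (\<integral>\<^sup>+a. ?e a * (\<integral>\<^sup>+(y::real\<times>real). ?e (fst y) * indicator {-1..1} (snd y) \<partial>lborel) \<partial>lborel)"
    using m1 by (intro nn_integral_cong nn_integral_cmult) simp
  also have "\<dots> = (\<integral>\<^sup>+a. ?e a \<partial>lborel) * (\<integral>\<^sup>+(y::real\<times>real). ?e (fst y) * indicator {-1..1} (snd y) \<partial>lborel)"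
    by (intro nn_integral_multc) simp
  also have "\<dots> < \<infinity>"
  proof -
    have "(\<integral>\<^sup>+(y::real\<times>real). ?e (fst y) * indicator {-1..1} (snd y) \<partial>lborel)
      = (\<integral>\<^sup>+b. \<integral>\<^sup>+d. ?e b * indicator {-1..1::real} d \<partial>lborel \<partial>lborel)"
      by (subst nn_integral_lborel_prod[OF m1]) simp
    also have "\<dots> = (\<integral>\<^sup>+b. ?e b * 2 \<partial>lborel)"
      by (intro nn_integral_cong) (subst nn_integral_cmult, auto)
    also have "\<dots> = (\<integral>\<^sup>+b. ?e b \<partial>lborel) * 2"
      by (intro nn_integral_multc) simp
    finally show ?thesis
      using nn_integral_exp_abs[of "c/2"] assms by (simp add: ennreal_mult_less_top)
  qed
  finally show ?thesis
    unfolding set_integrable_def by (intro integrableI_bounded) auto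
qed

text \<open>Since |k| >= 1 and pi > 1, the rate 1 lies below \<kappa> for every nonzero mode, which
  gives one majorant for all later estimates.\<close>

lemma modes_vec_bound:
  assumes "k \<noteq> 0" "r0 > 0" "\<And>i. V i \<in> modes k"
  shows "\<exists>C\<ge>0. \<forall>x. r0 \<le> radius x \<longrightarrow> norm (\<chi> i. V i x) \<le> C * exp (- radius x)"
proof -
  have "1 < pi * \<bar>real_of_int k\<bar>"
  proof -
    have "1 \<le> \<bar>real_of_int k\<bar>" using assms(1) by linarith
    then have "pi * 1 \<le> pi * \<bar>real_of_int k\<bar>" by (intro mult_left_mono) auto
    then show ?thesis using pi_gt3 by linarith
  qed
  then have "\<forall>i. \<exists>C\<ge>0. \<forall>x. r0 \<le> radius x \<longrightarrow> norm (V i x) \<le> C * exp (- 1 * radius x)"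
    using modes_exp_decay[OF assms(1,2,3)] by blast
  then obtain C where C: "\<And>i. C i \<ge> 0" "\<And>i x. r0 \<le> radius x \<Longrightarrow> norm (V i x) \<le> C i * exp (- 1 * radius x)"
    by metis
  have "norm (\<chi> i. V i x) \<le> (\<Sum>i\<in>UNIV. C i) * exp (- radius x)" if "r0 \<le> radius x" for x
  proof -
    have "norm (\<chi> i. V i x) \<le> (\<Sum>i\<in>UNIV. norm (V i x))"
      unfolding norm_vec_def by (rule order.trans[OF L2_set_le_sum]) simp_all
    also have "\<dots> \<le> (\<Sum>i\<in>UNIV. C i * exp (- 1 * radius x))"
      using C(2)[OF that] by (intro sum_mono) auto
    finally show ?thesis by (simp add: sum_distrib_right)
  qed
  then show ?thesis using C(1) by (intro exI[of _ "\<Sum>i\<in>UNIV. C i"]) (auto intro: sum_nonneg)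
qed

lemma modes_vec_continuous_on:
  assumes "k \<noteq> 0" "\<And>i. V i \<in> modes k" shows "continuous_on (Omega 0) (\<lambda>x. \<chi> i. V i x)"
  by (intro continuous_on_vec_lambda modes_continuous_on[OF assms])

lemma modes_vec_square_integrable:
  assumes "k \<noteq> 0" "\<epsilon> > 0" "\<And>i. V i \<in> modes k" "\<And>x. x \<in> Omega \<epsilon> \<Longrightarrow> norm (g x) = norm (\<chi> i. V i x)"
  shows "set_integrable lborel (Omega_cell \<epsilon>) (\<lambda>x. (norm (g x))\<^sup>2)"
proof -
  obtain C where C: "C \<ge> 0" "\<And>x. \<epsilon> \<le> radius x \<Longrightarrow> norm (\<chi> i. V i x) \<le> C * exp (- radius x)"
    using modes_vec_bound[where V=V, OF assms(1,2,3)] by blast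
  have "set_integrable lborel (Omega_cell \<epsilon>) (\<lambda>x. (norm (\<chi> i. V i x))\<^sup>2)"
  proof (rule set_integrable_bound)
    show "set_integrable lborel (Omega_cell \<epsilon>) (\<lambda>x. C\<^sup>2 * exp (- 2 * radius x))"
      by (intro set_integrable_mult_right exp_radius_integrable) auto
    have "Omega_cell \<epsilon> \<subseteq> Omega 0" using assms(2) by (auto simp: Omega_cell_def Omega_def)
    then have "continuous_on (Omega_cell \<epsilon>) (\<lambda>x. (norm (\<chi> i. V i x))\<^sup>2)"
      by (intro continuous_on_power continuous_on_norm continuous_on_subset[OF modes_vec_continuous_on[where V=V, OF assms(1,3)]])
    from borel_measurable_continuous_on_indicator[OF Omega_cell_measurable this]
    show "set_borel_measurable lborel (Omega_cell \<epsilon>) (\<lambda>x. (norm (\<chi> i. V i x))\<^sup>2)"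
      unfolding set_borel_measurable_def by simp
    have "(norm (\<chi> i. V i x))\<^sup>2 \<le> C\<^sup>2 * exp (- 2 * radius x)" if "x \<in> Omega_cell \<epsilon>" for x
    proof -
      have "(norm (\<chi> i. V i x))\<^sup>2 \<le> (C * exp (- radius x))\<^sup>2"
        using C(2)[of x] that by (intro power_mono) (auto simp: Omega_cell_def Omega_def)
      also have "\<dots> = C\<^sup>2 * exp (- 2 * radius x)"
        by (simp add: power_mult_distrib exp_double[symmetric])
      finally show ?thesis .
    qed
    then show "AE x in lborel. x \<in> Omega_cell \<epsilon> \<longrightarrow>
        norm ((norm (\<chi> i. V i x))\<^sup>2) \<le> norm (C\<^sup>2 * exp (- 2 * radius x))"
      by simp
  qed
  then show ?thesis
    by (rule set_integrable_cong[THEN iffD1, rotated -1]) (auto simp: Omega_cell_def assms(4))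
qed

lemma modes_vec_tendsto_0:
  assumes "k \<noteq> 0" "\<epsilon> > 0" "\<And>i. V i \<in> modes k" "\<And>x. x \<in> Omega \<epsilon> \<Longrightarrow> norm (g x) = norm (\<chi> i. V i x)"
  shows "(g \<longlongrightarrow> 0) (filtercomap radius at_top)"
proof -
  obtain C where C: "C \<ge> 0" "\<And>x. \<epsilon> \<le> radius x \<Longrightarrow> norm (\<chi> i. V i x) \<le> C * exp (- radius x)"
    using modes_vec_bound[where V=V, OF assms(1,2,3)] by blast
  show ?thesis
  proof (rule Lim_null_comparison)
    have "\<forall>\<^sub>F x in filtercomap radius at_top. radius x > \<epsilon>"
      by (rule eventually_filtercomapI[OF eventually_gt_at_top])
    then show "\<forall>\<^sub>F x in filtercomap radius at_top. norm (g x) \<le> C * exp (- radius x)"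
      by eventually_elim (use C(2) assms(4) in \<open>auto simp: Omega_def\<close>)
    show "((\<lambda>x. C * exp (- radius x)) \<longlongrightarrow> 0) (filtercomap radius at_top)"
      by (intro tendsto_mult_right_zero filterlim_compose[OF exp_at_bot]
          filterlim_compose[OF filterlim_uminus_at_bot_at_top] filterlim_filtercomap)
  qed
qed

lemma continuous_on_cyl: "continuous_on S (\<lambda>q. cyl (fst q) (fst (snd q)) (snd (snd q)))"
proof -
  have e: "(\<lambda>q. cyl (fst q) (fst (snd q)) (snd (snd q))) = (\<lambda>q. vec3 (fst q * cos (fst (snd q)), fst q * sin (fst (snd q)), snd (snd q)))"
    by (simp add: cyl_def vec3_def)
  show ?thesis unfolding e
    by (rule continuous_on_compose2[OF continuous_on_vec3[of UNIV] _ subset_UNIV]) (intro continuous_intros)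
qed

text \<open>An explicit field extends continuously across the wall, so it is uniformly continuous on
  a compact shell and converges uniformly to its boundary values; that is more than the L2
  trace.\<close>

lemma trace_tendsto_0:
  fixes F :: "real^3 \<Rightarrow> complex^3"
  assumes \<epsilon>: "\<epsilon> > 0" and F: "continuous_on (Omega 0) F"
    and u: "\<And>x. x \<in> Omega \<epsilon> \<Longrightarrow> u x = F x" and bc: "\<And>\<theta> z. F (cyl \<epsilon> \<theta> z) = ubar z"
  shows "((\<lambda>r. \<integral>\<^sup>+q\<in>{0..2*pi} \<times> {-1..1}.
             ennreal ((norm (u (cyl r (fst q) (snd q)) - ubar (snd q)))\<^sup>2) \<partial>lborel) \<longlongrightarrow> 0) (at_right \<epsilon>)"
    (is "(?I \<longlongrightarrow> 0) _")
proof (rule order_tendstoI)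
  fix a :: ennreal assume "0 < a"
  then obtain b where b: "0 < b" "b < a" using dense by blast
  then obtain b' where b': "b = ennreal b'" "b' > 0"
    by (cases b) (auto simp: ennreal_less_iff)
  \<comment> \<open>The parameter cell has area 4 pi, so a pointwise error \<open>e\<close>
    integrates to at most 4 pi e^2 = b' < a.\<close>
  define e where "e = sqrt (b' / (4 * pi))"
  have e: "e > 0" using b' by (simp add: e_def)
  let ?K = "{\<epsilon>..\<epsilon>+1} \<times> ({0..2*pi} \<times> {-1..1::real})"
  have "continuous_on ?K (\<lambda>q. F (cyl (fst q) (fst (snd q)) (snd (snd q))))"
    using \<epsilon> by (intro continuous_on_compose2[OF F continuous_on_cyl]) (auto intro: cyl_in_Omega)
  then have "uniformly_continuous_on ?K (\<lambda>q. F (cyl (fst q) (fst (snd q)) (snd (snd q))))"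
    by (intro compact_uniformly_continuous compact_Times) auto
  then obtain d where d: "d > 0" and dd: "\<And>p q. p \<in> ?K \<Longrightarrow> q \<in> ?K \<Longrightarrow> dist q p < d \<Longrightarrow>
      dist (F (cyl (fst q) (fst (snd q)) (snd (snd q)))) (F (cyl (fst p) (fst (snd p)) (snd (snd p)))) < e"
    unfolding uniformly_continuous_on_def using e by blast
  have "\<forall>\<^sub>F r in at_right \<epsilon>. r \<in> {\<epsilon><..<\<epsilon> + min d 1}"
    using d by (intro eventually_at_right_real) auto
  then show "\<forall>\<^sub>F r in at_right \<epsilon>. ?I r < a"
  proof eventually_elim
    case (elim r)
    have n: "norm (u (cyl r (fst q) (snd q)) - ubar (snd q)) \<le> e" if "q \<in> {0..2*pi} \<times> {-1..1}" for q
    proof -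
      have "dist (F (cyl r (fst q) (snd q))) (F (cyl \<epsilon> (fst q) (snd q))) < e"
        using dd[of "(\<epsilon>, q)" "(r, q)"] that elim by (auto simp: dist_Pair_Pair dist_real_def mem_Times_iff)
      moreover have "u (cyl r (fst q) (snd q)) = F (cyl r (fst q) (snd q))"
        using elim \<epsilon> by (intro u cyl_in_Omega) auto
      ultimately show ?thesis by (simp add: bc dist_norm)
    qed
    have "?I r \<le> (\<integral>\<^sup>+q\<in>{0..2*pi} \<times> {-1..1::real}. ennreal (e\<^sup>2) \<partial>lborel)"
      by (rule nn_integral_mono) (use n e in \<open>auto simp: indicator_def intro!: ennreal_leI power_mono\<close>)
    also have "\<dots> = ennreal (e\<^sup>2) * emeasure (lborel \<Otimes>\<^sub>M lborel) ({0..2*pi} \<times> {-1..1::real})"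
      by (subst nn_integral_cmult_indicator) (auto simp: lborel_prod borel_Times)
    also have "\<dots> = ennreal (e\<^sup>2) * (ennreal (2 * pi) * 2)"
      by (subst lborel.emeasure_pair_measure_Times) auto
    also have "\<dots> = ennreal (e\<^sup>2 * (2 * pi * 2))"
    proof -
      have x1: "ennreal (2 * pi * 2) = ennreal (2 * pi) * ennreal 2" by (rule ennreal_mult) simp_all
      have x2: "ennreal (e\<^sup>2 * (2 * pi * 2)) = ennreal (e\<^sup>2) * ennreal (2 * pi * 2)"
        by (rule ennreal_mult) simp_all
      show ?thesis by (simp only: x2 x1 ennreal_numeral)
    qed
    also have "e\<^sup>2 * (2 * pi * 2) = b'" using b' by (simp add: e_def)
    finally show ?case using b b' by simp
  qed
qed simp

text \<open>Reduces the verification of a solution to algebra: momentum, divergence and boundary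
  values are checked on components, while every analytic condition follows from membership in
  \<open>modes\<close>. The stress is recorded here because it uses the same partial
  derivatives.\<close>

lemma modes_stokes_solution:
  assumes k: "k \<noteq> 0" and \<epsilon>: "\<epsilon> > 0"
    and U: "\<And>i. U i \<in> modes k" "\<And>i. pd2 (U i) (D i) (L i)"
    and P: "P \<in> modes k" "pd2 P DP LP"
    and mom: "\<And>i x. x \<in> Omega 0 \<Longrightarrow> L i x = DP i x"
    and dv: "\<And>x. x \<in> Omega 0 \<Longrightarrow> (\<Sum>i\<in>UNIV. D i i x) = 0"
    and bc: "\<And>i \<theta> z. U i (cyl \<epsilon> \<theta> z) = ubar z $ i"
  defines "u \<equiv> \<lambda>x. if x \<in> Omega \<epsilon> then (\<chi> i. U i x) else 0"
    and "p \<equiv> \<lambda>x. if x \<in> Omega \<epsilon> then P x else 0"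
  shows "stokes_solution \<epsilon> ubar u p"
    and "\<And>x. x \<in> Omega \<epsilon> \<Longrightarrow> stress u p x = (\<chi> i j. D i j x + D j i x - (if i = j then P x else 0))"
proof -
  have sub: "x \<in> Omega 0" if "x \<in> Omega \<epsilon>" for x using that \<epsilon> Omega_mono[of \<epsilon>] by auto
  have "\<forall>i. \<exists>DD. \<forall>x\<in>Omega 0. has_partials (U i) (\<lambda>j. D i j x) x \<and>
     (\<forall>j. has_partials (D i j) (\<lambda>l. DD j l x) x) \<and> L i x = (\<Sum>j\<in>UNIV. DD j j x)"
    using U(2) unfolding pd2_def by (rule allI)
  from choice[OF this] obtain DD where DD0: "\<forall>i. \<forall>x\<in>Omega 0. has_partials (U i) (\<lambda>j. D i j x) x \<and>
     (\<forall>j. has_partials (D i j) (\<lambda>l. DD i j l x) x) \<and> L i x = (\<Sum>j\<in>UNIV. DD i j j x)" ..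
  note DD = DD0[rule_format]
  have DP: "\<And>x. x \<in> Omega 0 \<Longrightarrow> has_partials P (\<lambda>j. DP j x) x"
    using P(2) unfolding pd2_def by blast
  have u1: "has_partials u (\<lambda>j. \<chi> i. D i j x) x" if x: "x \<in> Omega \<epsilon>" for x
    by (rule has_partials_cong[OF has_partials_vec[of U "\<lambda>i j. D i j x"] open_Omega x])
       (use DD sub[OF x] in \<open>auto simp: u_def\<close>)
  then have u1p: "pderiv_at j u x = (\<chi> i. D i j x)" if x: "x \<in> Omega \<epsilon>" for x j
    using has_partials_pderiv x by blast
  have "has_partials (pderiv_at j u) (\<lambda>l. \<chi> i. DD i j l x) x" if x: "x \<in> Omega \<epsilon>" for x j
    by (rule has_partials_cong[OF has_partials_vec[of "\<lambda>i. D i j" "\<lambda>i l. DD i j l x"] open_Omega x])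
       (use DD sub[OF x] in \<open>auto simp: u1p\<close>)
  then have u2p: "pderiv_at l (pderiv_at j u) x = (\<chi> i. DD i j l x)" if x: "x \<in> Omega \<epsilon>" for x j l
    using has_partials_pderiv x by blast
  have "has_partials p (\<lambda>j. DP j x) x" if x: "x \<in> Omega \<epsilon>" for x
    by (rule has_partials_cong[OF DP[OF sub[OF x]] open_Omega x]) (simp add: p_def)
  then have pp: "pderiv_at j p x = DP j x" if x: "x \<in> Omega \<epsilon>" for x j
    using has_partials_pderiv x by blast
  have lap: "laplacian u x = (\<chi> i. L i x)" if x: "x \<in> Omega \<epsilon>" for x
    unfolding laplacian_def u2p[OF x] using DD[OF sub[OF x]] by (simp add: vec_eq_iff)
  have "x + axis 3 2 \<in> Omega \<epsilon> \<longleftrightarrow> x \<in> Omega \<epsilon>" for x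
    by (simp add: Omega_def radius_def axis_def)
  then have per: "u (x + axis 3 2) = u x \<and> p (x + axis 3 2) = p x" for x
    using modes_periodic[OF U(1)] modes_periodic[OF P(1)] by (simp add: u_def p_def)
  have "\<forall>i. \<exists>D'. (\<forall>j. D' j \<in> modes k) \<and> (\<forall>x\<in>Omega 0. has_partials (U i) (\<lambda>j. D' j x) x)"
    using modes_partials[OF k U(1)] by blast
  then obtain D' where D': "\<And>i j. D' i j \<in> modes k" "\<And>i x. x \<in> Omega 0 \<Longrightarrow> has_partials (U i) (\<lambda>j. D' i j x) x"
    by metis
  \<comment> \<open>\<open>D\<close> comes from \<open>pd2\<close> and \<open>D'\<close> from
    \<open>modes_partials\<close>. Derivatives are unique, so the explicit gradient agrees with mode
    functions and inherits their decay.\<close>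
  have DD': "D i j x = D' i j x" if "x \<in> Omega 0" for i j x
    using has_partials_pderiv[OF D'(2)[OF that], of j] DD[OF that, of i] has_partials_pderiv[of "U i" "\<lambda>j. D i j x" x j]
    by simp
  have int_u: "set_integrable lborel (Omega_cell \<epsilon>) (\<lambda>x. (norm (pderiv_at j u x))\<^sup>2)" for j
    by (rule modes_vec_square_integrable[where V="\<lambda>i. D' i j", OF k \<epsilon> D'(1)]) (simp add: u1p DD' sub)
  \<comment> \<open>The pressure is padded to a vector so that the vector estimates apply; the zero
    entries are written \<open>0 * P x\<close> to be recognised as modes.\<close>
  let ?P = "\<lambda>i::3. if i = 1 then P else (\<lambda>x. 0 * P x)"
  have Pm: "?P i \<in> modes k" for i using P(1) modes.cmult[OF P(1), of 0] by auto
  have Pn: "norm (p x) = norm (\<chi> i. ?P i x)" if "x \<in> Omega \<epsilon>" for x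
    using that by (simp add: p_def norm_vec_def L2_set_def sum_3)
  have int_p: "set_integrable lborel (Omega_cell \<epsilon>) (\<lambda>x. (norm (p x))\<^sup>2)"
    by (rule modes_vec_square_integrable[where V="?P", OF k \<epsilon> Pm Pn])
  have tr: "((\<lambda>r. \<integral>\<^sup>+q\<in>{0..2*pi} \<times> {-1..1}.
             ennreal ((norm (u (cyl r (fst q) (snd q)) - ubar (snd q)))\<^sup>2) \<partial>lborel) \<longlongrightarrow> 0) (at_right \<epsilon>)"
    by (rule trace_tendsto_0[where F="\<lambda>x. \<chi> i. U i x", OF \<epsilon> modes_vec_continuous_on[where V=U, OF k U(1)]]) (simp_all add: u_def bc vec_eq_iff)
  have lim_u: "(u \<longlongrightarrow> 0) (filtercomap radius at_top)"
    by (rule modes_vec_tendsto_0[where V=U, OF k \<epsilon> U(1)]) (simp add: u_def)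
  have lim_p: "(p \<longlongrightarrow> 0) (filtercomap radius at_top)"
    by (rule modes_vec_tendsto_0[where V="?P", OF k \<epsilon> Pm Pn])
  have "- laplacian u x + gradient p x = 0" if x: "x \<in> Omega \<epsilon>" for x
    unfolding lap[OF x] gradient_def pp[OF x] using mom[OF sub[OF x]] by (simp add: vec_eq_iff)
  moreover have "divergence u x = 0" if x: "x \<in> Omega \<epsilon>" for x
    unfolding divergence_def u1p[OF x] using dv[OF sub[OF x]] by simp
  moreover have "Ck_on 2 (Omega \<epsilon>) u"
    using \<epsilon> by (intro modes_Ck_on_vec[OF k _ U(1)]) (auto simp: u_def)
  moreover have "Ck_on 1 (Omega \<epsilon>) p"
    using \<epsilon> by (intro modes_Ck_on[OF k _ P(1)]) (auto simp: p_def)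
  ultimately show "stokes_solution \<epsilon> ubar u p"
    unfolding stokes_solution_def using per int_u int_p tr lim_u lim_p
    by (auto simp: u_def p_def)
  show "stress u p x = (\<chi> i j. D i j x + D j i x - (if i = j then P x else 0))" if x: "x \<in> Omega \<epsilon>" for x
    unfolding stress_def jacobian_def u1p[OF x] using x
    by (simp add: vec_eq_iff transpose_def mat_def p_def)
qed

section \<open>The explicit solutions and their forces\<close>

text \<open>These six terms are all that a traction on a circle can contain. Over a full period
  cos^2 and sin^2 have mean 1/2, and the three mixed or linear terms have mean zero.\<close>

lemma set_integral_trig:
  fixes v1 v2 v3 v4 v5 v6 :: "complex^3"
  shows "(LINT \<theta>:{0..2*pi}|lborel. (cos \<theta>)\<^sup>2 *\<^sub>R v1 + (sin \<theta>)\<^sup>2 *\<^sub>R v2 + (cos \<theta> * sin \<theta>) *\<^sub>R v3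
     + cos \<theta> *\<^sub>R v4 + sin \<theta> *\<^sub>R v5 + v6) = pi *\<^sub>R (v1 + v2) + (2 * pi) *\<^sub>R v6" (is "(LINT \<theta>:_|_. ?f \<theta>) = _")
proof -
  have ftc: "(f has_integral (F (2*pi) - F 0)) {0..2*pi}"
    if "\<And>t. (F has_real_derivative f t) (at t)" for f F
    using that by (intro fundamental_theorem_of_calculus)
      (auto intro: has_field_derivative_at_within simp flip: has_real_derivative_iff_has_vector_derivative)
  have 1: "((\<lambda>t. (cos t)\<^sup>2) has_integral pi) {0..2*pi}"
  proof -
    have "((\<lambda>t. t / 2 + sin t * cos t / 2) has_real_derivative (cos t)\<^sup>2) (at t)" for t :: real
    proof -
      have "((\<lambda>t. t / 2 + sin t * cos t / 2) has_real_derivative 1 / 2 + (cos t * cos t - sin t * sin t) / 2) (at t)"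
        by (auto intro!: derivative_eq_intros)
      moreover have "1 / 2 + (cos t * cos t - sin t * sin t) / 2 = (cos t)\<^sup>2"
        using sin_cos_squared_add[of t] by (simp add: power2_eq_square field_simps)
      ultimately show ?thesis by (simp only:)
    qed
    from ftc[OF this] show ?thesis by simp
  qed
  have "((\<lambda>t. 1 - (cos t)\<^sup>2) has_integral (2 * pi - pi)) {0..2*pi}"
    using has_integral_diff[OF has_integral_const_real[of 1 0 "2*pi"] 1] by simp
  then have 2: "((\<lambda>t. (sin t)\<^sup>2) has_integral pi) {0..2*pi}"
    by (simp add: sin_squared_eq)
  have 3: "((\<lambda>t. cos t * sin t) has_integral 0) {0..2*pi}"
  proof -
    have "((\<lambda>t. (sin t)\<^sup>2 / 2) has_real_derivative cos t * sin t) (at t)" for t :: real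
      by (auto intro!: derivative_eq_intros)
    from ftc[OF this] show ?thesis by simp
  qed
  have 4: "(cos has_integral 0) {0..2*pi}"
    using ftc[of sin cos] DERIV_sin by simp
  have 5: "(sin has_integral 0) {0..2*pi}"
  proof -
    have "((\<lambda>t. - cos t) has_real_derivative sin t) (at t)" for t :: real
      by (auto intro!: derivative_eq_intros)
    from ftc[OF this] show ?thesis by simp
  qed
  have 6: "((\<lambda>t. v6) has_integral (2 * pi) *\<^sub>R v6) {0..2*pi}"
    using has_integral_const_real[of v6 0 "2*pi"] by simp
  have I: "(?f has_integral (pi *\<^sub>R v1 + pi *\<^sub>R v2 + 0 *\<^sub>R v3 + 0 *\<^sub>R v4 + 0 *\<^sub>R v5 + (2 * pi) *\<^sub>R v6)) {0..2*pi}"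
    by (intro has_integral_add has_integral_scaleR_left 1 2 3 4 5 6)
  have "set_integrable lborel {0..2*pi} ?f"
    by (intro borel_integrable_atLeastAtMost' continuous_intros)
  then have "(LINT \<theta>:{0..2*pi}|lborel. ?f \<theta>) = integral {0..2*pi} ?f"
    by (rule set_borel_integral_eq_integral(2))
  also have "\<dots> = pi *\<^sub>R v1 + pi *\<^sub>R v2 + 0 *\<^sub>R v3 + 0 *\<^sub>R v4 + 0 *\<^sub>R v5 + (2 * pi) *\<^sub>R v6"
    by (rule integral_unique[OF I])
  finally show ?thesis by (simp add: scaleR_add_right)
qed

definition profile :: "int \<Rightarrow> nat \<Rightarrow> real \<Rightarrow> real" where
  "profile k n r = bessel_K n (pi * \<bar>real_of_int k\<bar> * r) / r ^ n"

lemma profile_recurrence: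
  assumes "k \<noteq> 0" "r > 0"
  shows "(pi * \<bar>real_of_int k\<bar>) * r\<^sup>2 * profile k (Suc (Suc n)) r
    = (pi * \<bar>real_of_int k\<bar>) * profile k n r + 2 * real (Suc n) * profile k (Suc n) r"
  using bessel_K_recurrence[of "pi * \<bar>real_of_int k\<bar> * r" n] assms
  by (simp add: profile_def field_simps power2_eq_square)

lemma isCont_profile: "k \<noteq> 0 \<Longrightarrow> r > 0 \<Longrightarrow> isCont (profile k n) r"
  unfolding profile_def[abs_def]
  by (intro continuous_intros DERIV_isCont[OF bessel_K_has_derivative, THEN isCont_o2[rotated]]) auto

lemma atom_cyl: "r > 0 \<Longrightarrow> atom k n (cyl r \<theta> z) = of_real (profile k n r) * cis (pi * of_int k * z)"
  by (simp add: atom_def radial_bessel_def profile_def radius_cyl cyl_components)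

lemma profile_pos: "k \<noteq> 0 \<Longrightarrow> r > 0 \<Longrightarrow> profile k n r > 0"
  unfolding profile_def using bessel_K_pos[of "pi * \<bar>real_of_int k\<bar> * r" n] by simp

lemma atom_partial_12: "j \<noteq> 3 \<Longrightarrow> atom_partial k n j x = - of_real (pi * \<bar>real_of_int k\<bar>) * (of_real (x $ j) * atom k (Suc n) x)"
  and atom_partial_3: "atom_partial k n 3 x = \<i> * of_real (pi * of_int k) * atom k n x"
  by (simp_all add: atom_partial_def)

lemma atom_recurrence':
  assumes "k \<noteq> 0" "x \<in> Omega 0"
  shows "of_real (pi * \<bar>real_of_int k\<bar>) * ((of_real (x $ 1))\<^sup>2 + (of_real (x $ 2))\<^sup>2) * atom k (Suc (Suc n)) x
    = of_real (pi * \<bar>real_of_int k\<bar>) * atom k n x + 2 * of_nat (Suc n) * atom k (Suc n) x"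
proof -
  let ?K = "complex_of_real (pi * \<bar>real_of_int k\<bar>)"
  have e: "?K * of_real (2 * real (Suc n) / (pi * \<bar>real_of_int k\<bar>)) = 2 * of_nat (Suc n)"
    using assms unfolding of_real_mult[symmetric] by (simp del: of_nat_Suc)
  have "?K * (of_real ((x $ 1)\<^sup>2 + (x $ 2)\<^sup>2) * atom k (Suc (Suc n)) x)
      = ?K * atom k n x + 2 * of_nat (Suc n) * atom k (Suc n) x"
    unfolding atom_recurrence[OF assms, of n] distrib_left mult.assoc[symmetric] e ..
  then show ?thesis by (simp only: of_real_add of_real_power mult.assoc)
qed

lemma vec_eq_3: "x = y \<longleftrightarrow> x $ 1 = y $ 1 \<and> x $ 2 = y $ 2 \<and> (x::'a^3) $ 3 = y $ 3"
  by (simp add: vec_eq_iff forall_3)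

lemma mode_constants:
  assumes "k \<noteq> 0"
  shows "(\<i> * complex_of_real (pi * of_int k))\<^sup>2 = - (of_real (pi * \<bar>real_of_int k\<bar>))\<^sup>2"
    "\<i> * complex_of_real (pi * of_int k) \<noteq> 0" "complex_of_real (pi * \<bar>real_of_int k\<bar>) \<noteq> 0"
proof -
  have "(\<bar>real_of_int k\<bar>)\<^sup>2 = (real_of_int k)\<^sup>2" by simp
  then have "(complex_of_real (pi * of_int k))\<^sup>2 = (of_real (pi * \<bar>real_of_int k\<bar>))\<^sup>2"
    unfolding of_real_power[symmetric] power_mult_distrib by (simp only:)
  then show "(\<i> * complex_of_real (pi * of_int k))\<^sup>2 = - (of_real (pi * \<bar>real_of_int k\<bar>))\<^sup>2"
    by (simp only: power_mult_distrib) simp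
qed (use assms in auto)

lemma fourier_mode_axis: "fourier_mode k (axis j 1) z $ i = (if i = j then cis (pi * of_int k * z) else 0)"
  by (simp add: fourier_mode_def axis_def)

text \<open>Once each traction component is written as a trigonometric polynomial of degree two,
  only its mean survives the integration over the circle.\<close>

lemma force_density_eq:
  assumes "0 < \<epsilon>" "\<epsilon> < r"
    and st: "\<And>x. x \<in> Omega \<epsilon> \<Longrightarrow> stress u p x = (\<chi> i j. S i j x)"
    and S: "\<And>i \<theta>. - (of_real (cos \<theta>) * S i 1 (cyl r \<theta> z) + of_real (sin \<theta>) * S i 2 (cyl r \<theta> z))
      = of_real ((cos \<theta>)\<^sup>2) * v1 $ i + of_real ((sin \<theta>)\<^sup>2) * v2 $ i + of_real (cos \<theta> * sin \<theta>) * v3 $ i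
        + of_real (cos \<theta>) * v4 $ i + of_real (sin \<theta>) * v5 $ i + v6 $ i"
  shows "force_density \<epsilon> u p r z = (\<epsilon> * pi) *\<^sub>R (v1 + v2 + 2 *\<^sub>R v6)"
proof -
  have "\<epsilon> *\<^sub>R (stress u p (cyl r \<theta> z) *v inner_normal \<theta>)
    = (cos \<theta>)\<^sup>2 *\<^sub>R (\<epsilon> *\<^sub>R v1) + (sin \<theta>)\<^sup>2 *\<^sub>R (\<epsilon> *\<^sub>R v2) + (cos \<theta> * sin \<theta>) *\<^sub>R (\<epsilon> *\<^sub>R v3)
     + cos \<theta> *\<^sub>R (\<epsilon> *\<^sub>R v4) + sin \<theta> *\<^sub>R (\<epsilon> *\<^sub>R v5) + \<epsilon> *\<^sub>R v6" for \<theta>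
  proof -
    have "cyl r \<theta> z \<in> Omega \<epsilon>" using assms(1,2) by (intro cyl_in_Omega) auto
    then have "stress u p (cyl r \<theta> z) *v inner_normal \<theta>
      = (\<chi> i. - (of_real (cos \<theta>) * S i 1 (cyl r \<theta> z) + of_real (sin \<theta>) * S i 2 (cyl r \<theta> z)))"
      by (simp add: st matrix_vector_mult_def sum_3 inner_normal_def vec_eq_iff mult.commute)
    also have "\<dots> = (cos \<theta>)\<^sup>2 *\<^sub>R v1 + (sin \<theta>)\<^sup>2 *\<^sub>R v2 + (cos \<theta> * sin \<theta>) *\<^sub>R v3
        + cos \<theta> *\<^sub>R v4 + sin \<theta> *\<^sub>R v5 + v6"
      unfolding S by (simp add: vec_eq_iff scaleR_conv_of_real[where 'a=complex])
    finally show ?thesis by (simp add: scaleR_add_right mult.commute)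
  qed
  then show ?thesis unfolding force_density_def
    by (simp only: set_integral_trig) (simp add: scaleR_add_right mult_ac)
qed

text \<open>Ansatz, with w = i pi k the symbol of d/dz: cross-sectional velocity (x_1, x_2) v for v
  = A a_0 + B a_1, axial velocity w (be a_0 - al \<kappa> r^2 a_1), pressure 2 A a_0. Axial momentum
  forces A = al \<kappa>^2, the condition v = 0 on the wall gives \<open>B\<close>,
  incompressibility gives \<open>be\<close>, and the axial boundary value fixes
  \<open>al\<close>.\<close>

lemma tangential_solution:
  assumes k: "k \<noteq> 0" and \<epsilon>: "\<epsilon> > 0"
  defines "K0 \<equiv> bessel_K 0 (pi * \<epsilon> * \<bar>real_of_int k\<bar>)" and "K1 \<equiv> bessel_K 1 (pi * \<epsilon> * \<bar>real_of_int k\<bar>)"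
  shows "\<exists>u p c. stokes_solution \<epsilon> (fourier_mode k (axis 3 1)) u p
    \<and> (\<forall>r>\<epsilon>. \<forall>z. force_density \<epsilon> u p r z = c r *s fourier_mode k (axis 3 1) z)
    \<and> (c \<longlongrightarrow> of_real (4 * pi\<^sup>2 * \<epsilon> * \<bar>real_of_int k\<bar> * K1\<^sup>2
        / (2 * K0 * K1 + pi * \<epsilon> * \<bar>real_of_int k\<bar> * (K0\<^sup>2 - K1\<^sup>2)))) (at_right \<epsilon>)"
proof -
  define kap where "kap = pi * \<bar>real_of_int k\<bar>"
  define K where "K = complex_of_real kap"
  define w where "w = \<i> * complex_of_real (pi * of_int k)"
  have kap: "kap > 0" using k by (simp add: kap_def)
  have w2: "w\<^sup>2 = - K\<^sup>2" and w0: "w \<noteq> 0" and Kn0: "K \<noteq> 0"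
    using mode_constants[OF k] unfolding w_def K_def kap_def by blast+
  have ap: "atom_partial k n 1 x = - K * (of_real (x $ 1) * atom k (Suc n) x)"
    "atom_partial k n 2 x = - K * (of_real (x $ 2) * atom k (Suc n) x)"
    "atom_partial k n 3 x = w * atom k n x" for n x
    unfolding w_def K_def kap_def by (simp_all add: atom_partial_12 atom_partial_3)
  define d where "d = 2 * K0 * K1 + pi * \<epsilon> * \<bar>real_of_int k\<bar> * (K0\<^sup>2 - K1\<^sup>2)"
  have d: "d > 0" using tangential_ratio_bounds(1)[of "pi * \<epsilon> * \<bar>real_of_int k\<bar>"] k \<epsilon>
    by (simp add: d_def K0_def K1_def)
  define g where "g n = complex_of_real (profile k n \<epsilon>)" for n
  have g: "g 0 \<noteq> 0" "g 1 \<noteq> 0" using profile_pos[OF k \<epsilon>, of 0] profile_pos[OF k \<epsilon>, of 1] by (auto simp: g_def)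
  have g0: "g 0 = of_real K0" and g1: "of_real \<epsilon> * g 1 = of_real K1"
    using \<epsilon> by (simp_all add: g_def profile_def K0_def K1_def mult_ac)
  have K1: "K1 > 0" unfolding K1_def using k \<epsilon> by (intro bessel_K_pos) auto
  have g2: "K * (of_real \<epsilon>)\<^sup>2 * g 2 = K * g 0 + 2 * g 1"
  proof -
    have "complex_of_real (kap * \<epsilon>\<^sup>2 * profile k 2 \<epsilon>) = of_real (kap * profile k 0 \<epsilon> + 2 * profile k 1 \<epsilon>)"
      using profile_recurrence[OF k \<epsilon>, of 0] unfolding kap_def by (simp add: numeral_2_eq_2)
    then show ?thesis by (simp add: K_def g_def)
  qed
  \<comment> \<open>The axial velocity on the wall equals w al d / K_1 times the exponential, as
    computed in \<open>e1\<close>; this choice makes the factor 1 and brings in the denominator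
    \<open>d\<close>.\<close>
  define al where "al = of_real K1 / (w * of_real d)"
  define A where "A = al * K\<^sup>2"
  define B where "B = - A * g 0 / g 1"
  define be where "be = 2 * al - B / K"
  define v where "v = (\<lambda>x. A * atom k 0 x + B * atom k 1 x)"
  define Dv where "Dv = (\<lambda>j x. A * atom_partial k 0 j x + B * atom_partial k 1 j x)"
  define Lv where "Lv = (\<lambda>x. A * (of_real (2 * real 0 * (pi * \<bar>real_of_int k\<bar>)) * atom k (Suc 0) x)
     + B * (of_real (2 * real 1 * (pi * \<bar>real_of_int k\<bar>)) * atom k (Suc 1) x))"
  have v: "pd2 v Dv Lv" unfolding v_def Dv_def Lv_def by (intro pd2_add pd2_cmult pd2_atom k)
  \<comment> \<open>The terms for i = 1 and i = 2 add up to r^2 a_1.\<close>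
  define s where "s = (\<lambda>i::3. \<lambda>x. complex_of_real (x $ i) * (complex_of_real (x $ i) * atom k 1 x))"
  define Ds where "Ds = (\<lambda>i j x. (if j = i then complex_of_real (x $ i) * atom k 1 x else 0)
     + complex_of_real (x $ i) * ((if j = i then atom k 1 x else 0) + complex_of_real (x $ i) * atom_partial k 1 j x))"
  define Ls where "Ls = (\<lambda>i x. complex_of_real (x $ i) * (complex_of_real (x $ i)
       * (of_real (2 * real 1 * (pi * \<bar>real_of_int k\<bar>)) * atom k (Suc 1) x) + 2 * atom_partial k 1 i x)
     + 2 * ((if i = i then atom k 1 x else 0) + complex_of_real (x $ i) * atom_partial k 1 i x))"
  have s: "pd2 (s i) (Ds i) (Ls i)" for i
    unfolding s_def Ds_def Ls_def by (rule pd2_coord[OF pd2_coord[OF pd2_atom[OF k]]])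
  define U where "U i = (if i = 3 then (\<lambda>x. w * (be * atom k 0 x + (- al * K) * (s 1 x + s 2 x)))
     else (\<lambda>x. complex_of_real (x $ i) * v x))" for i
  define D where "D i = (if i = 3 then (\<lambda>j x. w * (be * atom_partial k 0 j x + (- al * K) * (Ds 1 j x + Ds 2 j x)))
     else (\<lambda>j x. (if j = i then v x else 0) + complex_of_real (x $ i) * Dv j x))" for i
  define L where "L i = (if i = 3 then (\<lambda>x. w * (be * (of_real (2 * real 0 * (pi * \<bar>real_of_int k\<bar>)) * atom k (Suc 0) x)
       + (- al * K) * (Ls 1 x + Ls 2 x)))
     else (\<lambda>x. complex_of_real (x $ i) * Lv x + 2 * Dv i x))" for i
  define P where "P = (\<lambda>x. 2 * A * atom k 0 x)"
  have U2: "pd2 (U i) (D i) (L i)" for i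
  proof (cases "i = 3")
    case True
    show ?thesis unfolding U_def D_def L_def if_P[OF True]
      by (intro pd2_add pd2_cmult pd2_atom k s)
  next
    case False
    show ?thesis unfolding U_def D_def L_def if_not_P[OF False] by (rule pd2_coord[OF v])
  qed
  have Um: "U i \<in> modes k" for i
  proof (cases "i = 3")
    case True
    show ?thesis unfolding U_def s_def if_P[OF True] by (intro modes.intros) simp_all
  next
    case False
    show ?thesis unfolding U_def v_def if_not_P[OF False] by (intro modes.intros False)
  qed
  have Pm: "P \<in> modes k" unfolding P_def by (intro modes.intros)
  have P2: "pd2 P (\<lambda>j x. 2 * A * atom_partial k 0 j x) (\<lambda>x. 2 * A * (of_real (2 * real 0 * (pi * \<bar>real_of_int k\<bar>)) * atom k (Suc 0) x))"
    unfolding P_def by (intro pd2_cmult pd2_atom k)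
  have rec: "K * ((of_real (x $ 1))\<^sup>2 + (of_real (x $ 2))\<^sup>2) * atom k (Suc (Suc n)) x
      = K * atom k n x + 2 * of_nat (Suc n) * atom k (Suc n) x" if "x \<in> Omega 0" for x n
    using atom_recurrence'[OF k that] by (simp only: K_def kap_def)
  have two: "complex_of_real (2 * real 1 * (pi * \<bar>real_of_int k\<bar>)) = 2 * K"
    by (simp add: K_def kap_def)
  have mom: "L i x = 2 * A * atom_partial k 0 i x" if x: "x \<in> Omega 0" for i x
  proof -
    have "L 3 x - 2 * A * (w * atom k 0 x)
        = 2 * w * al * K * (K * ((of_real (x $ 1))\<^sup>2 + (of_real (x $ 2))\<^sup>2) * atom k (Suc (Suc 0)) x
          - (K * atom k 0 x + 2 * of_nat (Suc 0) * atom k (Suc 0) x))"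
      unfolding L_def Ls_def two by (simp add: ap A_def algebra_simps power2_eq_square)
    then have "L 3 x = 2 * A * (w * atom k 0 x)" unfolding rec[OF x] by simp
    moreover have "L 1 x = 2 * A * (- K * (of_real (x $ 1) * atom k (Suc 0) x))"
      "L 2 x = 2 * A * (- K * (of_real (x $ 2) * atom k (Suc 0) x))"
      unfolding L_def Lv_def two Dv_def by (simp_all add: ap algebra_simps)
    ultimately show ?thesis using UNIV_3_cases[of i] by (auto simp: ap)
  qed
  have AK: "2 * A - B * K - K\<^sup>2 * be = 0"
    using Kn0 by (simp add: be_def A_def algebra_simps power2_eq_square)
  have dv: "(\<Sum>i\<in>UNIV. D i i x) = 0" if x: "x \<in> Omega 0" for x
  proof -
    let ?r2 = "(complex_of_real (x $ 1))\<^sup>2 + (of_real (x $ 2))\<^sup>2"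
    \<comment> \<open>Sorted into three multiples of expressions that vanish: by the choice of
      \<open>be\<close> (that is \<open>AK\<close>), by the recurrence, and by w^2 =
      -\<kappa>^2.\<close>
    have "(\<Sum>i\<in>UNIV. D i i x) = (2 * A - B * K - K\<^sup>2 * be) * atom k 0 x
       - B * (K * ?r2 * atom k (Suc (Suc 0)) x - (K * atom k 0 x + 2 * of_nat (Suc 0) * atom k (Suc 0) x))
       + (w\<^sup>2 + K\<^sup>2) * (be * atom k 0 x - al * K * ?r2 * atom k 1 x)"
      unfolding sum_3 D_def Ds_def Dv_def v_def
      by (simp add: ap A_def algebra_simps power2_eq_square)
    then show ?thesis unfolding rec[OF x] AK w2 by simp
  qed
  have wal: "w * al * of_real d = of_real K1" using w0 d by (simp add: al_def)
  have e0: "A * g 0 + B * g 1 = 0" using g by (simp add: B_def)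
  have e1: "w * (be * g 0 - al * K * (of_real \<epsilon>)\<^sup>2 * g 1) = 1"
  proof -
    have "complex_of_real d = 2 * g 0 * (of_real \<epsilon> * g 1) + K * of_real \<epsilon> * ((g 0)\<^sup>2 - (of_real \<epsilon> * g 1)\<^sup>2)"
      unfolding g0 g1 by (simp add: d_def K_def kap_def)
    then have dX: "complex_of_real d = of_real \<epsilon> * (2 * g 0 * g 1 + K * (g 0)\<^sup>2 - K * (of_real \<epsilon>)\<^sup>2 * (g 1)\<^sup>2)"
      by (simp add: algebra_simps power2_eq_square)
    have "of_real \<epsilon> * (w * al * (2 * g 0 * g 1 + K * (g 0)\<^sup>2 - K * (of_real \<epsilon>)\<^sup>2 * (g 1)\<^sup>2)) = w * al * of_real d"
      unfolding dX by (simp only: mult_ac)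
    also have "\<dots> = of_real \<epsilon> * g 1" unfolding wal g1 ..
    finally have "of_real \<epsilon> * (w * al * (2 * g 0 * g 1 + K * (g 0)\<^sup>2 - K * (of_real \<epsilon>)\<^sup>2 * (g 1)\<^sup>2)) = of_real \<epsilon> * g 1" .
    then have m: "w * al * (2 * g 0 * g 1 + K * (g 0)\<^sup>2 - K * (of_real \<epsilon>)\<^sup>2 * (g 1)\<^sup>2) = g 1"
      using \<epsilon> by simp
    have bg: "be * g 1 = al * (2 * g 1 + K * g 0)"
      using Kn0 g by (simp add: be_def B_def A_def field_simps power2_eq_square)
    have "w * (be * g 0 - al * K * (of_real \<epsilon>)\<^sup>2 * g 1) * g 1
       = w * ((be * g 1) * g 0 - al * K * (of_real \<epsilon>)\<^sup>2 * g 1 * g 1)"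
      by (simp add: algebra_simps)
    also have "\<dots> = w * al * (2 * g 0 * g 1 + K * (g 0)\<^sup>2 - K * (of_real \<epsilon>)\<^sup>2 * (g 1)\<^sup>2)"
      unfolding bg by (simp add: algebra_simps power2_eq_square)
    finally have "w * (be * g 0 - al * K * (of_real \<epsilon>)\<^sup>2 * g 1) * g 1
       = w * al * (2 * g 0 * g 1 + K * (g 0)\<^sup>2 - K * (of_real \<epsilon>)\<^sup>2 * (g 1)\<^sup>2)" .
    with m g show ?thesis by simp
  qed
  have trig: "(complex_of_real (cos t))\<^sup>2 = 1 - (of_real (sin t))\<^sup>2" for t
    unfolding of_real_power[symmetric] cos_squared_eq by simp
  have bc: "U i (cyl \<epsilon> \<theta> z) = fourier_mode k (axis 3 1) z $ i" for i \<theta> z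
  proof -
    let ?E = "cis (pi * of_int k * z)"
    have "U 3 (cyl \<epsilon> \<theta> z) = w * (be * g 0 - al * K * (of_real \<epsilon>)\<^sup>2 * g 1 * ((of_real (cos \<theta>))\<^sup>2 + (of_real (sin \<theta>))\<^sup>2)) * ?E"
      using \<epsilon> by (simp add: U_def s_def atom_cyl cyl_components g_def algebra_simps power2_eq_square)
    also have "\<dots> = ?E" unfolding trig using e1 by simp
    finally have U3: "U 3 (cyl \<epsilon> \<theta> z) = ?E" .
    have "v (cyl \<epsilon> \<theta> z) = (A * g 0 + B * g 1) * ?E"
      using \<epsilon> by (simp add: v_def atom_cyl g_def algebra_simps)
    then have "v (cyl \<epsilon> \<theta> z) = 0" using e0 by simp
    then have "U 1 (cyl \<epsilon> \<theta> z) = 0" "U 2 (cyl \<epsilon> \<theta> z) = 0" by (simp_all add: U_def)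
    with U3 show ?thesis using UNIV_3_cases[of i] by (auto simp: fourier_mode_axis)
  qed
  note sol = modes_stokes_solution[where ubar="fourier_mode k (axis 3 1)", OF k \<epsilon> Um U2 Pm P2 mom dv bc]
  \<comment> \<open>The axial traction at radius r is -r w m(r) times the exponential; the integral
    over the angle with weight \<epsilon> then gives \<open>c\<close>.\<close>
  define m where "m r = A * of_real (profile k 0 r) + B * of_real (profile k 1 r) - be * K * of_real (profile k 1 r)
     - al * K * (2 * of_real (profile k 1 r) - K * (of_real r)\<^sup>2 * of_real (profile k 2 r))" for r
  define c where "c r = - (of_real (\<epsilon> * pi)) * (2 * (of_real r * w * m r))" for r
  let ?u = "\<lambda>x. if x \<in> Omega \<epsilon> then (\<chi> i. U i x) else 0"
  let ?p = "\<lambda>x. if x \<in> Omega \<epsilon> then P x else 0"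
  have "force_density \<epsilon> ?u ?p r z = c r *s fourier_mode k (axis 3 1) z" if r: "r > \<epsilon>" for r z
  proof -
    let ?E = "cis (pi * of_int k * z)"
    let ?h = "\<lambda>n. complex_of_real (profile k n r)"
    let ?Q = "- (2 * (A * ?h 0 + B * ?h 1) - 2 * K * (of_real r)\<^sup>2 * (A * ?h 1 + B * ?h 2) - 2 * A * ?h 0) * ?E"
    have r0: "r > 0" using r \<epsilon> by simp
    have at: "atom k n (cyl r \<theta> z) = ?h n * ?E" for n \<theta> using atom_cyl[OF r0] .
    have "force_density \<epsilon> ?u ?p r z = (\<epsilon> * pi) *\<^sub>R (0 + 0 + 2 *\<^sub>R (\<chi> i. if i = 3 then - (of_real r * w * m r) * ?E else 0))"
    proof (rule force_density_eq[where S = "\<lambda>i j x. D i j x + D j i x - (if i = j then P x else 0)"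
          and ?v3.0 = 0 and ?v4.0 = "\<chi> i. if i = 1 then ?Q else 0" and ?v5.0 = "\<chi> i. if i = 2 then ?Q else 0", OF \<epsilon> r sol(2)])
      fix i \<theta>
      let ?c = "complex_of_real (cos \<theta>)" and ?s = "complex_of_real (sin \<theta>)"
      let ?S = "\<lambda>i j x. D i j x + D j i x - (if i = j then P x else 0)"
      \<comment> \<open>The identities carry an explicit multiple of cos^2 + sin^2 - 1, so that they
        hold with cos and sin as free variables and ring normalisation proves them;
        \<open>cs\<close> removes the remainder afterwards.\<close>
      have 1: "- (?c * ?S 1 1 (cyl r \<theta> z) + ?s * ?S 1 2 (cyl r \<theta> z)) = ?c * ?Q
         + 2 * K * (of_real r)\<^sup>2 * (A * ?h 1 + B * ?h 2) * ?E * ?c * (?c\<^sup>2 + ?s\<^sup>2 - 1)"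
        unfolding D_def Dv_def v_def P_def
        by (simp add: ap at cyl_components numeral_2_eq_2) (simp add: algebra_simps power2_eq_square)
      have 2: "- (?c * ?S 2 1 (cyl r \<theta> z) + ?s * ?S 2 2 (cyl r \<theta> z)) = ?s * ?Q
         + 2 * K * (of_real r)\<^sup>2 * (A * ?h 1 + B * ?h 2) * ?E * ?s * (?c\<^sup>2 + ?s\<^sup>2 - 1)"
        unfolding D_def Dv_def v_def P_def
        by (simp add: ap at cyl_components numeral_2_eq_2) (simp add: algebra_simps power2_eq_square)
      have 3: "- (?c * ?S 3 1 (cyl r \<theta> z) + ?s * ?S 3 2 (cyl r \<theta> z)) = - (of_real r * w * m r) * ?E
         - (of_real r * w * (A * ?h 0 + B * ?h 1 - be * K * ?h 1 - al * K * (2 * ?h 1))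
             + of_real r * w * al * K * (K * (of_real r)\<^sup>2 * ?h 2) * (?c\<^sup>2 + ?s\<^sup>2 + 1)) * ?E * (?c\<^sup>2 + ?s\<^sup>2 - 1)"
        unfolding D_def Dv_def Ds_def v_def m_def
        by (simp add: ap at cyl_components numeral_2_eq_2) (simp add: algebra_simps power2_eq_square)
      have cs: "?c\<^sup>2 + ?s\<^sup>2 - 1 = 0" using trig[of \<theta>] by simp
      show "- (?c * ?S i 1 (cyl r \<theta> z) + ?s * ?S i 2 (cyl r \<theta> z))
        = of_real ((cos \<theta>)\<^sup>2) * (0::complex^3) $ i + of_real ((sin \<theta>)\<^sup>2) * (0::complex^3) $ i
        + of_real (cos \<theta> * sin \<theta>) * (0::complex^3) $ i
        + ?c * (\<chi> i. if i = 1 then ?Q else 0) $ i + ?s * (\<chi> i. if i = 2 then ?Q else 0) $ i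
        + (\<chi> i. if i = 3 then - (of_real r * w * m r) * ?E else 0) $ i"
        using UNIV_3_cases[of i] 1[unfolded cs] 2[unfolded cs] 3[unfolded cs] by (elim disjE) simp_all
    qed
    then have F: "force_density \<epsilon> ?u ?p r z $ i
        = complex_of_real (\<epsilon> * pi) * (2 * (if i = 3 then - (of_real r * w * m r) * ?E else 0))" for i
      by (simp only: vector_scaleR_component vector_add_component zero_index add_0 vec_lambda_beta
          scaleR_conv_of_real[where 'a=complex] of_real_numeral)
    show ?thesis unfolding vec_eq_iff F vector_smult_component fourier_mode_axis c_def
    proof (intro allI)
      fix i :: 3
      show "complex_of_real (\<epsilon> * pi) * (2 * (if i = 3 then - (of_real r * w * m r) * ?E else 0))
          = - of_real (\<epsilon> * pi) * (2 * (of_real r * w * m r)) * (if i = 3 then ?E else 0)"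
        by (cases "i = 3") (simp_all only: simp_thms if_True if_False mult_zero_right mult_minus_left mult_minus_right mult.assoc)
    qed
  qed
  moreover have "(c \<longlongrightarrow> of_real (4 * pi\<^sup>2 * \<epsilon> * \<bar>real_of_int k\<bar> * K1\<^sup>2 / d)) (at_right \<epsilon>)"
  proof -
    have "((\<lambda>r. complex_of_real (profile k n r)) \<longlongrightarrow> g n) (at_right \<epsilon>)" for n
      unfolding g_def using isCont_profile[OF k \<epsilon>, of n, unfolded isCont_def]
      by (intro tendsto_of_real) (rule tendsto_mono[OF at_le[OF subset_UNIV]])
    then have lim: "(c \<longlongrightarrow> - (of_real (\<epsilon> * pi)) * (2 * (of_real \<epsilon> * w * (A * g 0 + B * g 1 - be * K * g 1
        - al * K * (2 * g 1 - K * (of_real \<epsilon>)\<^sup>2 * g 2))))) (at_right \<epsilon>)"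
      unfolding c_def m_def by (intro tendsto_intros)
    \<comment> \<open>On the wall the condition v = 0, the definition of \<open>be\<close> and the
      recurrence for \<open>g 2\<close> collapse the traction to a single multiple of
      \<open>g 1\<close>.\<close>
    have mv: "A * g 0 + B * g 1 - be * K * g 1 - al * K * (2 * g 1 - K * (of_real \<epsilon>)\<^sup>2 * g 2) = - 2 * al * K * g 1"
    proof -
      have 1: "be * K * g 1 = 2 * al * K * g 1 - B * g 1"
        using Kn0 by (simp add: be_def field_simps)
      have 2: "B * g 1 = - al * K\<^sup>2 * g 0" using g by (simp add: B_def A_def)
      show ?thesis unfolding 1 2 e0[unfolded 2] g2 by (simp add: A_def algebra_simps power2_eq_square)
    qed
    have "- (of_real (\<epsilon> * pi)) * (2 * (of_real \<epsilon> * w * (- 2 * al * K * g 1)))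
       = 4 * of_real pi * of_real \<epsilon> * K * (w * al) * (of_real \<epsilon> * g 1)"
      by (simp add: algebra_simps)
    also have "\<dots> = 4 * of_real pi * of_real \<epsilon> * K * (of_real K1 / of_real d) * of_real K1"
    proof -
      have "w * al = of_real K1 / of_real d" using w0 by (simp add: al_def)
      then show ?thesis unfolding g1 by (simp only:)
    qed
    also have "\<dots> = of_real (4 * pi\<^sup>2 * \<epsilon> * \<bar>real_of_int k\<bar> * K1\<^sup>2 / d)"
      unfolding K_def kap_def by (simp add: power2_eq_square)
    finally have val: "- (of_real (\<epsilon> * pi)) * (2 * (of_real \<epsilon> * w * (- 2 * al * K * g 1)))
       = of_real (4 * pi\<^sup>2 * \<epsilon> * \<bar>real_of_int k\<bar> * K1\<^sup>2 / d)" .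
    show ?thesis using lim unfolding mv val .
  qed
  ultimately show ?thesis using sol(1) unfolding d_def by blast
qed

text \<open>Ansatz in the cross section: the i-th velocity is delta_ie v + x_e d_i(a a_0 + cc a_1),
  because d_i a_n = -\<kappa> x_i a_{n+1} turns the second part into -\<kappa> x_e x_i q. The axial
  velocity is w x_e h and the pressure 2 a d_e a_0. Momentum holds for all coefficients;
  \<open>cc\<close> and \<open>b\<close> make q and h vanish on the wall, \<open>dd\<close> is
  incompressibility, and \<open>a\<close> normalises v to 1 there.\<close>

lemma normal_solution:
  fixes e :: 3
  assumes k: "k \<noteq> 0" and \<epsilon>: "\<epsilon> > 0" and e: "e = 1 \<or> e = 2"
  defines "K0 \<equiv> bessel_K 0 (pi * \<epsilon> * \<bar>real_of_int k\<bar>)" and "K1 \<equiv> bessel_K 1 (pi * \<epsilon> * \<bar>real_of_int k\<bar>)"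
    and "K2 \<equiv> bessel_K 2 (pi * \<epsilon> * \<bar>real_of_int k\<bar>)"
  defines "d \<equiv> 2 * K0 * K1 * K2 + pi * \<epsilon> * \<bar>real_of_int k\<bar> * (K1\<^sup>2 * (K0 + K2) - 2 * K0\<^sup>2 * K2)"
    and "n \<equiv> 4 * K1\<^sup>2 * K2 + pi * \<epsilon> * \<bar>real_of_int k\<bar> * K1 * (K1\<^sup>2 - K0 * K2)"
  shows "\<exists>u p c. stokes_solution \<epsilon> (fourier_mode k (axis e 1)) u p
    \<and> (\<forall>r>\<epsilon>. \<forall>z. force_density \<epsilon> u p r z = c r *s fourier_mode k (axis e 1) z)
    \<and> (c \<longlongrightarrow> of_real (2 * pi\<^sup>2 * \<epsilon> * \<bar>real_of_int k\<bar> * (n / d))) (at_right \<epsilon>)"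
proof -
  define kap where "kap = pi * \<bar>real_of_int k\<bar>"
  define K where "K = complex_of_real kap"
  define w where "w = \<i> * complex_of_real (pi * of_int k)"
  have kap: "kap > 0" using k by (simp add: kap_def)
  have w2: "w\<^sup>2 = - K\<^sup>2" and w0: "w \<noteq> 0" and Kn0: "K \<noteq> 0"
    using mode_constants[OF k] unfolding w_def K_def kap_def by blast+
  have ap: "atom_partial k n 1 x = - K * (of_real (x $ 1) * atom k (Suc n) x)"
    "atom_partial k n 2 x = - K * (of_real (x $ 2) * atom k (Suc n) x)"
    "atom_partial k n 3 x = w * atom k n x" for n x
    unfolding w_def K_def kap_def by (simp_all add: atom_partial_12 atom_partial_3)
  have x0: "pi * \<epsilon> * \<bar>real_of_int k\<bar> > 0" using k \<epsilon> by simp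
  have d: "d > 0" using normal_ratio_bounds(1)[OF x0] by (simp add: d_def K0_def K1_def K2_def)
  have Kpos: "K0 > 0" "K1 > 0" "K2 > 0" unfolding K0_def K1_def K2_def using x0 by (simp_all add: bessel_K_pos)
  define g where "g m = complex_of_real (profile k m \<epsilon>)" for m
  have g0: "g 0 = of_real K0" and g1: "g 1 = of_real (K1 / \<epsilon>)" and g2: "g 2 = of_real (K2 / \<epsilon>\<^sup>2)"
    using \<epsilon> by (simp_all add: g_def profile_def K0_def K1_def K2_def mult_ac)
  have gn0: "g 0 \<noteq> 0" "g 1 \<noteq> 0" "g 2 \<noteq> 0" using Kpos \<epsilon> unfolding g0 g1 g2 by simp_all
  \<comment> \<open>The boundary value of v for a = 1, with the other coefficients eliminated. By
    \<open>rM\<close> below it is -d / (2 K_1 K_2): the source of the denominator and the reason why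
    the normalisation is possible.\<close>
  define rM where "rM = - K0 + kap * \<epsilon> * (K0\<^sup>2 / K1 - K0 * K1 / K2) - K1\<^sup>2 / K2"
  have Krec: "2 * K1 = kap * \<epsilon> * (K2 - K0)"
  proof -
    define y where "y = pi * \<epsilon> * \<bar>real_of_int k\<bar>"
    have y: "y > 0" "y = kap * \<epsilon>" using x0 by (simp_all add: y_def kap_def mult_ac)
    have "K2 = K0 + 2 / y * K1"
      using bessel_K_recurrence[OF y(1), of 0] unfolding K0_def K1_def K2_def y_def by (simp add: numeral_2_eq_2)
    then have "2 * K1 = y * (K2 - K0)" using y(1) by (simp add: field_simps)
    then show ?thesis by (simp only: y(2))
  qed
  have rM: "2 * K1 * K2 * rM = - d"
  proof -
    have "2 * K1 * K2 * rM = - 2 * K0 * K1 * K2 + 2 * kap * \<epsilon> * (K0\<^sup>2 * K2 - K0 * K1\<^sup>2) - (2 * K1) * K1\<^sup>2"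
      using Kpos by (simp add: rM_def field_simps power2_eq_square)
    also have "\<dots> = - d" unfolding Krec d_def kap_def by (simp add: algebra_simps power2_eq_square)
    finally show ?thesis .
  qed
  then have rM0: "rM \<noteq> 0" using d Kpos by auto
  \<comment> \<open>All coefficients are real; \<open>ra\<close> and \<open>rd\<close> mirror them
    so that the arithmetic with quotients takes place over the reals.\<close>
  define ra where "ra = 1 / rM"
  define a where "a = complex_of_real ra"
  define cc where "cc = - a * g 1 / g 2"
  define b where "b = - a * g 0 / g 1"
  define dd where "dd = K * (cc - b) - 2 * a"
  have e0: "a * g 1 + cc * g 2 = 0" "a * g 0 + b * g 1 = 0" using gn0 by (simp_all add: cc_def b_def)
  have ccr: "cc = of_real (- ra * \<epsilon> * K1 / K2)" and br: "b = of_real (- ra * \<epsilon> * K0 / K1)"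
    unfolding cc_def b_def a_def g0 g1 g2 using \<epsilon> by (simp_all add: field_simps power2_eq_square)
  define rd where "rd = kap * (ra * \<epsilon> * K0 / K1 - ra * \<epsilon> * K1 / K2) - 2 * ra"
  have ddr: "dd = of_real rd"
    unfolding dd_def ccr br a_def K_def rd_def by (simp add: algebra_simps)
  have e1: "(a + dd) * g 0 + cc * g 1 = 1"
  proof -
    have "(ra + rd) * K0 + (- ra * \<epsilon> * K1 / K2) * (K1 / \<epsilon>) = ra * rM"
      using \<epsilon> by (simp add: rd_def rM_def algebra_simps power2_eq_square)
    also have "\<dots> = 1" using rM0 by (simp add: ra_def)
    finally have "complex_of_real ((ra + rd) * K0 + (- ra * \<epsilon> * K1 / K2) * (K1 / \<epsilon>)) = 1" by simp
    then show ?thesis unfolding a_def ddr ccr g0 g1 by (simp only: of_real_add of_real_mult)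
  qed
  define tw where "tw m = complex_of_real (2 * real m * (pi * \<bar>real_of_int k\<bar>))" for m
  have tw: "tw m = 2 * of_nat m * K" for m by (simp add: tw_def K_def kap_def)
  define v where "v = (\<lambda>x. (a + dd) * atom k 0 x + cc * atom k 1 x)"
  define Dv where "Dv = (\<lambda>j x. (a + dd) * atom_partial k 0 j x + cc * atom_partial k 1 j x)"
  define Lv where "Lv = (\<lambda>x. (a + dd) * (tw 0 * atom k (Suc 0) x) + cc * (tw 1 * atom k (Suc 1) x))"
  have v: "pd2 v Dv Lv" unfolding v_def Dv_def Lv_def tw_def by (intro pd2_add pd2_cmult pd2_atom k)
  define q where "q = (\<lambda>x. a * atom k 1 x + cc * atom k 2 x)"
  define Dq where "Dq = (\<lambda>j x. a * atom_partial k 1 j x + cc * atom_partial k 2 j x)"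
  define Lq where "Lq = (\<lambda>x. a * (tw 1 * atom k (Suc 1) x) + cc * (tw 2 * atom k (Suc 2) x))"
  have q: "pd2 q Dq Lq" unfolding q_def Dq_def Lq_def tw_def by (intro pd2_add pd2_cmult pd2_atom k)
  define h where "h = (\<lambda>x. a * atom k 0 x + b * atom k 1 x)"
  define Dh where "Dh = (\<lambda>j x. a * atom_partial k 0 j x + b * atom_partial k 1 j x)"
  define Lh where "Lh = (\<lambda>x. a * (tw 0 * atom k (Suc 0) x) + b * (tw 1 * atom k (Suc 1) x))"
  have h: "pd2 h Dh Lh" unfolding h_def Dh_def Lh_def tw_def by (intro pd2_add pd2_cmult pd2_atom k)
  define dl :: "3 \<Rightarrow> complex" where "dl = (\<lambda>i. if i = e then 1 else 0)"
  define U where "U i = (if i = 3 then (\<lambda>x. w * (complex_of_real (x $ e) * h x))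
     else (\<lambda>x. dl i * v x + (- K) * (complex_of_real (x $ e) * (complex_of_real (x $ i) * q x))))" for i
  define D where "D i = (if i = 3 then (\<lambda>j x. w * ((if j = e then h x else 0) + complex_of_real (x $ e) * Dh j x))
     else (\<lambda>j x. dl i * Dv j x + (- K) * ((if j = e then complex_of_real (x $ i) * q x else 0)
        + complex_of_real (x $ e) * ((if j = i then q x else 0) + complex_of_real (x $ i) * Dq j x))))" for i
  define L where "L i = (if i = 3 then (\<lambda>x. w * (complex_of_real (x $ e) * Lh x + 2 * Dh e x))
     else (\<lambda>x. dl i * Lv x + (- K) * (complex_of_real (x $ e) * (complex_of_real (x $ i) * Lq x + 2 * Dq i x)
        + 2 * ((if e = i then q x else 0) + complex_of_real (x $ i) * Dq e x))))" for i
  define P where "P = (\<lambda>x. - 2 * K * a * (complex_of_real (x $ e) * atom k 1 x))"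
  define DP where "DP = (\<lambda>j x. - 2 * K * a * ((if j = e then atom k 1 x else 0) + complex_of_real (x $ e) * atom_partial k 1 j x))"
  define LP where "LP = (\<lambda>x. - 2 * K * a * (complex_of_real (x $ e) * (tw 1 * atom k (Suc 1) x) + 2 * atom_partial k 1 e x))"
  have e3: "e \<noteq> 3" using e by auto
  have U2: "pd2 (U i) (D i) (L i)" for i
  proof (cases "i = 3")
    case True
    show ?thesis unfolding U_def D_def L_def if_P[OF True]
      by (rule pd2_cmult[OF pd2_coord[OF h]])
  next
    case False
    show ?thesis unfolding U_def D_def L_def if_not_P[OF False]
      by (rule pd2_add[OF pd2_cmult[OF v] pd2_cmult[OF pd2_coord[OF pd2_coord[OF q]]]])
  qed
  have Um: "U i \<in> modes k" for i
  proof (cases "i = 3")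
    case True
    show ?thesis unfolding U_def h_def if_P[OF True] by (intro modes.intros e3)
  next
    case False
    show ?thesis unfolding U_def v_def q_def if_not_P[OF False] by (intro modes.intros False e3)
  qed
  have Pm: "P \<in> modes k" unfolding P_def by (intro modes.intros e3)
  have P2: "pd2 P DP LP"
    unfolding P_def DP_def LP_def tw_def by (rule pd2_cmult[OF pd2_coord[OF pd2_atom[OF k]]])
  have rec: "K * ((of_real (x $ 1))\<^sup>2 + (of_real (x $ 2))\<^sup>2) * atom k (Suc (Suc m)) x
      = K * atom k m x + 2 * of_nat (Suc m) * atom k (Suc m) x" if "x \<in> Omega 0" for x m
    using atom_recurrence'[OF k that] by (simp only: K_def kap_def)
  have mom: "L i x = DP i x" if x: "x \<in> Omega 0" for i x
  proof -
    have "L 3 x = DP 3 x"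
      using e by (elim disjE; simp add: L_def DP_def Lh_def Dh_def tw ap algebra_simps numeral_2_eq_2)
    moreover have "L 1 x = DP 1 x"
      using e by (elim disjE; simp add: L_def DP_def Lv_def Lq_def Dq_def dl_def q_def tw ap numeral_2_eq_2;
          simp add: algebra_simps)
    moreover have "L 2 x = DP 2 x"
      using e by (elim disjE; simp add: L_def DP_def Lv_def Lq_def Dq_def dl_def q_def tw ap numeral_2_eq_2;
          simp add: algebra_simps)
    ultimately show ?thesis using UNIV_3_cases[of i] by auto
  qed
  have dv: "(\<Sum>i\<in>UNIV. D i i x) = 0" if x: "x \<in> Omega 0" for x
  proof -
    let ?r2 = "(complex_of_real (x $ 1))\<^sup>2 + (of_real (x $ 2))\<^sup>2"
    let ?xe = "complex_of_real (x $ e)"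
    \<comment> \<open>Sorted into multiples of two recurrences, of w^2 + \<kappa>^2, and of the
      relation that defines \<open>dd\<close>.\<close>
    have "(\<Sum>i\<in>UNIV. D i i x) = K * ?xe * (a * (K * ?r2 * atom k (Suc (Suc 0)) x - (K * atom k 0 x + 2 * of_nat (Suc 0) * atom k (Suc 0) x))
        + cc * (K * ?r2 * atom k (Suc (Suc (Suc 0))) x - (K * atom k (Suc 0) x + 2 * of_nat (Suc (Suc 0)) * atom k (Suc (Suc 0)) x)))
       + (w\<^sup>2 + K\<^sup>2) * ?xe * (a * atom k 0 x + b * atom k (Suc 0) x)
       - K * ?xe * atom k (Suc 0) x * (2 * a + dd - K * (cc - b))"
      unfolding sum_3
      using e by (elim disjE; simp add: D_def Dv_def Dh_def Dq_def q_def h_def dl_def ap numeral_2_eq_2;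
          simp add: algebra_simps power2_eq_square)
    then show ?thesis unfolding rec[OF x] w2 dd_def by simp
  qed
  have trig: "(complex_of_real (cos t))\<^sup>2 = 1 - (of_real (sin t))\<^sup>2" for t
    unfolding of_real_power[symmetric] cos_squared_eq by simp
  have bc: "U i (cyl \<epsilon> \<theta> z) = fourier_mode k (axis e 1) z $ i" for i \<theta> z
  proof -
    let ?E = "cis (pi * of_int k * z)"
    have "q (cyl \<epsilon> \<theta> z) = (a * g 1 + cc * g 2) * ?E"
      using \<epsilon> by (simp add: q_def atom_cyl g_def algebra_simps)
    moreover have "h (cyl \<epsilon> \<theta> z) = (a * g 0 + b * g 1) * ?E"
      using \<epsilon> by (simp add: h_def atom_cyl g_def algebra_simps)
    moreover have "v (cyl \<epsilon> \<theta> z) = ((a + dd) * g 0 + cc * g 1) * ?E"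
      using \<epsilon> by (simp add: v_def atom_cyl g_def algebra_simps)
    ultimately have "q (cyl \<epsilon> \<theta> z) = 0" "h (cyl \<epsilon> \<theta> z) = 0" "v (cyl \<epsilon> \<theta> z) = ?E"
      unfolding e0 e1 by simp_all
    then show ?thesis using e3 unfolding fourier_mode_axis by (auto simp: U_def dl_def)
  qed
  note sol = modes_stokes_solution[where ubar="fourier_mode k (axis e 1)", OF k \<epsilon> Um U2 Pm P2 mom dv bc]
  define S0 where "S0 r = (a + dd) * of_real (profile k 1 r) + cc * of_real (profile k 2 r)" for r
  define Q0 where "Q0 r = a * of_real (profile k 1 r) + cc * of_real (profile k 2 r)" for r
  define Q2 where "Q2 r = a * of_real (profile k 2 r) + cc * of_real (profile k 3 r)" for r
  define H0 where "H0 r = a * of_real (profile k 0 r) + b * of_real (profile k 1 r)" for r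
  define H1 where "H1 r = a * of_real (profile k 1 r) + b * of_real (profile k 2 r)" for r
  define V0 where "V0 r = (a + dd) * of_real (profile k 0 r) + cc * of_real (profile k 1 r)" for r
  \<comment> \<open>With n_1 = cos and n_2 = sin, the cross-sectional traction is n_e n_i X +
    delta_ie Y. The mean of n_e^2 is 1/2, which produces the combination X + 2Y in
    \<open>c\<close>.\<close>
  define Y where "Y r = of_real r * K * (S0 r + Q0 r)" for r
  define X where "X r = of_real r * K * (S0 r + 3 * Q0 r - 2 * K * (of_real r)\<^sup>2 * Q2 r - 2 * a * of_real (profile k 1 r))" for r
  define c where "c r = of_real (\<epsilon> * pi) * (X r + 2 * Y r)" for r
  let ?u = "\<lambda>x. if x \<in> Omega \<epsilon> then (\<chi> i. U i x) else 0"
  let ?p = "\<lambda>x. if x \<in> Omega \<epsilon> then P x else 0"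
  have "force_density \<epsilon> ?u ?p r z = c r *s fourier_mode k (axis e 1) z" if r: "r > \<epsilon>" for r z
  proof -
    let ?E = "cis (pi * of_int k * z)"
    let ?r = "complex_of_real r"
    define Z where "Z = - w * (H0 r - K * ?r\<^sup>2 * H1 r + V0 r - K * ?r\<^sup>2 * Q0 r)"
    have r0: "r > 0" using r \<epsilon> by simp
    have at: "atom k n (cyl r \<theta> z) = of_real (profile k n r) * ?E" for n \<theta> using atom_cyl[OF r0] .
    have vc: "v (cyl r \<theta> z) = V0 r * ?E" "q (cyl r \<theta> z) = Q0 r * ?E" "h (cyl r \<theta> z) = H0 r * ?E" for \<theta>
      by (simp_all add: v_def q_def h_def V0_def Q0_def H0_def at algebra_simps)
    have Dc: "Dv 1 (cyl r \<theta> z) = - K * (?r * of_real (cos \<theta>)) * S0 r * ?E"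
      "Dv 2 (cyl r \<theta> z) = - K * (?r * of_real (sin \<theta>)) * S0 r * ?E"
      "Dv 3 (cyl r \<theta> z) = w * V0 r * ?E"
      "Dq 1 (cyl r \<theta> z) = - K * (?r * of_real (cos \<theta>)) * Q2 r * ?E"
      "Dq 2 (cyl r \<theta> z) = - K * (?r * of_real (sin \<theta>)) * Q2 r * ?E"
      "Dq 3 (cyl r \<theta> z) = w * Q0 r * ?E"
      "Dh 1 (cyl r \<theta> z) = - K * (?r * of_real (cos \<theta>)) * H1 r * ?E"
      "Dh 2 (cyl r \<theta> z) = - K * (?r * of_real (sin \<theta>)) * H1 r * ?E"
      "Dh 3 (cyl r \<theta> z) = w * H0 r * ?E" for \<theta>
      by (simp_all add: Dv_def Dq_def Dh_def ap at cyl_components S0_def Q2_def H1_def V0_def Q0_def H0_def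
          numeral_2_eq_2 numeral_3_eq_3 algebra_simps)
    have Pc: "P (cyl r \<theta> z) = - 2 * K * a * (?r * of_real (if e = 1 then cos \<theta> else sin \<theta>) * of_real (profile k 1 r)) * ?E" for \<theta>
      using e by (auto simp: P_def at cyl_components)
    define v1 :: "complex^3" where "v1 = (\<chi> i. if i = 1 \<and> e = 1 then X r * ?E else 0)"
    define v2 :: "complex^3" where "v2 = (\<chi> i. if i = 2 \<and> e = 2 then X r * ?E else 0)"
    define v3 :: "complex^3" where "v3 = (\<chi> i. if i \<noteq> 3 \<and> i \<noteq> e then X r * ?E else 0)"
    define v4 :: "complex^3" where "v4 = (\<chi> i. if i = 3 \<and> e = 1 then Z * ?E else 0)"
    define v5 :: "complex^3" where "v5 = (\<chi> i. if i = 3 \<and> e = 2 then Z * ?E else 0)"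
    define v6 :: "complex^3" where "v6 = (\<chi> i. if i = e then Y r * ?E else 0)"
    have F: "force_density \<epsilon> ?u ?p r z = (\<epsilon> * pi) *\<^sub>R (v1 + v2 + 2 *\<^sub>R v6)"
    proof (rule force_density_eq[where S = "\<lambda>i j x. D i j x + D j i x - (if i = j then P x else 0)"
          and ?v3.0 = v3 and ?v4.0 = v4 and ?v5.0 = v5, OF \<epsilon> r sol(2)])
      fix i \<theta>
      let ?c = "complex_of_real (cos \<theta>)" and ?s = "complex_of_real (sin \<theta>)"
      let ?S = "\<lambda>i j x. D i j x + D j i x - (if i = j then P x else 0)"
      let ?ne = "if e = 1 then ?c else ?s"
      have cs: "?c\<^sup>2 + ?s\<^sup>2 - 1 = 0" using trig[of \<theta>] by simp
      have 1: "- (?c * ?S 1 1 (cyl r \<theta> z) + ?s * ?S 1 2 (cyl r \<theta> z))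
         = ?ne * ?c * X r * ?E + dl 1 * Y r * ?E
           + (dl 1 * Y r - 2 * K * ?r * (K * ?r\<^sup>2 * Q2 r) * ?ne * ?c) * ?E * (?c\<^sup>2 + ?s\<^sup>2 - 1)"
        using e by (elim disjE; simp add: D_def Dc vc Pc cyl_components dl_def X_def Y_def;
            simp add: algebra_simps power2_eq_square)
      have 2: "- (?c * ?S 2 1 (cyl r \<theta> z) + ?s * ?S 2 2 (cyl r \<theta> z))
         = ?ne * ?s * X r * ?E + dl 2 * Y r * ?E
           + (dl 2 * Y r - 2 * K * ?r * (K * ?r\<^sup>2 * Q2 r) * ?ne * ?s) * ?E * (?c\<^sup>2 + ?s\<^sup>2 - 1)"
        using e by (elim disjE; simp add: D_def Dc vc Pc cyl_components dl_def X_def Y_def;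
            simp add: algebra_simps power2_eq_square)
      have 3: "- (?c * ?S 3 1 (cyl r \<theta> z) + ?s * ?S 3 2 (cyl r \<theta> z)) = ?ne * Z * ?E
         + w * K * ?r\<^sup>2 * (H1 r + Q0 r) * ?ne * ?E * (?c\<^sup>2 + ?s\<^sup>2 - 1)"
        using e by (elim disjE; simp add: D_def Dc vc Pc cyl_components dl_def Z_def;
            simp add: algebra_simps power2_eq_square)
      show "- (?c * ?S i 1 (cyl r \<theta> z) + ?s * ?S i 2 (cyl r \<theta> z))
        = of_real ((cos \<theta>)\<^sup>2) * v1 $ i + of_real ((sin \<theta>)\<^sup>2) * v2 $ i
        + of_real (cos \<theta> * sin \<theta>) * v3 $ i + ?c * v4 $ i + ?s * v5 $ i + v6 $ i"
        using UNIV_3_cases[of i] e 1[unfolded cs mult_zero_right add_0_right] 2[unfolded cs mult_zero_right add_0_right]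
          3[unfolded cs mult_zero_right add_0_right] unfolding v1_def v2_def v3_def v4_def v5_def v6_def
        by (elim disjE) (simp_all add: dl_def power2_eq_square mult_ac)
    qed
    have Fi: "force_density \<epsilon> ?u ?p r z $ i
        = complex_of_real (\<epsilon> * pi) * (v1 $ i + v2 $ i + 2 * v6 $ i)" for i
      unfolding F by (simp only: vector_scaleR_component vector_add_component
          scaleR_conv_of_real[where 'a=complex] of_real_numeral)
    have vi: "v1 $ i + v2 $ i + 2 * v6 $ i = (if i = e then (X r + 2 * Y r) * ?E else 0)" for i
      unfolding v1_def v2_def v6_def using e by (auto simp: distrib_right)
    show ?thesis unfolding vec_eq_iff Fi vi vector_smult_component fourier_mode_axis c_def
      by (auto simp only: if_True if_False mult_zero_right mult.assoc split: if_split)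
  qed
  moreover have "(c \<longlongrightarrow> of_real (2 * pi\<^sup>2 * \<epsilon> * \<bar>real_of_int k\<bar> * (n / d))) (at_right \<epsilon>)"
  proof -
    have "((\<lambda>r. complex_of_real (profile k n r)) \<longlongrightarrow> g n) (at_right \<epsilon>)" for n
      unfolding g_def using isCont_profile[OF k \<epsilon>, of n, unfolded isCont_def]
      by (intro tendsto_of_real) (rule tendsto_mono[OF at_le[OF subset_UNIV]])
    then have lim: "(c \<longlongrightarrow> of_real (\<epsilon> * pi) * (of_real \<epsilon> * K * (((a + dd) * g 1 + cc * g 2) + 3 * (a * g 1 + cc * g 2)
        - 2 * K * (of_real \<epsilon>)\<^sup>2 * (a * g 2 + cc * g 3) - 2 * a * g 1)
        + 2 * (of_real \<epsilon> * K * (((a + dd) * g 1 + cc * g 2) + (a * g 1 + cc * g 2))))) (at_right \<epsilon>)"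
      unfolding c_def X_def Y_def S0_def Q0_def Q2_def by (intro tendsto_intros)
    have r2: "K * (of_real \<epsilon>)\<^sup>2 * g 2 = K * g 0 + 2 * g 1" and r3: "K * (of_real \<epsilon>)\<^sup>2 * g 3 = K * g 1 + 4 * g 2"
    proof -
      have "complex_of_real (kap * \<epsilon>\<^sup>2 * profile k 2 \<epsilon>) = of_real (kap * profile k 0 \<epsilon> + 2 * profile k 1 \<epsilon>)"
        using profile_recurrence[OF k \<epsilon>, of 0] unfolding kap_def by (simp add: numeral_2_eq_2)
      then show "K * (of_real \<epsilon>)\<^sup>2 * g 2 = K * g 0 + 2 * g 1" by (simp add: K_def g_def)
      have "complex_of_real (kap * \<epsilon>\<^sup>2 * profile k 3 \<epsilon>) = of_real (kap * profile k 1 \<epsilon> + 4 * profile k 2 \<epsilon>)"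
        using profile_recurrence[OF k \<epsilon>, of 1] unfolding kap_def by (simp add: numeral_2_eq_2 numeral_3_eq_3)
      then show "K * (of_real \<epsilon>)\<^sup>2 * g 3 = K * g 1 + 4 * g 2" by (simp add: K_def g_def)
    qed
    \<comment> \<open>This is (X + 2Y)/(\<epsilon>\<kappa>) at the wall. There q = 0, and the
      recurrences for \<open>g 2\<close> and \<open>g 3\<close> leave only \<open>g 0\<close> and
      \<open>g 1\<close>.\<close>
    let ?V = "((a + dd) * g 1 + cc * g 2) + 3 * (a * g 1 + cc * g 2)
        - 2 * K * (of_real \<epsilon>)\<^sup>2 * (a * g 2 + cc * g 3) - 2 * a * g 1
        + 2 * (((a + dd) * g 1 + cc * g 2) + (a * g 1 + cc * g 2))"
    have V: "?V = of_real (3 * rd * K1 / \<epsilon> - 2 * kap * (ra * K0 - ra * K1\<^sup>2 / K2) + 2 * ra * K1 / \<epsilon>)"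
    proof -
      have "?V = 8 * (a * g 1 + cc * g 2) + 3 * dd * g 1 - 2 * (a * (K * (of_real \<epsilon>)\<^sup>2 * g 2) + cc * (K * (of_real \<epsilon>)\<^sup>2 * g 3))
          - 2 * (a * g 1 + cc * g 2) + 2 * cc * g 2"
        by (simp add: algebra_simps)
      also have "\<dots> = 3 * dd * g 1 - 2 * K * (a * g 0 + cc * g 1) + 2 * a * g 1"
        unfolding r2 r3 by (simp add: algebra_simps)
      also have "\<dots> = of_real (3 * rd * K1 / \<epsilon> - 2 * kap * (ra * K0 - ra * K1\<^sup>2 / K2) + 2 * ra * K1 / \<epsilon>)"
        unfolding ddr a_def ccr K_def g0 g1 using \<epsilon> by (simp add: algebra_simps power2_eq_square)
      finally show ?thesis .
    qed
    have real_val: "\<epsilon> * pi * (\<epsilon> * kap * (3 * rd * K1 / \<epsilon> - 2 * kap * (ra * K0 - ra * K1\<^sup>2 / K2) + 2 * ra * K1 / \<epsilon>))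
        = 2 * pi\<^sup>2 * \<epsilon> * \<bar>real_of_int k\<bar> * (n / d)"
    proof -
      define W where "W = 3 * rd * K1 / \<epsilon> - 2 * kap * (ra * K0 - ra * K1\<^sup>2 / K2) + 2 * ra * K1 / \<epsilon>"
      have "\<epsilon> * W * K2 = ra * (kap * \<epsilon> * (K0 * K2 - K1\<^sup>2) - 4 * K1 * K2)"
        using \<epsilon> Kpos by (simp add: W_def rd_def field_simps power2_eq_square)
      then have "\<epsilon> * W * K2 * K1 = ra * (kap * \<epsilon> * (K0 * K2 - K1\<^sup>2) - 4 * K1 * K2) * K1"
        by (simp only:)
      also have "\<dots> = - ra * n"
        by (simp add: n_def kap_def algebra_simps power2_eq_square)
      finally have x1: "\<epsilon> * W * K2 * K1 = - ra * n" .
      have x2: "ra * d = - 2 * K1 * K2" using rM rM0 by (simp add: ra_def field_simps)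
      have "(\<epsilon> * W * K2 * K1) * d = - (ra * d) * n" unfolding x1 by simp
      also have "\<dots> = n * (2 * K1 * K2)" unfolding x2 by simp
      finally have "(\<epsilon> * W * K2 * K1) * d = n * (2 * K1 * K2)" .
      then have "(\<epsilon> * W * d) * (K1 * K2) = (2 * n) * (K1 * K2)" by (simp only: mult_ac)
      then have "\<epsilon> * W = 2 * n / d" using Kpos d by (simp add: field_simps)
      moreover have "\<epsilon> * pi * (\<epsilon> * kap * W) = pi * kap * \<epsilon> * (\<epsilon> * W)" by (simp only: mult_ac)
      ultimately show ?thesis unfolding W_def[symmetric] by (simp add: kap_def power2_eq_square)
    qed
    have "of_real (\<epsilon> * pi) * (of_real \<epsilon> * K * (((a + dd) * g 1 + cc * g 2) + 3 * (a * g 1 + cc * g 2)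
        - 2 * K * (of_real \<epsilon>)\<^sup>2 * (a * g 2 + cc * g 3) - 2 * a * g 1)
        + 2 * (of_real \<epsilon> * K * (((a + dd) * g 1 + cc * g 2) + (a * g 1 + cc * g 2))))
       = of_real (\<epsilon> * pi) * (of_real \<epsilon> * K * ?V)"
      by (simp add: algebra_simps)
    also have "\<dots> = complex_of_real (2 * pi\<^sup>2 * \<epsilon> * \<bar>real_of_int k\<bar> * (n / d))"
      unfolding V unfolding K_def real_val[symmetric] by (simp only: of_real_mult)
    finally show ?thesis using lim by (simp only:)
  qed
  ultimately show ?thesis using sol(1) by blast
qed

section \<open>Uniqueness of the finite-energy solution\<close>

lemma integral_ge_log:
  fixes f :: "real \<Rightarrow> real"
  assumes "e < a" "a \<le> b" "0 \<le> c" and f: "continuous_on {a..b} f" and le: "\<And>r. a \<le> r \<Longrightarrow> r \<le> b \<Longrightarrow> c / (r - e) \<le> f r"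
  shows "c * (ln (b - e) - ln (a - e)) \<le> integral {a..b} f"
proof -
  have "((\<lambda>r. c / (r - e)) has_integral (c * ln (b - e) - c * ln (a - e))) {a..b}"
  proof (rule fundamental_theorem_of_calculus[OF assms(2)])
    fix r assume "r \<in> {a..b}"
    then have "((\<lambda>r. c * ln (r - e)) has_real_derivative c / (r - e)) (at r within {a..b})"
      using assms by (auto intro!: derivative_eq_intros)
    then show "((\<lambda>r. c * ln (r - e)) has_vector_derivative c / (r - e)) (at r within {a..b})"
      by (simp add: has_real_derivative_iff_has_vector_derivative)
  qed
  moreover have "f integrable_on {a..b}" using f by (rule integrable_continuous_real)
  ultimately show ?thesis
    using le by (subst right_diff_distrib) (rule has_integral_le[OF _ integrable_integral], auto)
qed

text \<open>Read M(r) as the integral of |w|^2 over the parameter cell, E(r) as that of |grad w|^2 +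
  |q|^2, and \<open>B\<close> as a bound for the energy of any shell. The flux is bounded with a
  free weight s; choosing s so that the M term takes at most half of the flux leaves a lower bound
  for r E(r) whose integral diverges logarithmically, at infinity with e = 0 in
  \<open>integral_ge_log\<close> and at the wall with e = \<epsilon>.\<close>

lemma energy_vanishes:
  fixes \<Phi> \<Phi>' M M' E :: "real \<Rightarrow> real"
  assumes \<epsilon>: "\<epsilon> > 0"
    and der\<Phi>: "\<And>r. r > \<epsilon> \<Longrightarrow> (\<Phi> has_real_derivative \<Phi>' r) (at r)" and pos\<Phi>: "\<And>r. r > \<epsilon> \<Longrightarrow> \<Phi>' r \<ge> 0"
    and \<Phi>: "\<And>r s. r > \<epsilon> \<Longrightarrow> s > 0 \<Longrightarrow> \<bar>\<Phi> r\<bar> \<le> r * (4 * s * M r + 2 * E r / s)"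
    and derM: "\<And>r. r > \<epsilon> \<Longrightarrow> (M has_real_derivative M' r) (at r)"
    and M': "\<And>r s. r > \<epsilon> \<Longrightarrow> s > 0 \<Longrightarrow> M' r \<le> 2 * s * M r + E r / s"
    and Mpos: "\<And>r. r > \<epsilon> \<Longrightarrow> M r \<ge> 0"
    and M0: "(M \<longlongrightarrow> 0) (at_right \<epsilon>)" and Mbd: "\<And>r. r \<ge> R \<Longrightarrow> M r \<le> m"
    and Econt: "continuous_on {\<epsilon><..} E" and Epos: "\<And>r. r > \<epsilon> \<Longrightarrow> E r \<ge> 0"
    and B: "\<And>a b. \<epsilon> < a \<Longrightarrow> a \<le> b \<Longrightarrow> integral {a..b} (\<lambda>r. r * E r) \<le> B"
    and r0: "r0 > \<epsilon>"
  shows "\<Phi> r0 = 0"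
proof -
  have mono: "\<Phi> a \<le> \<Phi> b" if "\<epsilon> < a" "a \<le> b" for a b
    by (rule DERIV_nonneg_imp_nondecreasing[OF that(2)])
       (use der\<Phi> pos\<Phi> that in \<open>meson order.strict_trans1 order.strict_trans2\<close>)
  have cE: "continuous_on {a..b} E" if "\<epsilon> < a" for a b
    by (rule continuous_on_subset[OF Econt]) (use that in auto)
  have crE: "continuous_on {a..b} (\<lambda>r. r * E r)" if "\<epsilon> < a" for a b
    by (intro continuous_intros cE that)
  \<comment> \<open>Here y stands for the logarithm of a moving limit of integration; linear growth
    in y contradicts the energy bound.\<close>
  have unbounded: False if "c > 0" "\<And>y. y \<ge> y0 \<Longrightarrow> c * (y - d) \<le> B" for c d y0 :: real
  proof -
    let ?y = "max y0 (d + (\<bar>B\<bar> + 1) / c)"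
    have "\<bar>B\<bar> + 1 \<le> c * (?y - d)"
    proof -
      have "(\<bar>B\<bar> + 1) / c \<le> ?y - d" by linarith
      then show ?thesis using that(1) by (simp add: pos_divide_le_eq mult.commute)
    qed
    with that(2)[of ?y] show False by linarith
  qed
  have le0: "\<not> \<Phi> r0 > 0"
  proof
    assume c: "\<Phi> r0 > 0"
    let ?c = "\<Phi> r0"
    define k where "k = max m 1"
    have k: "k > 0" "\<And>r. r \<ge> R \<Longrightarrow> M r \<le> k"
      unfolding k_def using Mbd by (simp, meson max.coboundedI1)
    define a where "a = max r0 (max R 1)"
    have a: "a \<ge> r0" "a \<ge> R" "a > 0" "a > \<epsilon>" using r0 by (auto simp: a_def)
    have low: "?c\<^sup>2 / (32 * k) / (r - 0) \<le> r * E r" if r: "a \<le> r" for r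
    proof -
      have rp: "r > 0" "r > \<epsilon>" using r a by auto
      \<comment> \<open>Solves 4 r s k = c/2, so that the M term uses up half of the flux.\<close>
      let ?s = "?c / (8 * r * k)"
      have s: "?s > 0" using c rp k by simp
      have "?c \<le> \<Phi> r" using mono[of r0 r] r a r0 by auto
      also have "\<dots> \<le> r * (4 * ?s * M r + 2 * E r / ?s)" using \<Phi>[OF rp(2) s] by linarith
      also have "\<dots> \<le> r * (4 * ?s * k + 2 * E r / ?s)"
      proof -
        have "0 \<le> 4 * ?s" using s by (intro mult_nonneg_nonneg) (simp_all only: less_imp_le zero_le_numeral)
        then have "4 * ?s * M r \<le> 4 * ?s * k" using r a by (intro mult_left_mono k(2)) (simp_all only: order.trans)
        then show ?thesis by (rule mult_left_mono[OF add_right_mono less_imp_le[OF rp(1)]])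
      qed
      also have "\<dots> = ?c / 2 + 16 * r * k / ?c * (r * E r)"
        using c rp k by (simp add: field_simps)
      finally have "?c / 2 \<le> 16 * r * k / ?c * (r * E r)" by simp
      then show ?thesis using c rp k by (simp add: field_simps power2_eq_square)
    qed
    have "?c\<^sup>2 / (32 * k) * (y - ln a) \<le> B" if "y \<ge> ln a" for y
    proof -
      have "a \<le> exp y" using that a(3) by (simp add: ln_ge_iff[symmetric] flip: ln_le_cancel_iff)
      then have "?c\<^sup>2 / (32 * k) * (ln (exp y - 0) - ln (a - 0)) \<le> integral {a..exp y} (\<lambda>r. r * E r)"
        using low k a by (intro integral_ge_log crE) auto
      also have "\<dots> \<le> B" using B[OF a(4) \<open>a \<le> exp y\<close>] .
      finally show ?thesis by simp
    qed
    then show False using unbounded[of "?c\<^sup>2 / (32 * k)" "ln a" "ln a"] c k by simp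
  qed
  have ge0: "\<not> \<Phi> r0 < 0"
  proof
    assume "\<Phi> r0 < 0"
    define c where "c = - \<Phi> r0"
    have c: "c > 0" using \<open>\<Phi> r0 < 0\<close> by (simp add: c_def)
    have B0: "B \<ge> 0"
      using B[OF r0 order.refl] by simp
    \<comment> \<open>Towards the wall boundedness of M is too weak; the linear bound M(r) <= C (r -
      \<epsilon>) is needed, and it is here that the trace condition enters. The summand 1 keeps C
      positive when B = 0.\<close>
    define C where "C = exp 2 * (B / \<epsilon> + 1)"
    have C: "C > 0" using B0 \<epsilon> by (simp add: C_def add_nonneg_pos)
    have Mle: "M r \<le> C * (r - \<epsilon>)" if r: "r > \<epsilon>" for r
    proof -
      define t where "t = r - \<epsilon>"
      have t: "t > 0" using r by (simp add: t_def)
      have step: "M r * exp (- 2) \<le> M a + t * (B / \<epsilon>)" if a: "\<epsilon> < a" "a \<le> r" for a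
      proof -
        \<comment> \<open>A base point strictly to the left of \<open>a\<close> makes the integral
          of E differentiable from both sides at \<open>a\<close>.\<close>
        define a' where "a' = (\<epsilon> + a) / 2"
        have a': "\<epsilon> < a'" "a' < a" using a by (auto simp: a'_def)
        \<comment> \<open>Gronwall for M' <= 2 s M + E/s with s = 1/t: since t = r - \<epsilon> is
          the full distance to the wall, the exponential never falls below exp(-2) up to r.\<close>
        define h where "h x = M x * exp (- 2 * (x - \<epsilon>) / t) - t * integral {a'..x} E" for x
        have hle: "h r \<le> h a"
        proof (rule DERIV_nonpos_imp_nonincreasing[OF a(2)])
          fix x assume x: "a \<le> x" "x \<le> r"
          have xe: "x > \<epsilon>" using x a by simp
          let ?e = "exp (- 2 * (x - \<epsilon>) / t)"
          have "((\<lambda>x. integral {a'..x} E) has_real_derivative E x) (at x within {a'..r+1})"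
            using integral_has_real_derivative[OF cE[OF a'(1)], of x "r + 1"] x a' by simp
          moreover have "at x within {a'..r+1} = at x"
            using x a' by (intro at_within_interior) auto
          ultimately have dI: "((\<lambda>x. integral {a'..x} E) has_real_derivative E x) (at x)" by simp
          have "(h has_real_derivative (M' x * ?e + M x * (?e * (- 2 / t)) - t * E x)) (at x)"
            unfolding h_def[abs_def] using t
            by (auto intro!: derivative_eq_intros derM[OF xe] dI)
          moreover have "M' x * ?e + M x * (?e * (- 2 / t)) - t * E x \<le> 0"
          proof -
            have "M' x \<le> 2 * (1 / t) * M x + E x / (1 / t)" using M'[OF xe, of "1 / t"] t by simp
            then have "M' x - 2 / t * M x \<le> t * E x" by (simp add: mult.commute)
            then have "(M' x - 2 / t * M x) * ?e \<le> (t * E x) * ?e" by (rule mult_right_mono) simp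
            also have "\<dots> \<le> t * E x * 1"
              using t Epos[OF xe] xe by (intro mult_left_mono) (auto simp: divide_nonpos_pos)
            finally show ?thesis by (simp add: algebra_simps)
          qed
          ultimately show "\<exists>y. DERIV h x :> y \<and> y \<le> 0" by blast
        qed
        have "M r * exp (- 2) \<le> M a * exp (- 2 * (a - \<epsilon>) / t) + t * integral {a'..r} E - t * integral {a'..a} E"
        proof -
          have "exp (- 2 * (r - \<epsilon>) / t) = exp (- 2)" using t by (simp add: t_def field_simps)
          then show ?thesis using hle unfolding h_def by simp
        qed
        moreover have "M a * exp (- 2 * (a - \<epsilon>) / t) \<le> M a"
          using Mpos[OF a(1)] a(1) t by (intro mult_left_le) (auto simp: divide_nonpos_pos)
        moreover have "0 \<le> t * integral {a'..a} E"
          using t a' Epos by (intro mult_nonneg_nonneg integral_nonneg integrable_continuous_real cE) auto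
        moreover have "integral {a'..r} E \<le> B / \<epsilon>"
        proof -
          have "integral {a'..r} (\<lambda>r. \<epsilon> * E r) \<le> integral {a'..r} (\<lambda>r. r * E r)"
            using a' Epos by (intro integral_le integrable_continuous_real crE continuous_on_mult_left cE)
              (auto intro!: mult_right_mono)
          also have "\<dots> \<le> B" using a a' by (intro B) auto
          finally show ?thesis using \<epsilon> by (simp add: field_simps)
        qed
        then have "t * integral {a'..r} E \<le> t * (B / \<epsilon>)" using t by (intro mult_left_mono) auto
        ultimately show ?thesis by linarith
      qed
      \<comment> \<open>Letting \<open>a\<close> tend to the wall removes M(a), and a bound linear
        in t remains.\<close>
      have "M r * exp (- 2) \<le> 0 + t * (B / \<epsilon>)"
      proof (rule tendsto_lowerbound)
        show "((\<lambda>a. M a + t * (B / \<epsilon>)) \<longlongrightarrow> 0 + t * (B / \<epsilon>)) (at_right \<epsilon>)"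
          by (intro tendsto_intros M0)
        show "\<forall>\<^sub>F a in at_right \<epsilon>. M r * exp (- 2) \<le> M a + t * (B / \<epsilon>)"
          using eventually_at_right_real[OF r] by eventually_elim (use step in auto)
      qed simp
      then have "M r \<le> exp 2 * (t * (B / \<epsilon>))"
        by (simp add: exp_minus field_simps)
      also have "\<dots> \<le> C * t" using t by (simp add: C_def algebra_simps)
      finally show ?thesis by (simp add: t_def)
    qed
    have low: "c\<^sup>2 / (32 * r0 * C) / (r - \<epsilon>) \<le> r * E r" if r: "\<epsilon> < r" "r \<le> r0" for r
    proof -
      have rp: "r > 0" "r0 > 0" using r r0 \<epsilon> by auto
      \<comment> \<open>With the linear bound the M term becomes at most (r/r0) c/2, hence at most
        c/2.\<close>
      let ?s = "c / (8 * r0 * C * (r - \<epsilon>))"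
      have s: "?s > 0" using c rp C r by simp
      have "c \<le> \<bar>\<Phi> r\<bar>" using mono[of r r0] r by (auto simp: c_def)
      also have "\<dots> \<le> r * (4 * ?s * M r + 2 * E r / ?s)" using \<Phi>[OF r(1) s] .
      also have "\<dots> \<le> r * (4 * ?s * (C * (r - \<epsilon>)) + 2 * E r / ?s)"
      proof -
        have "0 \<le> 4 * ?s" using s by (intro mult_nonneg_nonneg) (simp_all only: less_imp_le zero_le_numeral)
        then have "4 * ?s * M r \<le> 4 * ?s * (C * (r - \<epsilon>))" by (rule mult_left_mono[OF Mle[OF r(1)]])
        then show ?thesis by (rule mult_left_mono[OF add_right_mono less_imp_le[OF rp(1)]])
      qed
      also have "\<dots> = r / r0 * (c / 2) + 16 * r0 * C * (r - \<epsilon>) / c * (r * E r)"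
        using c rp C r by (simp add: field_simps)
      also have "r / r0 * (c / 2) \<le> 1 * (c / 2)" using r rp c by (intro mult_right_mono) auto
      finally have "c / 2 \<le> 16 * r0 * C * (r - \<epsilon>) / c * (r * E r)" by simp
      then show ?thesis using c rp C r by (simp add: field_simps power2_eq_square)
    qed
    have "c\<^sup>2 / (32 * r0 * C) * (y - (- ln (r0 - \<epsilon>))) \<le> B" if "y \<ge> - ln (r0 - \<epsilon>)" for y
    proof -
      \<comment> \<open>The lower limit approaches the wall, with y minus the logarithm of its
        distance.\<close>
      let ?a = "\<epsilon> + exp (- y)"
      have "exp (- y) \<le> exp (ln (r0 - \<epsilon>))" using that by simp
      then have a: "\<epsilon> < ?a" "?a \<le> r0" using r0 by auto
      have "c\<^sup>2 / (32 * r0 * C) * (ln (r0 - \<epsilon>) - ln (?a - \<epsilon>)) \<le> integral {?a..r0} (\<lambda>r. r * E r)"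
      proof (rule integral_ge_log[OF a _ crE[OF a(1)]])
        show "0 \<le> c\<^sup>2 / (32 * r0 * C)" using C r0 \<epsilon> by (intro divide_nonneg_nonneg) auto
        fix r assume r: "?a \<le> r" "r \<le> r0"
        show "c\<^sup>2 / (32 * r0 * C) / (r - \<epsilon>) \<le> r * E r"
          by (rule low[OF order.strict_trans2[OF a(1) r(1)] r(2)])
      qed
      also have "\<dots> \<le> B" using B[OF a] .
      finally show ?thesis by (simp add: algebra_simps)
    qed
    then show False using unbounded[of "c\<^sup>2 / (32 * r0 * C)" "- ln (r0 - \<epsilon>)" "- ln (r0 - \<epsilon>)"] c C r0 \<epsilon> by simp
  qed
  show ?thesis using le0 ge0 by linarith
qed

section \<open>Differentiation and integration on the coaxial cylinders\<close>

abbreviation cell :: "(real \<times> real) set" where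
  "cell \<equiv> cbox (0, -1) (2 * pi, 1)"

lemma has_partials_chain:
  assumes "has_partials f D (\<gamma> t)" "(\<gamma> has_vector_derivative v) (at t)"
  shows "((\<lambda>t. f (\<gamma> t)) has_vector_derivative (\<Sum>j\<in>UNIV. v $ j *\<^sub>R D j)) (at t)"
  using has_derivative_compose[OF assms(2)[unfolded has_vector_derivative_def] assms(1)[unfolded has_partials_def]]
  unfolding has_vector_derivative_def by (simp add: scaleR_sum_right)

lemma cyl_axis: "cyl r \<theta> z = (r * cos \<theta>) *\<^sub>R axis 1 1 + (r * sin \<theta>) *\<^sub>R axis 2 1 + z *\<^sub>R axis 3 1"
  unfolding vec_eq_3 by (simp add: cyl_components axis_def)

lemma cyl_has_derivative_r:
  "((\<lambda>r. cyl r \<theta> z) has_vector_derivative (cos \<theta> *\<^sub>R axis 1 1 + sin \<theta> *\<^sub>R axis 2 1)) (at r)"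
  unfolding cyl_axis by (auto intro!: derivative_eq_intros simp flip: has_real_derivative_iff_has_vector_derivative)

lemma cyl_has_derivative_\<theta>:
  "((\<lambda>\<theta>. cyl r \<theta> z) has_vector_derivative ((- r * sin \<theta>) *\<^sub>R axis 1 1 + (r * cos \<theta>) *\<^sub>R axis 2 1)) (at \<theta>)"
  unfolding cyl_axis
  by (auto intro!: derivative_eq_intros simp: algebra_simps simp flip: has_real_derivative_iff_has_vector_derivative)

lemma cyl_has_derivative_z:
  "((\<lambda>z. cyl r \<theta> z) has_vector_derivative axis 3 1) (at z)"
  unfolding cyl_axis by (auto intro!: derivative_eq_intros simp flip: has_real_derivative_iff_has_vector_derivative)

lemma has_partials_cyl_r:
  fixes f :: "real^3 \<Rightarrow> 'b::real_normed_vector"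
  assumes "has_partials f D (cyl r \<theta> z)"
  shows "((\<lambda>r. f (cyl r \<theta> z)) has_vector_derivative (cos \<theta> *\<^sub>R D 1 + sin \<theta> *\<^sub>R D 2)) (at r)"
  using has_partials_chain[of f D "\<lambda>r. cyl r \<theta> z", OF assms cyl_has_derivative_r] by (simp add: sum_3 axis_def)

lemma has_partials_cyl_\<theta>:
  fixes f :: "real^3 \<Rightarrow> 'b::real_normed_vector"
  assumes "has_partials f D (cyl r \<theta> z)"
  shows "((\<lambda>\<theta>. f (cyl r \<theta> z)) has_vector_derivative ((- r * sin \<theta>) *\<^sub>R D 1 + (r * cos \<theta>) *\<^sub>R D 2)) (at \<theta>)"
  using has_partials_chain[of f D "\<lambda>\<theta>. cyl r \<theta> z", OF assms cyl_has_derivative_\<theta>] by (simp add: sum_3 axis_def)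

lemma has_partials_cyl_z:
  fixes f :: "real^3 \<Rightarrow> 'b::real_normed_vector"
  assumes "has_partials f D (cyl r \<theta> z)"
  shows "((\<lambda>z. f (cyl r \<theta> z)) has_vector_derivative D 3) (at z)"
  using has_partials_chain[of f D "\<lambda>z. cyl r \<theta> z", OF assms cyl_has_derivative_z] by (simp add: sum_3 axis_def)

lemma continuous_on_comp_cyl:
  fixes S :: "'a::euclidean_space set"
  assumes "0 \<le> \<epsilon>" "continuous_on (Omega \<epsilon>) f" "continuous_on S a" "continuous_on S b" "continuous_on S c"
    and "\<And>x. x \<in> S \<Longrightarrow> a x > \<epsilon>"
  shows "continuous_on S (\<lambda>x. f (cyl (a x) (b x) (c x)))"
proof -
  have "continuous_on S (\<lambda>x. cyl (a x) (b x) (c x))"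
    unfolding cyl_axis by (intro continuous_on_add continuous_on_scaleR continuous_on_mult continuous_on_cos
        continuous_on_sin continuous_on_const assms(3-5))
  then show ?thesis
    by (rule continuous_on_compose2[OF assms(2)]) (use assms(1,6) in \<open>auto intro: cyl_in_Omega\<close>)
qed

lemma continuous_on_cyl_slice:
  assumes "0 \<le> \<epsilon>" "continuous_on (Omega \<epsilon>) f" "r > \<epsilon>"
  shows "continuous_on S (\<lambda>q. f (cyl r (fst q) (snd q)))"
  by (rule continuous_on_comp_cyl[OF assms(1,2)]) (use assms(3) in \<open>auto intro!: continuous_intros\<close>)

lemma integral_\<theta>_derivative_eq_0:
  fixes f f' :: "real \<Rightarrow> real \<Rightarrow> real"
  assumes "\<And>t z. ((\<lambda>t. f t z) has_real_derivative f' t z) (at t)"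
    and "continuous_on cell (\<lambda>q. f' (fst q) (snd q))" and "\<And>z. f (2 * pi) z = f 0 z"
  shows "integral cell (\<lambda>q. f' (fst q) (snd q)) = 0"
proof -
  have c: "continuous_on cell (\<lambda>(t, z). f' t z)"
    using assms(2) by (simp add: case_prod_unfold)
  have "integral cell (\<lambda>q. f' (fst q) (snd q)) = integral (cbox 0 (2*pi)) (\<lambda>t. integral (cbox (-1) 1) (\<lambda>z. f' t z))"
    using integral_prod_continuous[OF assms(2)] by simp
  also have "\<dots> = integral (cbox (-1) 1) (\<lambda>z. integral (cbox 0 (2*pi)) (\<lambda>t. f' t z))"
    by (rule integral_swap_continuous[OF c])
  also have "\<dots> = integral (cbox (-1) 1) (\<lambda>z::real. 0)"
  proof (rule Henstock_Kurzweil_Integration.integral_cong)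
    fix z :: real
    have "((\<lambda>t. f' t z) has_integral (f (2*pi) z - f 0 z)) {0..2*pi}"
      using assms(1) by (intro fundamental_theorem_of_calculus)
        (auto intro: has_field_derivative_at_within simp flip: has_real_derivative_iff_has_vector_derivative)
    then show "integral (cbox 0 (2*pi)) (\<lambda>t. f' t z) = 0"
      using assms(3) by (simp add: integral_unique)
  qed
  finally show ?thesis by simp
qed

lemma integral_z_derivative_eq_0:
  fixes f f' :: "real \<Rightarrow> real \<Rightarrow> real"
  assumes "\<And>t z. ((\<lambda>z. f t z) has_real_derivative f' t z) (at z)"
    and "continuous_on cell (\<lambda>q. f' (fst q) (snd q))" and "\<And>t. f t 1 = f t (-1)"
  shows "integral cell (\<lambda>q. f' (fst q) (snd q)) = 0"
proof -
  have "integral cell (\<lambda>q. f' (fst q) (snd q)) = integral (cbox 0 (2*pi)) (\<lambda>t. integral (cbox (-1) 1) (\<lambda>z. f' t z))"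
    using integral_prod_continuous[OF assms(2)] by simp
  also have "\<dots> = integral (cbox 0 (2*pi)) (\<lambda>t::real. 0)"
  proof (rule Henstock_Kurzweil_Integration.integral_cong)
    fix t :: real
    have "((\<lambda>z. f' t z) has_integral (f t 1 - f t (-1))) {-1..1}"
      using assms(1) by (intro fundamental_theorem_of_calculus)
        (auto intro: has_field_derivative_at_within simp flip: has_real_derivative_iff_has_vector_derivative)
    then show "integral (cbox (-1) 1) (\<lambda>z. f' t z) = 0"
      using assms(3) by (simp add: integral_unique)
  qed
  finally show ?thesis by simp
qed

text \<open>The divergence theorem on the shells between coaxial cylinders, in differentiated form.\<close>

lemma cylinder_divergence:
  fixes V :: "3 \<Rightarrow> real^3 \<Rightarrow> real"
  assumes \<epsilon>: "0 \<le> \<epsilon>" and V: "\<And>j x. x \<in> Omega \<epsilon> \<Longrightarrow> has_partials (V j) (\<lambda>l. VD j l x) x"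
    and VD: "\<And>j l. continuous_on (Omega \<epsilon>) (VD j l)" and per: "\<And>j x. V j (x + axis 3 2) = V j x"
    and r: "r > \<epsilon>"
  shows "((\<lambda>r. integral cell (\<lambda>q. r * (cos (fst q) * V 1 (cyl r (fst q) (snd q)) + sin (fst q) * V 2 (cyl r (fst q) (snd q)))))
     has_real_derivative integral cell (\<lambda>q. r * (\<Sum>j\<in>UNIV. VD j j (cyl r (fst q) (snd q))))) (at r)"
proof -
  have cV: "continuous_on (Omega \<epsilon>) (V j)" for j
    using V has_partials_differentiable
    by (metis continuous_at_imp_continuous_on differentiable_imp_continuous_within)
  let ?f = "\<lambda>r q. r * (cos (fst q) * V 1 (cyl r (fst q) (snd q)) + sin (fst q) * V 2 (cyl r (fst q) (snd q)))"
  let ?c = "\<lambda>r q. cyl r (fst q) (snd q)"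
  define g where "g r q = (cos (fst q) * V 1 (?c r q) + sin (fst q) * V 2 (?c r q))
     + r * (cos (fst q) * (cos (fst q) * VD 1 1 (?c r q) + sin (fst q) * VD 1 2 (?c r q))
          + sin (fst q) * (cos (fst q) * VD 2 1 (?c r q) + sin (fst q) * VD 2 2 (?c r q)))" for r and q :: "real \<times> real"
  have Vr: "((\<lambda>r. V j (?c r q)) has_real_derivative (cos (fst q) * VD j 1 (?c r q) + sin (fst q) * VD j 2 (?c r q))) (at r)"
    if "r > \<epsilon>" for r q j
    using has_partials_cyl_r[OF V[OF cyl_in_Omega[OF \<epsilon> that]]]
    by (simp add: has_real_derivative_iff_has_vector_derivative)
  have fr: "((\<lambda>r. ?f r q) has_real_derivative g r q) (at r)" if "r > \<epsilon>" for r q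
    unfolding g_def using that by (auto intro!: derivative_eq_intros Vr)
  have cg: "continuous_on ({\<epsilon><..} \<times> cell) (\<lambda>(r, q). g r q)"
    unfolding g_def case_prod_unfold
    by (intro continuous_intros continuous_on_comp_cyl[OF \<epsilon> cV] continuous_on_comp_cyl[OF \<epsilon> VD]) auto
  have "((\<lambda>r. integral cell (?f r)) has_real_derivative integral cell (g r)) (at r within {\<epsilon><..})"
  proof (rule leibniz_rule_field_derivative[OF _ _ cg])
    fix r' q assume "r' \<in> {\<epsilon><..}"
    then show "((\<lambda>r. ?f r q) has_real_derivative g r' q) (at r' within {\<epsilon><..})"
      by (intro has_field_derivative_at_within[OF fr]) auto
  next
    fix r' assume "r' \<in> {\<epsilon><..}"
    then show "?f r' integrable_on cell"
      by (intro integrable_continuous continuous_intros continuous_on_cyl_slice[OF \<epsilon> cV]) auto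
  qed (use r in auto)
  moreover have "at r within {\<epsilon><..} = at r" using r by (intro at_within_open) auto
  moreover have "integral cell (g r) = integral cell (\<lambda>q. r * (\<Sum>j\<in>UNIV. VD j j (?c r q)))"
  proof -
    \<comment> \<open>The derivative in the angle of the azimuthal component -sin V_1 + cos V_2. It
      enters r div V = d_r(r V_r) + d_theta V_theta + r d_z V_3, where the last two terms integrate
      to zero over a period.\<close>
    define T' where "T' t z = - cos t * V 1 (cyl r t z) - sin t * V 2 (cyl r t z)
      - sin t * ((- r * sin t) * VD 1 1 (cyl r t z) + (r * cos t) * VD 1 2 (cyl r t z))
      + cos t * ((- r * sin t) * VD 2 1 (cyl r t z) + (r * cos t) * VD 2 2 (cyl r t z))" for t z
    have V\<theta>: "((\<lambda>t. V j (cyl r t z)) has_real_derivative ((- r * sin t) * VD j 1 (cyl r t z) + (r * cos t) * VD j 2 (cyl r t z))) (at t)" for j t z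
      using has_partials_cyl_\<theta>[OF V[OF cyl_in_Omega[OF \<epsilon> r]]]
      by (simp add: has_real_derivative_iff_has_vector_derivative)
    have Vz: "((\<lambda>z. V j (cyl r t z)) has_real_derivative VD j 3 (cyl r t z)) (at z)" for j t z
      using has_partials_cyl_z[OF V[OF cyl_in_Omega[OF \<epsilon> r]]]
      by (simp add: has_real_derivative_iff_has_vector_derivative)
    have cT: "continuous_on cell (\<lambda>q. T' (fst q) (snd q))"
      unfolding T'_def
      by (intro continuous_intros continuous_on_cyl_slice[OF \<epsilon> cV r] continuous_on_cyl_slice[OF \<epsilon> VD r])
    have cZ: "continuous_on cell (\<lambda>q. r * VD 3 3 (cyl r (fst q) (snd q)))"
      by (intro continuous_intros continuous_on_cyl_slice[OF \<epsilon> VD r])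
    have cS: "continuous_on cell (\<lambda>q. r * (\<Sum>j\<in>UNIV. VD j j (?c r q)))"
      by (intro continuous_intros continuous_on_cyl_slice[OF \<epsilon> VD r])
    have T0: "integral cell (\<lambda>q. T' (fst q) (snd q)) = 0"
    proof (rule integral_\<theta>_derivative_eq_0[OF _ cT])
      show "((\<lambda>t. - sin t * V 1 (cyl r t z) + cos t * V 2 (cyl r t z)) has_real_derivative T' t z) (at t)" for t z
        unfolding T'_def by (auto intro!: derivative_eq_intros V\<theta>)
    qed (simp add: cyl_def)
    have Z0: "integral cell (\<lambda>q. r * VD 3 3 (cyl r (fst q) (snd q))) = 0"
    proof (rule integral_z_derivative_eq_0[OF _ cZ])
      show "((\<lambda>z. r * V 3 (cyl r t z)) has_real_derivative r * VD 3 3 (cyl r t z)) (at z)" for t z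
        by (auto intro!: derivative_eq_intros Vz)
      have "cyl r t 1 = cyl r t (-1) + axis 3 2" for t
        unfolding vec_eq_3 by (simp add: cyl_components axis_def)
      then show "r * V 3 (cyl r t 1) = r * V 3 (cyl r t (-1))" for t by (simp add: per)
    qed
    have "g r q = r * (\<Sum>j\<in>UNIV. VD j j (?c r q)) - T' (fst q) (snd q) - r * VD 3 3 (cyl r (fst q) (snd q))" for q
    proof -
      define c where "c = cos (fst q)"
      define s where "s = sin (fst q)"
      have cs: "c * c + s * s = 1" by (simp add: c_def s_def)
      have "r * (\<Sum>j\<in>UNIV. VD j j (?c r q)) - T' (fst q) (snd q) - r * VD 3 3 (cyl r (fst q) (snd q)) - g r q
        = r * (VD 1 1 (?c r q) + VD 2 2 (?c r q)) * (1 - (c * c + s * s))"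
        unfolding g_def T'_def sum_3 c_def[symmetric] s_def[symmetric] by (simp add: algebra_simps)
      then show ?thesis unfolding cs by simp
    qed
    then have "integral cell (g r) = integral cell (\<lambda>q. r * (\<Sum>j\<in>UNIV. VD j j (?c r q)) - T' (fst q) (snd q) - r * VD 3 3 (cyl r (fst q) (snd q)))"
      by presburger
    also have "\<dots> = integral cell (\<lambda>q. r * (\<Sum>j\<in>UNIV. VD j j (?c r q))) - integral cell (\<lambda>q. T' (fst q) (snd q))
        - integral cell (\<lambda>q. r * VD 3 3 (cyl r (fst q) (snd q)))"
      by (simp only: Henstock_Kurzweil_Integration.integral_diff[OF integrable_continuous[OF continuous_on_diff[OF cS cT]] integrable_continuous[OF cZ]]
          Henstock_Kurzweil_Integration.integral_diff[OF integrable_continuous[OF cS] integrable_continuous[OF cT]])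
    finally show ?thesis by (simp only: T0 Z0 diff_zero)
  qed
  ultimately show ?thesis by (simp only:)
qed

section \<open>Polar coordinates and the energy of shells\<close>

definition polar_map :: "real^3 \<Rightarrow> real^3" where
  "polar_map y = cyl (y $ 1) (y $ 2) (y $ 3)"

definition polar_derivative :: "real^3 \<Rightarrow> real^3 \<Rightarrow> real^3" where
  "polar_derivative y h = (h $ 1 * cos (y $ 2) - y $ 1 * sin (y $ 2) * h $ 2) *\<^sub>R axis 1 1
     + (h $ 1 * sin (y $ 2) + y $ 1 * cos (y $ 2) * h $ 2) *\<^sub>R axis 2 1 + h $ 3 *\<^sub>R axis 3 1"

lemma polar_map_has_derivative: "(polar_map has_derivative polar_derivative y) (at y within S)"
proof -
  have d: "((\<lambda>y::real^3. y $ i) has_derivative (\<lambda>h. h $ i)) (at y within S)" for i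
    by (intro bounded_linear_imp_has_derivative bounded_linear_vec_nth)
  show ?thesis
    unfolding polar_map_def[abs_def] cyl_axis polar_derivative_def[abs_def]
    by (auto intro!: derivative_eq_intros d simp: algebra_simps)
qed

lemma det_polar_derivative: "det (matrix (polar_derivative y)) = y $ 1"
proof -
  have "det (matrix (polar_derivative y)) = y $ 1 * (cos (y $ 2) * cos (y $ 2)) + y $ 1 * (sin (y $ 2) * sin (y $ 2))"
    unfolding det_3 matrix_def polar_derivative_def by (simp add: axis_def algebra_simps)
  also have "\<dots> = y $ 1" unfolding distrib_left[symmetric] sin_cos_squared_add3 by simp
  finally show ?thesis .
qed

lemma cos_sin_inj:
  assumes "cos a = cos b" "sin a = sin b" "0 < a" "a < 2 * pi" "0 < b" "b < 2 * pi"
  shows "a = b"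
proof -
  have "cos (a - b) = cos b * cos b + sin b * sin b" using assms(1,2) by (simp add: cos_diff)
  then have "cos (a - b) = 1" by simp
  then obtain n :: int where n: "a - b = of_int n * 2 * pi" unfolding cos_one_2pi_int by blast
  have e: "of_int n * (2 * pi) = a - b" using n by simp
  have "of_int n * (2 * pi) < 1 * (2 * pi)" "(-1) * (2 * pi) < of_int n * (2 * pi)"
    unfolding e using assms by auto
  then have "real_of_int n < 1" "-1 < real_of_int n"
    by (simp_all only: mult_less_cancel_right_pos[of "2 * pi"] pi_gt_zero zero_less_mult_iff zero_less_numeral simp_thms)
  then have "n = 0" by linarith
  with n show ?thesis by simp
qed

text \<open>Change of variables on the open parameter box, where the polar map is injective with
  Jacobian r; enlarging its image to the whole cell can only increase the integral of a nonnegative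
  function. Passing through \<open>vec3\<close> then gives the iterated integral.\<close>

lemma polar_energy_bound:
  fixes F :: "real^3 \<Rightarrow> real"
  assumes \<epsilon>: "\<epsilon> > 0" and F: "continuous_on (Omega \<epsilon>) F" "\<And>x. x \<in> Omega \<epsilon> \<Longrightarrow> F x \<ge> 0"
    and int: "set_integrable lborel (Omega_cell \<epsilon>) F" and ab: "\<epsilon> < a" "a \<le> b"
  shows "integral {a..b} (\<lambda>r. r * integral cell (\<lambda>q. F (cyl r (fst q) (snd q)))) \<le> integral (Omega_cell \<epsilon>) F"
proof -
  let ?l = "vector [a, 0, -1] :: real^3" and ?u = "vector [b, 2 * pi, 1] :: real^3"
  let ?S = "box ?l ?u"
  let ?f = "\<lambda>y. y $ 1 * F (polar_map y)"
  have memS: "y \<in> ?S \<longleftrightarrow> a < y $ 1 \<and> y $ 1 < b \<and> 0 < y $ 2 \<and> y $ 2 < 2 * pi \<and> -1 < y $ 3 \<and> y $ 3 < 1" for y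
    by (simp add: mem_box_cart forall_3)
  have memC: "y \<in> cbox ?l ?u \<longleftrightarrow> a \<le> y $ 1 \<and> y $ 1 \<le> b \<and> 0 \<le> y $ 2 \<and> y $ 2 \<le> 2 * pi \<and> -1 \<le> y $ 3 \<and> y $ 3 \<le> 1" for y
    by (simp add: mem_box_cart forall_3)
  have gO: "polar_map y \<in> Omega \<epsilon>" if "a \<le> y $ 1" for y
    unfolding polar_map_def using that ab \<epsilon> by (intro cyl_in_Omega) auto
  have inj: "inj_on polar_map ?S"
  proof (rule inj_onI)
    fix x y assume x: "x \<in> ?S" and y: "y \<in> ?S" and e: "polar_map x = polar_map y"
    have "radius (polar_map x) = radius (polar_map y)" using e by simp
    then have 1: "x $ 1 = y $ 1" unfolding polar_map_def using x y ab \<epsilon> by (simp add: radius_cyl memS)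
    have "x $ 1 * cos (x $ 2) = y $ 1 * cos (y $ 2)" "x $ 1 * sin (x $ 2) = y $ 1 * sin (y $ 2)" "x $ 3 = y $ 3"
      using arg_cong[OF e, of "\<lambda>v. v $ 1"] arg_cong[OF e, of "\<lambda>v. v $ 2"] arg_cong[OF e, of "\<lambda>v. v $ 3"]
      by (simp_all add: polar_map_def cyl_components)
    then have "cos (x $ 2) = cos (y $ 2)" "sin (x $ 2) = sin (y $ 2)" "x $ 3 = y $ 3"
      using 1 y ab \<epsilon> by (auto simp: memS)
    then show "x = y" using 1 x y cos_sin_inj[of "x $ 2" "y $ 2"] by (simp add: vec_eq_3 memS)
  qed
  have cg: "continuous_on X polar_map" for X
    using polar_map_has_derivative has_derivative_continuous_on by blast
  have cf: "continuous_on (cbox ?l ?u) ?f"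
    by (intro continuous_intros continuous_on_compose2[OF F(1) cg]) (use gO in \<open>auto simp: memC\<close>)
  \<comment> \<open>Injectivity and continuity make the image open, hence measurable.\<close>
  have "open (polar_map ` ?S)"
    by (rule invariance_of_domain[OF cg open_box inj])
  then have meas: "polar_map ` ?S \<in> sets lebesgue" by simp
  have sub: "polar_map ` ?S \<subseteq> Omega_cell \<epsilon>"
    using gO by (auto simp: memS Omega_cell_def) (auto simp: polar_map_def cyl_components)
  have absF: "F absolutely_integrable_on Omega_cell \<epsilon>"
    using int unfolding set_integrable_def by (subst integrable_completion) (auto simp: borel_measurable_integrable)
  then have absI: "F absolutely_integrable_on polar_map ` ?S"
    by (rule set_integrable_subset) (use meas sub in auto)
  \<comment> \<open>The change of variables is applied to functions with values in
    \<open>real^1\<close>, whose single component is read off afterwards.\<close>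
  then have v1: "(\<lambda>x. vec (F x) :: real^1) absolutely_integrable_on polar_map ` ?S"
    by (simp add: absolutely_integrable_on_1_iff)
  have "(\<lambda>x. \<bar>det (matrix (polar_derivative x))\<bar> *\<^sub>R (vec (F (polar_map x)) :: real^1)) absolutely_integrable_on ?S \<and>
      integral ?S (\<lambda>x. \<bar>det (matrix (polar_derivative x))\<bar> *\<^sub>R (vec (F (polar_map x)) :: real^1))
        = integral (polar_map ` ?S) (\<lambda>x. vec (F x))"
    by (subst has_absolute_integral_change_of_variables[OF _ polar_map_has_derivative inj]) (use v1 in auto)
  then have I1: "integral ?S (\<lambda>x. \<bar>det (matrix (polar_derivative x))\<bar> *\<^sub>R (vec (F (polar_map x)) :: real^1))
        = integral (polar_map ` ?S) (\<lambda>x. vec (F x))" by blast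
  have "integral ?S ?f = integral ?S (\<lambda>x. (\<bar>det (matrix (polar_derivative x))\<bar> *\<^sub>R (vec (F (polar_map x)) :: real^1)) $ 1)"
    using ab \<epsilon> by (intro Henstock_Kurzweil_Integration.integral_cong) (simp add: det_polar_derivative memS)
  also have "\<dots> = integral (polar_map ` ?S) (\<lambda>x. (vec (F x) :: real^1) $ 1)"
    using arg_cong[OF I1, of "\<lambda>v. v $ 1"] by (simp add: integral_on_1_eq)
  also have "\<dots> = integral (polar_map ` ?S) F" by simp
  also have "\<dots> \<le> integral (Omega_cell \<epsilon>) F"
    using sub absI absF F(2) by (intro integral_subset_le) (auto simp: Omega_cell_def dest: set_lebesgue_integral_eq_integral(1))
  finally have le: "integral (cbox ?l ?u) ?f \<le> integral (Omega_cell \<epsilon>) F"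
    by (simp only: integral_open_interval)
  have pre: "vec3 q \<in> cbox ?l ?u \<longleftrightarrow> q \<in> cbox (a, 0, -1) (b, 2 * pi, 1)" for q
    by (cases q) (auto simp: memC vec3_components cbox_Pair_eq)
  have ci: "continuous_on (cbox (a, 0, -1) (b, 2 * pi, 1)) (\<lambda>q. ?f (vec3 q))"
    by (rule continuous_on_compose2[OF cf continuous_on_vec3]) (use pre in auto)
  have "integral (cbox ?l ?u) ?f = (LINT y:cbox ?l ?u|lborel. ?f y)"
    by (rule set_borel_integral_eq_integral(2)[symmetric]) (unfold set_integrable_def, rule borel_integrable_compact[OF compact_cbox cf])
  also have "\<dots> = (\<integral>q. indicator (cbox ?l ?u) (vec3 q) *\<^sub>R ?f (vec3 q) \<partial>lborel)"
    unfolding set_lebesgue_integral_def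
    by (subst lborel_real3, rule integral_distr)
      (simp, rule borel_measurable_continuous_on_indicator[OF borel_closed[OF closed_cbox] cf])
  also have "\<dots> = (LINT q:cbox (a, 0, -1) (b, 2 * pi, 1)|lborel. ?f (vec3 q))"
    unfolding set_lebesgue_integral_def by (intro Bochner_Integration.integral_cong) (auto simp: pre indicator_def)
  also have "\<dots> = integral (cbox (a, 0, -1) (b, 2 * pi, 1)) (\<lambda>q. ?f (vec3 q))"
    by (rule set_borel_integral_eq_integral(2)) (unfold set_integrable_def, rule borel_integrable_compact[OF compact_cbox ci])
  also have "\<dots> = integral (cbox a b) (\<lambda>r. integral (cbox (0, -1) (2 * pi, 1)) (\<lambda>q. ?f (vec3 (r, q))))"
    by (rule integral_prod_continuous[OF ci])
  also have "\<dots> = integral (cbox a b) (\<lambda>r. r * integral cell (\<lambda>q. F (cyl r (fst q) (snd q))))"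
  proof (rule Henstock_Kurzweil_Integration.integral_cong)
    fix r :: real
    have "?f (vec3 (r, q)) = r * F (cyl r (fst q) (snd q))" for q
      by (cases q) (simp add: vec3_components polar_map_def)
    then show "integral cell (\<lambda>q. ?f (vec3 (r, q))) = r * integral cell (\<lambda>q. F (cyl r (fst q) (snd q)))"
      by simp
  qed
  finally show ?thesis using le unfolding box_real(2) by linarith
qed

section \<open>Regularity, traces and decay for differences of solutions\<close>

lemma has_partials_diff:
  assumes "has_partials f D x" "has_partials g D' x"
  shows "has_partials (\<lambda>x. f x - g x) (\<lambda>j. D j - D' j) x"
proof -
  have "(\<lambda>h. (\<Sum>j\<in>UNIV. h $ j *\<^sub>R D j) - (\<Sum>j\<in>UNIV. h $ j *\<^sub>R D' j)) = (\<lambda>h. \<Sum>j\<in>UNIV. h $ j *\<^sub>R (D j - D' j))"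
    by (simp add: scaleR_diff_right sum_subtractf)
  then show ?thesis using has_derivative_diff[OF assms[unfolded has_partials_def]]
    unfolding has_partials_def by simp
qed

lemma has_partials_inner:
  assumes "has_partials f D x" "has_partials g D' x"
  shows "has_partials (\<lambda>x. f x \<bullet> g x) (\<lambda>j. D j \<bullet> g x + f x \<bullet> D' j) x"
proof -
  have "(\<lambda>h. f x \<bullet> (\<Sum>j\<in>UNIV. h $ j *\<^sub>R D' j) + (\<Sum>j\<in>UNIV. h $ j *\<^sub>R D j) \<bullet> g x)
     = (\<lambda>h. \<Sum>j\<in>UNIV. h $ j *\<^sub>R (D j \<bullet> g x + f x \<bullet> D' j))"
    by (simp add: inner_sum_right inner_sum_left sum.distrib[symmetric] algebra_simps)
  then show ?thesis using has_derivative_inner[OF assms[unfolded has_partials_def]]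
    unfolding has_partials_def by simp
qed

lemma has_partials_nth:
  assumes "has_partials f D x"
  shows "has_partials (\<lambda>x. f x $ i) (\<lambda>j. D j $ i) x"
  using bounded_linear.has_derivative[OF bounded_linear_vec_nth assms[unfolded has_partials_def], of i]
  unfolding has_partials_def by simp

lemma has_partials_cscale:
  fixes f :: "real^3 \<Rightarrow> real"
  assumes "has_partials f D x"
  shows "has_partials (\<lambda>x. c * f x) (\<lambda>j. c * D j) x"
proof -
  have "(\<lambda>h. c * (\<Sum>j\<in>UNIV. h $ j *\<^sub>R D j)) = (\<lambda>h. \<Sum>j\<in>UNIV. h $ j *\<^sub>R (c * D j))"
    by (simp add: sum_distrib_left mult_ac)
  then show ?thesis using has_derivative_mult_right[OF assms[unfolded has_partials_def], of c]
    unfolding has_partials_def by simp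
qed

lemma Ck_on_1_partials:
  assumes "open S" "Ck_on 1 S f" "x \<in> S"
  shows "has_partials f (\<lambda>j. pderiv_at j f x) x" "continuous_on S (pderiv_at j f)"
proof -
  have "f differentiable_on S" "\<forall>j. continuous_on S (pderiv_at j f)" using assms(2) by simp_all
  then show "has_partials f (\<lambda>j. pderiv_at j f x) x" "continuous_on S (pderiv_at j f)"
    using assms by (auto simp: differentiable_on_eq_differentiable_at has_partials_iff_differentiable)
qed

lemma Ck_on_2_partials:
  assumes "open S" "Ck_on 2 S f" "x \<in> S"
  shows "has_partials f (\<lambda>j. pderiv_at j f x) x" "has_partials (pderiv_at j f) (\<lambda>l. pderiv_at l (pderiv_at j f) x) x"
    "continuous_on S (pderiv_at l (pderiv_at j f))"
proof -
  have "f differentiable_on S" "\<forall>j. Ck_on 1 S (pderiv_at j f)" using assms(2) by (simp_all add: numeral_2_eq_2)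
  then show "has_partials f (\<lambda>j. pderiv_at j f x) x" "has_partials (pderiv_at j f) (\<lambda>l. pderiv_at l (pderiv_at j f) x) x"
    "continuous_on S (pderiv_at l (pderiv_at j f))"
    using assms Ck_on_1_partials[OF assms(1) _ assms(3)]
    by (auto simp: differentiable_on_eq_differentiable_at has_partials_iff_differentiable)
qed

text \<open>A map is a derivative at x + v exactly when it is one at x, so
  \<open>frechet_derivative\<close> makes the same choice at both points, differentiable or
  not.\<close>

lemma pderiv_periodic:
  assumes per: "\<And>x. f (x + v) = f x" shows "pderiv_at j f (x + v) = pderiv_at j f x"
proof -
  have sh: "(g has_derivative g') (at x)" if "(g has_derivative g') (at (x + v))" "\<And>x. g (x + v) = g x"
    for g :: "real^3 \<Rightarrow> 'a" and g' x v
  proof -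
    have "((\<lambda>y. y + v) has_derivative (\<lambda>h. h)) (at x)" by (auto intro!: derivative_eq_intros)
    from has_derivative_compose[OF this that(1)] show ?thesis by (simp add: that(2))
  qed
  have "(f has_derivative f') (at (x + v)) = (f has_derivative f') (at x)" for f'
    using sh[of f f' x v] sh[of f f' "x + v" "- v"] per per[of "_ - v"] by auto
  then show ?thesis by (simp add: pderiv_at_def frechet_derivative_def)
qed

lemma slice_integral_has_derivative:
  fixes f :: "real^3 \<Rightarrow> real"
  assumes \<epsilon>: "0 \<le> \<epsilon>" and f: "\<And>x. x \<in> Omega \<epsilon> \<Longrightarrow> has_partials f (\<lambda>l. D l x) x"
    and D: "\<And>l. continuous_on (Omega \<epsilon>) (D l)" and r: "r > \<epsilon>"
  shows "((\<lambda>r. integral cell (\<lambda>q. f (cyl r (fst q) (snd q)))) has_real_derivative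
     integral cell (\<lambda>q. cos (fst q) * D 1 (cyl r (fst q) (snd q)) + sin (fst q) * D 2 (cyl r (fst q) (snd q)))) (at r)"
proof -
  have cf: "continuous_on (Omega \<epsilon>) f"
    using f has_partials_differentiable
    by (metis continuous_at_imp_continuous_on differentiable_imp_continuous_within)
  let ?g = "\<lambda>r q. cos (fst q) * D 1 (cyl r (fst q) (snd q)) + sin (fst q) * D 2 (cyl r (fst q) (snd q))"
  have cg: "continuous_on ({\<epsilon><..} \<times> cell) (\<lambda>(r, q). ?g r q)"
    unfolding case_prod_unfold
    by (intro continuous_intros continuous_on_comp_cyl[OF \<epsilon> D]) auto
  have "((\<lambda>r. integral cell (\<lambda>q. f (cyl r (fst q) (snd q)))) has_real_derivative integral cell (?g r)) (at r within {\<epsilon><..})"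
  proof (rule leibniz_rule_field_derivative[OF _ _ cg])
    fix r' and q :: "real \<times> real" assume "r' \<in> {\<epsilon><..}"
    then have "cyl r' (fst q) (snd q) \<in> Omega \<epsilon>" using \<epsilon> by (auto intro: cyl_in_Omega)
    from has_partials_cyl_r[OF f[OF this]]
    show "((\<lambda>r. f (cyl r (fst q) (snd q))) has_real_derivative ?g r' q) (at r' within {\<epsilon><..})"
      by (auto simp: has_real_derivative_iff_has_vector_derivative[symmetric] intro: has_field_derivative_at_within)
  next
    fix r' assume "r' \<in> {\<epsilon><..}"
    then show "(\<lambda>q. f (cyl r' (fst q) (snd q))) integrable_on cell"
      by (intro integrable_continuous continuous_on_cyl_slice[OF \<epsilon> cf]) auto
  qed (use r in auto)
  moreover have "at r within {\<epsilon><..} = at r" using r by (intro at_within_open) auto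
  ultimately show ?thesis by (simp only:)
qed

lemma young_inequality: "s > 0 \<Longrightarrow> 2 * a * b \<le> s * a\<^sup>2 + b\<^sup>2 / (s::real)"
proof -
  assume s: "s > 0"
  have "0 \<le> (s * a - b)\<^sup>2 / s" using s by simp
  also have "\<dots> = s * a\<^sup>2 + b\<^sup>2 / s - 2 * a * b" using s by (simp add: field_simps power2_eq_square)
  finally show ?thesis by simp
qed

lemma set_integrable_norm_diff_square:
  fixes f g :: "real^3 \<Rightarrow> 'b::euclidean_space"
  assumes "A \<in> sets borel" "continuous_on A f" "continuous_on A g"
    and "set_integrable lborel A (\<lambda>x. (norm (f x))\<^sup>2)" "set_integrable lborel A (\<lambda>x. (norm (g x))\<^sup>2)"
  shows "set_integrable lborel A (\<lambda>x. (norm (f x - g x))\<^sup>2)"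
proof (rule set_integrable_bound)
  show "set_integrable lborel A (\<lambda>x. 2 * (norm (f x))\<^sup>2 + 2 * (norm (g x))\<^sup>2)"
    using assms(4,5) by (intro set_integral_add(1) set_integrable_mult_right) auto
  have "continuous_on A (\<lambda>x. (norm (f x - g x))\<^sup>2)" by (intro continuous_intros assms)
  from borel_measurable_continuous_on_indicator[OF assms(1) this]
  show "set_borel_measurable lborel A (\<lambda>x. (norm (f x - g x))\<^sup>2)"
    unfolding set_borel_measurable_def by simp
  have "(norm (f x - g x))\<^sup>2 \<le> 2 * (norm (f x))\<^sup>2 + 2 * (norm (g x))\<^sup>2" for x
  proof -
    have "(norm (f x - g x))\<^sup>2 \<le> (norm (f x) + norm (g x))\<^sup>2"
      by (intro power_mono norm_triangle_ineq4) simp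
    also have "\<dots> \<le> 2 * (norm (f x))\<^sup>2 + 2 * (norm (g x))\<^sup>2"
      using sum_squares_bound[of "norm (f x)" "norm (g x)"] by (simp add: power2_sum)
    finally show ?thesis .
  qed
  then show "AE x in lborel. x \<in> A \<longrightarrow> norm ((norm (f x - g x))\<^sup>2) \<le> norm (2 * (norm (f x))\<^sup>2 + 2 * (norm (g x))\<^sup>2)"
    by simp
qed

lemma radial_limit_const:
  assumes "(f \<longlongrightarrow> l) (filtercomap radius at_top)" "\<And>t. t > \<epsilon> \<Longrightarrow> f (cyl t \<theta> z) = c"
  shows "c = (l :: 'a::t2_space)"
proof -
  have "filterlim (radius \<circ> (\<lambda>t. cyl t \<theta> z)) at_top at_top"
    by (rule filterlim_mono_eventually[OF filterlim_ident order.refl order.refl])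
       (use eventually_ge_at_top[of 0] in \<open>eventually_elim, simp add: radius_cyl\<close>)
  then have "filterlim (\<lambda>t. cyl t \<theta> z) (filtercomap radius at_top) at_top"
    by (simp add: filterlim_filtercomap_iff)
  from filterlim_compose[OF assms(1) this] have "((\<lambda>t. f (cyl t \<theta> z)) \<longlongrightarrow> l) at_top" .
  moreover have "((\<lambda>t. f (cyl t \<theta> z)) \<longlongrightarrow> c) at_top"
    by (rule tendsto_eventually) (rule eventually_mono[OF eventually_gt_at_top[of \<epsilon>]], rule assms(2))
  ultimately show ?thesis using tendsto_unique trivial_limit_at_top_linorder by blast
qed

text \<open>The function is constant along a single ray and tends to 0 there. Working ray by ray
  fits the situation that vanishing gradients are known only for parameters in one period
  cell.\<close>

lemma zero_if_radial_derivative_0: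
  fixes f :: "real^3 \<Rightarrow> 'b::real_normed_vector"
  assumes \<epsilon>: "0 \<le> \<epsilon>" and f: "\<And>x. x \<in> Omega \<epsilon> \<Longrightarrow> has_partials f (\<lambda>l. D l x) x"
    and D: "\<And>t. t > \<epsilon> \<Longrightarrow> D 1 (cyl t \<theta> z) = 0 \<and> D 2 (cyl t \<theta> z) = 0"
    and lim: "(f \<longlongrightarrow> 0) (filtercomap radius at_top)" and r: "r > \<epsilon>"
  shows "f (cyl r \<theta> z) = 0"
proof -
  have "\<exists>c. \<forall>t\<in>{\<epsilon><..}. f (cyl t \<theta> z) = c"
  proof (rule has_vector_derivative_zero_constant[of "{\<epsilon><..}" "\<lambda>t. f (cyl t \<theta> z)"])
    fix t assume "t \<in> {\<epsilon><..}"
    then have t: "t > \<epsilon>" by simp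
    from has_partials_cyl_r[of f "\<lambda>l. D l (cyl t \<theta> z)" t \<theta> z, OF f[OF cyl_in_Omega[OF \<epsilon> t]]] D[OF t]
    show "((\<lambda>t. f (cyl t \<theta> z)) has_vector_derivative 0) (at t within {\<epsilon><..})"
      by (simp add: has_vector_derivative_at_within)
  qed (simp, blast)
  then obtain c where c: "\<And>t. t > \<epsilon> \<Longrightarrow> f (cyl t \<theta> z) = c" by auto
  with radial_limit_const[OF lim c] r show ?thesis by simp
qed

lemma Omega_cyl_cases:
  assumes "x \<in> Omega \<epsilon>" "\<epsilon> \<ge> 0"
  obtains \<theta> where "0 \<le> \<theta>" "\<theta> \<le> 2 * pi" "x = cyl (radius x) \<theta> (x $ 3)" "radius x > \<epsilon>"
proof -
  have r: "radius x > \<epsilon>" "radius x > 0" using assms by (auto simp: Omega_def)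
  have "(x $ 1 / radius x)\<^sup>2 + (x $ 2 / radius x)\<^sup>2 = 1"
  proof -
    have "(x $ 1 / radius x)\<^sup>2 + (x $ 2 / radius x)\<^sup>2 = ((x $ 1)\<^sup>2 + (x $ 2)\<^sup>2) / (radius x)\<^sup>2"
      by (simp add: power_divide add_divide_distrib)
    also have "\<dots> = 1" unfolding radius_square[symmetric] using r by simp
    finally show ?thesis .
  qed
  then obtain t where t: "0 \<le> t" "t \<le> 2 * pi" "x $ 1 / radius x = cos t" "x $ 2 / radius x = sin t"
    using sincos_total_2pi_le by blast
  then have "x = cyl (radius x) t (x $ 3)"
    using r by (simp add: vec_eq_3 cyl_components field_simps)
  with t r that show thesis by blast
qed

lemma periodic_int:
  fixes f :: "real^3 \<Rightarrow> 'b"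
  assumes "\<And>x. f (x + axis 3 2) = f x"
  shows "f (x + axis 3 (2 * of_int n)) = f x"
proof -
  have nat: "f (x + axis 3 (2 * real m)) = f x" for m x
  proof (induction m)
    case 0
    have "x + axis 3 (2 * real 0) = x" by (simp add: vec_eq_3 axis_def)
    then show ?case by (simp only:)
  next
    case (Suc m)
    have "x + axis 3 (2 * real (Suc m)) = (x + axis 3 (2 * real m)) + axis 3 2"
      by (simp add: vec_eq_3 axis_def)
    with Suc show ?case by (simp only: assms)
  qed
  show ?thesis
  proof (cases "n \<ge> 0")
    case True
    then show ?thesis using nat[of x "nat n"] by simp
  next
    case False
    have "f ((x + axis 3 (2 * of_int n)) + axis 3 (2 * real (nat (- n)))) = f (x + axis 3 (2 * of_int n))"
      by (rule nat)
    moreover have "(x + axis 3 (2 * of_int n)) + axis 3 (2 * real (nat (- n))) = x"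
      using False by (simp add: vec_eq_3 axis_def)
    ultimately show ?thesis by simp
  qed
qed

lemma cell_eq: "cell = {0..2*pi} \<times> {-1..1}"
  by (simp add: cbox_Pair_eq)

text \<open>From |u - u'|^2 <= 2 |u - ubar|^2 + 2 |u' - ubar|^2: fields with a common trace approach
  each other in mean square. Continuity of \<open>ubar\<close> supplies measurability, and the
  doubled terms are repeated sums so that additivity of the nonnegative integral suffices.\<close>

lemma integral_cell_tendsto_0:
  fixes u u' :: "real^3 \<Rightarrow> complex^3"
  assumes \<epsilon>: "0 \<le> \<epsilon>" and u: "continuous_on (Omega \<epsilon>) u" "continuous_on (Omega \<epsilon>) u'" and ub: "continuous_on UNIV ubar"
    and lim: "((\<lambda>r. \<integral>\<^sup>+q\<in>{0..2*pi} \<times> {-1..1}. ennreal ((norm (u (cyl r (fst q) (snd q)) - ubar (snd q)))\<^sup>2) \<partial>lborel) \<longlongrightarrow> 0) (at_right \<epsilon>)"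
      "((\<lambda>r. \<integral>\<^sup>+q\<in>{0..2*pi} \<times> {-1..1}. ennreal ((norm (u' (cyl r (fst q) (snd q)) - ubar (snd q)))\<^sup>2) \<partial>lborel) \<longlongrightarrow> 0) (at_right \<epsilon>)"
  shows "((\<lambda>r. integral cell (\<lambda>q. (norm (u (cyl r (fst q) (snd q)) - u' (cyl r (fst q) (snd q))))\<^sup>2)) \<longlongrightarrow> 0) (at_right \<epsilon>)"
    (is "(?M \<longlongrightarrow> 0) _")
proof -
  let ?I = "\<lambda>u r. \<integral>\<^sup>+q\<in>{0..2*pi} \<times> {-1..1}. ennreal ((norm (u (cyl r (fst q) (snd q)) - ubar (snd q)))\<^sup>2) \<partial>lborel"
  have pos: "?M r \<ge> 0" if r: "r > \<epsilon>" for r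
    by (intro integral_nonneg integrable_continuous continuous_intros continuous_on_cyl_slice[OF \<epsilon> _ r] u) auto
  have le: "ennreal (?M r) \<le> (?I u r + ?I u' r) + (?I u r + ?I u' r)" if r: "r > \<epsilon>" for r
  proof -
    let ?f = "\<lambda>q. (norm (u (cyl r (fst q) (snd q)) - u' (cyl r (fst q) (snd q))))\<^sup>2"
    let ?a = "\<lambda>u q. ennreal ((norm (u (cyl r (fst q) (snd q)) - ubar (snd q)))\<^sup>2) * indicator cell q"
    have cf: "continuous_on cell ?f"
      by (intro continuous_intros continuous_on_cyl_slice[OF \<epsilon> _ r] u)
    have int: "set_integrable lborel cell ?f"
      unfolding set_integrable_def by (rule borel_integrable_compact[OF compact_cbox cf])
    have "ennreal (?M r) = ennreal (\<integral>q. indicator cell q *\<^sub>R ?f q \<partial>lborel)"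
      using set_borel_integral_eq_integral(2)[OF int] unfolding set_lebesgue_integral_def by simp
    also have "\<dots> = (\<integral>\<^sup>+q. ennreal (indicator cell q *\<^sub>R ?f q) \<partial>lborel)"
      by (rule nn_integral_eq_integral[symmetric]) (use int in \<open>auto simp: set_integrable_def\<close>)
    also have "\<dots> \<le> (\<integral>\<^sup>+q. (?a u q + ?a u' q) + (?a u q + ?a u' q) \<partial>lborel)"
    proof (rule nn_integral_mono)
      fix q :: "real \<times> real"
      let ?x = "u (cyl r (fst q) (snd q)) - ubar (snd q)" and ?y = "u' (cyl r (fst q) (snd q)) - ubar (snd q)"
      have "?f q = (norm (?x - ?y))\<^sup>2" by simp
      also have "\<dots> \<le> (norm ?x + norm ?y)\<^sup>2"
        by (intro power_mono norm_triangle_ineq4) simp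
      also have "\<dots> \<le> ((norm ?x)\<^sup>2 + (norm ?y)\<^sup>2) + ((norm ?x)\<^sup>2 + (norm ?y)\<^sup>2)"
        using sum_squares_bound[of "norm ?x" "norm ?y"] by (simp add: power2_sum)
      finally have "ennreal (?f q) \<le> ennreal (((norm ?x)\<^sup>2 + (norm ?y)\<^sup>2) + ((norm ?x)\<^sup>2 + (norm ?y)\<^sup>2))"
        by (rule ennreal_leI)
      also have "\<dots> = (ennreal ((norm ?x)\<^sup>2) + ennreal ((norm ?y)\<^sup>2)) + (ennreal ((norm ?x)\<^sup>2) + ennreal ((norm ?y)\<^sup>2))"
        by (simp only: ennreal_plus zero_le_power2 add_nonneg_nonneg)
      finally show "ennreal (indicator cell q *\<^sub>R ?f q) \<le> (?a u q + ?a u' q) + (?a u q + ?a u' q)"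
        by (cases "q \<in> cell") (simp_all del: cbox_Pair_eq)
    qed
    also have "\<dots> = (?I u r + ?I u' r) + (?I u r + ?I u' r)"
    proof -
      have m: "?a v \<in> borel_measurable lborel" if v: "continuous_on (Omega \<epsilon>) v" for v
      proof -
        have "continuous_on cell (\<lambda>q. v (cyl r (fst q) (snd q)) - ubar (snd q))"
          by (intro continuous_intros continuous_on_cyl_slice[OF \<epsilon> v r] continuous_on_compose2[OF ub]) auto
        from borel_measurable_continuous_on_indicator[OF borel_closed[OF closed_cbox] this]
        have "(\<lambda>q. ennreal ((norm (indicator cell q *\<^sub>R (v (cyl r (fst q) (snd q)) - ubar (snd q))))\<^sup>2)) \<in> borel_measurable borel"
          by measurable
        also have "(\<lambda>q. ennreal ((norm (indicator cell q *\<^sub>R (v (cyl r (fst q) (snd q)) - ubar (snd q))))\<^sup>2)) = ?a v"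
          by (auto simp: indicator_def fun_eq_iff)
        finally show ?thesis by simp
      qed
      note M = m[OF u(1)] m[OF u(2)]
      show ?thesis unfolding cell_eq[symmetric]
        by (simp only: nn_integral_add[OF borel_measurable_add[OF M] borel_measurable_add[OF M]] nn_integral_add[OF M])
    qed
    finally show ?thesis .
  qed
  have "((\<lambda>r. (?I u r + ?I u' r) + (?I u r + ?I u' r)) \<longlongrightarrow> (0 + 0) + (0 + 0)) (at_right \<epsilon>)"
    by (intro tendsto_add lim)
  then have "((\<lambda>r. (?I u r + ?I u' r) + (?I u r + ?I u' r)) \<longlongrightarrow> 0) (at_right \<epsilon>)" by simp
  then have "((\<lambda>r. ennreal (?M r)) \<longlongrightarrow> 0) (at_right \<epsilon>)"
    by (rule tendsto_sandwich[OF _ _ tendsto_const, rotated -1])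
       (auto simp: eventually_at_filter le intro: always_eventually)
  then have "((\<lambda>r. ennreal (?M r)) \<longlongrightarrow> ennreal 0) (at_right \<epsilon>)" by simp
  then show ?thesis
    by (rule tendsto_ennrealD) (auto simp: eventually_at_filter pos)
qed

text \<open>Everything is expressed by the real inner product of complex vectors, which takes the
  real part and conjugates implicitly; the flux field is thus real, as
  \<open>cylinder_divergence\<close> requires.\<close>

lemma stokes_velocity_unique:
  fixes u u' :: "real^3 \<Rightarrow> complex^3" and p p' :: "real^3 \<Rightarrow> complex"
  assumes \<epsilon>: "\<epsilon> > 0" and ub: "continuous_on UNIV ubar"
    and sol: "stokes_solution \<epsilon> ubar u p" and sol': "stokes_solution \<epsilon> ubar u' p'"
  shows "u = u'"
proof -
  have e0: "0 \<le> \<epsilon>" using \<epsilon> by simp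
  note S = sol[unfolded stokes_solution_def] and S' = sol'[unfolded stokes_solution_def]
  have C: "Ck_on 2 (Omega \<epsilon>) u" "Ck_on 2 (Omega \<epsilon>) u'" "Ck_on 1 (Omega \<epsilon>) p" "Ck_on 1 (Omega \<epsilon>) p'"
    using S S' by blast+
  note P = Ck_on_2_partials[OF open_Omega C(1)] Ck_on_2_partials[OF open_Omega C(2)]
    Ck_on_1_partials[OF open_Omega C(3)] Ck_on_1_partials[OF open_Omega C(4)]
  define w where "w x = u x - u' x" for x
  define h where "h x = p x - p' x" for x
  define W where "W j x = pderiv_at j u x - pderiv_at j u' x" for j x
  define WW where "WW j l x = pderiv_at l (pderiv_at j u) x - pderiv_at l (pderiv_at j u') x" for j l x
  define Q where "Q j x = pderiv_at j p x - pderiv_at j p' x" for j x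
  have hw: "has_partials w (\<lambda>j. W j x) x" if "x \<in> Omega \<epsilon>" for x
    unfolding w_def[abs_def] W_def by (intro has_partials_diff P that)
  have hW: "has_partials (W j) (\<lambda>l. WW j l x) x" if "x \<in> Omega \<epsilon>" for j x
    unfolding W_def[abs_def] WW_def by (intro has_partials_diff P that)
  have hh: "has_partials h (\<lambda>j. Q j x) x" if "x \<in> Omega \<epsilon>" for x
    unfolding h_def[abs_def] Q_def by (intro has_partials_diff P that)
  have contI: "continuous_on (Omega \<epsilon>) f" if "\<And>x. x \<in> Omega \<epsilon> \<Longrightarrow> has_partials f (D x) x" for f :: "real^3 \<Rightarrow> 'b::real_normed_vector" and D
    using that has_partials_differentiable
    by (metis continuous_at_imp_continuous_on differentiable_imp_continuous_within)
  have cw: "continuous_on (Omega \<epsilon>) w" and cW: "\<And>j. continuous_on (Omega \<epsilon>) (W j)" and ch: "continuous_on (Omega \<epsilon>) h"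
    using contI[OF hw] contI[OF hW] contI[OF hh] by blast+
  have ne: "cyl (\<epsilon> + 1) 0 0 \<in> Omega \<epsilon>" using e0 by (intro cyl_in_Omega) auto
  have cWW: "continuous_on (Omega \<epsilon>) (WW j l)" for j l
    unfolding WW_def[abs_def] by (intro continuous_on_diff P(3)[OF ne] P(6)[OF ne])
  have cQ: "continuous_on (Omega \<epsilon>) (Q j)" for j
    unfolding Q_def[abs_def] by (intro continuous_on_diff P(8)[OF ne] P(10)[OF ne])
  have cu: "continuous_on (Omega \<epsilon>) u" "continuous_on (Omega \<epsilon>) u'"
    using contI[OF P(1)] contI[OF P(4)] by blast+
  have cpu: "continuous_on (Omega \<epsilon>) (pderiv_at j u)" "continuous_on (Omega \<epsilon>) (pderiv_at j u')" for j
    using contI[OF P(2)] contI[OF P(5)] by blast+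
  have cp: "continuous_on (Omega \<epsilon>) p" "continuous_on (Omega \<epsilon>) p'"
    using contI[OF P(7)] contI[OF P(9)] by blast+
  have perw: "w (x + axis 3 2) = w x" and perh: "h (x + axis 3 2) = h x" for x
    using S S' by (simp_all add: w_def h_def)
  have perW: "W j (x + axis 3 2) = W j x" for j x
  proof -
    have "\<And>x. u (x + axis 3 2) = u x" "\<And>x. u' (x + axis 3 2) = u' x" using S S' by blast+
    from pderiv_periodic[of u "axis 3 2", OF this(1)] pderiv_periodic[of u' "axis 3 2", OF this(2)] show ?thesis by (simp add: W_def)
  qed
  have lapl: "(\<Sum>j\<in>UNIV. WW j j x) = (\<chi> i. Q i x)" if x: "x \<in> Omega \<epsilon>" for x
  proof -
    have "laplacian u x = gradient p x" "laplacian u' x = gradient p' x"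
      using S S' x by (simp_all add: neg_eq_iff_add_eq_0)
    then have "laplacian u x - laplacian u' x = gradient p x - gradient p' x" by simp
    moreover have "laplacian u x - laplacian u' x = (\<Sum>j\<in>UNIV. WW j j x)"
      by (simp add: laplacian_def WW_def sum_subtractf)
    moreover have "gradient p x - gradient p' x = (\<chi> i. Q i x)"
      by (simp add: gradient_def Q_def vec_eq_iff)
    ultimately show ?thesis by simp
  qed
  have divw: "(\<Sum>j\<in>UNIV. W j x $ j) = 0" if x: "x \<in> Omega \<epsilon>" for x
  proof -
    have "divergence u x - divergence u' x = 0" using S S' x by simp
    then show ?thesis by (simp add: divergence_def W_def sum_subtractf)
  qed

  \<comment> \<open>Component j of grad |w|^2 - 2 Re(h conj(w)), where \<open>h\<close> is the
    pressure difference.\<close>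
  define V where "V j x = 2 * (w x \<bullet> W j x) - 2 * (w x $ j \<bullet> h x)" for j x
  define VD where "VD j l x = 2 * (W l x \<bullet> W j x + w x \<bullet> WW j l x) - 2 * (W l x $ j \<bullet> h x + w x $ j \<bullet> Q l x)" for j l x
  have hV: "has_partials (V j) (\<lambda>l. VD j l x) x" if x: "x \<in> Omega \<epsilon>" for j x
    unfolding V_def[abs_def] VD_def
    by (intro has_partials_diff has_partials_cscale has_partials_inner has_partials_nth hw hW hh x)
  have cVD: "continuous_on (Omega \<epsilon>) (VD j l)" for j l
    unfolding VD_def[abs_def] by (intro continuous_intros cw cW cWW ch cQ)
  have perV: "V j (x + axis 3 2) = V j x" for j x
    by (simp add: V_def perw perW perh)
  have sumVD: "(\<Sum>j\<in>UNIV. VD j j x) = 2 * (\<Sum>j\<in>UNIV. (norm (W j x))\<^sup>2)" if x: "x \<in> Omega \<epsilon>" for x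
  proof -
    \<comment> \<open>The Laplacian term cancels against the one with the pressure gradient, and the
      term with \<open>h\<close> carries the divergence of w, which is zero.\<close>
    have "(\<Sum>j\<in>UNIV. VD j j x) = 2 * (\<Sum>j\<in>UNIV. W j x \<bullet> W j x) + 2 * (w x \<bullet> (\<Sum>j\<in>UNIV. WW j j x))
        - 2 * ((\<Sum>j\<in>UNIV. W j x $ j) \<bullet> h x) - 2 * (\<Sum>j\<in>UNIV. w x $ j \<bullet> Q j x)"
      unfolding VD_def inner_sum_left inner_sum_right
      by (simp add: sum.distrib sum_subtractf algebra_simps flip: sum_distrib_left)
    also have "\<dots> = 2 * (\<Sum>j\<in>UNIV. W j x \<bullet> W j x)"
      unfolding lapl[OF x] divw[OF x] by (simp add: inner_vec_def)
    finally show ?thesis by (simp add: power2_norm_eq_inner)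
  qed

  \<comment> \<open>The pressure belongs to the energy density because it contributes to the flux
    and must be bounded by something integrable.\<close>
  define G where "G x = (\<Sum>j\<in>UNIV. (norm (W j x))\<^sup>2) + (norm (h x))\<^sup>2" for x
  have cG: "continuous_on (Omega \<epsilon>) G"
    unfolding G_def[abs_def] by (intro continuous_intros cW ch)
  have G0: "G x \<ge> 0" for x unfolding G_def by (intro add_nonneg_nonneg sum_nonneg) auto
  let ?c = "\<lambda>r q. cyl r (fst q) (snd q)"
  define M where "M r = integral cell (\<lambda>q. w (?c r q) \<bullet> w (?c r q))" for r
  define E where "E r = integral cell (\<lambda>q. G (?c r q))" for r
  define \<Phi> where "\<Phi> r = integral cell (\<lambda>q. r * (cos (fst q) * V 1 (?c r q) + sin (fst q) * V 2 (?c r q)))" for r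
  define \<Phi>' where "\<Phi>' r = integral cell (\<lambda>q. r * (\<Sum>j\<in>UNIV. VD j j (?c r q)))" for r
  define M' where "M' r = integral cell (\<lambda>q. cos (fst q) * (W 1 (?c r q) \<bullet> w (?c r q) + w (?c r q) \<bullet> W 1 (?c r q))
      + sin (fst q) * (W 2 (?c r q) \<bullet> w (?c r q) + w (?c r q) \<bullet> W 2 (?c r q)))" for r
  have slice: "continuous_on cell (\<lambda>q. f (?c r q))" if "continuous_on (Omega \<epsilon>) f" "r > \<epsilon>" for f :: "real^3 \<Rightarrow> 'b::topological_space" and r
    using that by (intro continuous_on_cyl_slice[OF e0])
  have inO: "?c r q \<in> Omega \<epsilon>" if "r > \<epsilon>" for r and q :: "real \<times> real" using that e0 by (rule cyl_in_Omega[rotated])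
  have cww: "continuous_on (Omega \<epsilon>) (\<lambda>x. w x \<bullet> w x)" by (intro continuous_intros cw)
  have iM: "(\<lambda>q. w (?c r q) \<bullet> w (?c r q)) integrable_on cell" if "r > \<epsilon>" for r
    by (intro integrable_continuous slice[OF cww that])
  have iG: "(\<lambda>q. G (?c r q)) integrable_on cell" if "r > \<epsilon>" for r
    by (intro integrable_continuous slice[OF cG that])
  have cV: "continuous_on (Omega \<epsilon>) (V j)" for j by (rule contI[OF hV])
  have Wle: "2 * (norm (w x) * norm (W j x)) \<le> s * (w x \<bullet> w x) + (norm (W j x))\<^sup>2 / s" if "s > 0" for s x j
    using young_inequality[OF that, of "norm (w x)" "norm (W j x)"] by (simp add: power2_norm_eq_inner mult.assoc)
  have hle: "2 * (norm (w x) * norm (h x)) \<le> s * (w x \<bullet> w x) + (norm (h x))\<^sup>2 / s" if "s > 0" for s x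
    using young_inequality[OF that, of "norm (w x)" "norm (h x)"] by (simp add: power2_norm_eq_inner mult.assoc)
  have G12: "(norm (W 1 x))\<^sup>2 + (norm (W 2 x))\<^sup>2 + (norm (h x))\<^sup>2 \<le> G x" for x
    by (simp add: G_def sum_3)
  have cs: "\<bar>cos t * a + sin t * b\<bar> \<le> \<bar>a\<bar> + \<bar>b\<bar>" for t a b :: real
  proof -
    have "\<bar>cos t * a\<bar> \<le> 1 * \<bar>a\<bar>" "\<bar>sin t * b\<bar> \<le> 1 * \<bar>b\<bar>"
      unfolding abs_mult by (intro mult_right_mono abs_cos_le_one abs_sin_le_one abs_ge_zero)+
    then show ?thesis using abs_triangle_ineq[of "cos t * a" "sin t * b"] by linarith
  qed
  have \<Phi>'0: "\<Phi>' r0 = 0" if r0: "r0 > \<epsilon>" for r0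
  proof -
    have der\<Phi>: "(\<Phi> has_real_derivative \<Phi>' r) (at r)" if "r > \<epsilon>" for r
      unfolding \<Phi>_def[abs_def] \<Phi>'_def by (rule cylinder_divergence[OF e0 hV cVD perV that])
    have pos\<Phi>: "\<Phi>' r \<ge> 0" if "r > \<epsilon>" for r
      unfolding \<Phi>'_def
    proof (rule integral_nonneg)
      show "(\<lambda>q. r * (\<Sum>j\<in>UNIV. VD j j (?c r q))) integrable_on cell"
        by (intro integrable_continuous continuous_intros slice[OF cVD that])
      show "0 \<le> r * (\<Sum>j\<in>UNIV. VD j j (?c r q))" for q
        using that \<epsilon> by (simp add: sumVD[OF inO[OF that]] sum_nonneg)
    qed
    have lin: "integral cell (\<lambda>q. a * (w (?c r q) \<bullet> w (?c r q)) + G (?c r q) * b) = a * M r + E r * b" if "r > \<epsilon>" for a b r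
      unfolding M_def E_def
      using iM[OF that] iG[OF that] by (simp add: Henstock_Kurzweil_Integration.integral_add integrable_on_mult_right integrable_on_mult_left)
    have ilin: "(\<lambda>q. a * (w (?c r q) \<bullet> w (?c r q)) + G (?c r q) * b) integrable_on cell" if "r > \<epsilon>" for a b r
      using iM[OF that] iG[OF that] by (intro integrable_add integrable_on_mult_right integrable_on_mult_left)
    have b\<Phi>: "\<bar>\<Phi> r\<bar> \<le> r * (4 * s * M r + 2 * E r / s)" if r: "r > \<epsilon>" and s: "s > 0" for r s
    proof -
      have "norm (\<Phi> r) \<le> integral cell (\<lambda>q. (r * (4 * s)) * (w (?c r q) \<bullet> w (?c r q)) + G (?c r q) * (r * (2 / s)))"
        unfolding \<Phi>_def
      proof (rule Henstock_Kurzweil_Integration.integral_norm_bound_integral[OF _ ilin[OF r]])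
        show "(\<lambda>q. r * (cos (fst q) * V 1 (?c r q) + sin (fst q) * V 2 (?c r q))) integrable_on cell"
          by (intro integrable_continuous continuous_intros slice[OF cV r])
        fix q :: "real \<times> real"
        let ?x = "?c r q"
        define A where "A = w ?x \<bullet> w ?x"
        define i where "i = 1 / s"
        have i: "i > 0" using s by (simp add: i_def)
        have Vj: "\<bar>V j ?x\<bar> \<le> 2 * s * A + (norm (W j ?x))\<^sup>2 * i + (norm (h ?x))\<^sup>2 * i" for j
        proof -
          have "\<bar>w ?x \<bullet> W j ?x\<bar> \<le> norm (w ?x) * norm (W j ?x)" by (rule Cauchy_Schwarz_ineq2)
          moreover have "\<bar>w ?x $ j \<bullet> h ?x\<bar> \<le> norm (w ?x) * norm (h ?x)"
            by (rule order.trans[OF Cauchy_Schwarz_ineq2]) (intro mult_right_mono Finite_Cartesian_Product.norm_nth_le norm_ge_zero)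
          ultimately have "\<bar>V j ?x\<bar> \<le> 2 * (norm (w ?x) * norm (W j ?x)) + 2 * (norm (w ?x) * norm (h ?x))"
            unfolding V_def by linarith
          then show ?thesis using Wle[OF s, of ?x j] hle[OF s, of ?x] by (simp add: A_def i_def)
        qed
        have "\<bar>cos (fst q) * V 1 ?x + sin (fst q) * V 2 ?x\<bar> \<le> \<bar>V 1 ?x\<bar> + \<bar>V 2 ?x\<bar>" by (rule cs)
        also have "\<dots> \<le> 4 * s * A + ((norm (W 1 ?x))\<^sup>2 + (norm (W 2 ?x))\<^sup>2 + (norm (h ?x))\<^sup>2) * i + (norm (h ?x))\<^sup>2 * i"
          by (rule order.trans[OF add_mono[OF Vj[of 1] Vj[of 2]]]) (simp add: algebra_simps)
        also have "\<dots> \<le> 4 * s * A + G ?x * i + G ?x * i"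
        proof (intro add_mono mult_right_mono order.refl G12)
          show "(norm (h ?x))\<^sup>2 \<le> G ?x" by (simp add: G_def sum_nonneg)
        qed (use i s in \<open>auto simp: A_def\<close>)
        finally have "r * \<bar>cos (fst q) * V 1 ?x + sin (fst q) * V 2 ?x\<bar> \<le> r * (4 * s * A + G ?x * i + G ?x * i)"
          by (rule mult_left_mono) (use r \<epsilon> in simp)
        moreover have "norm (r * (cos (fst q) * V 1 ?x + sin (fst q) * V 2 ?x))
            = r * \<bar>cos (fst q) * V 1 ?x + sin (fst q) * V 2 ?x\<bar>"
          unfolding real_norm_def abs_mult using r \<epsilon> by simp
        moreover have "r * (4 * s * A + G ?x * i + G ?x * i) = (r * (4 * s)) * A + G ?x * (r * (2 / s))"
          by (simp add: i_def algebra_simps)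
        ultimately show "norm (r * (cos (fst q) * V 1 ?x + sin (fst q) * V 2 ?x)) \<le> (r * (4 * s)) * (w ?x \<bullet> w ?x) + G ?x * (r * (2 / s))"
          by (simp only: A_def)
      qed
      also have "\<dots> = r * (4 * s * M r + 2 * E r / s)" unfolding lin[OF r] by (simp add: algebra_simps)
      finally show ?thesis by simp
    qed
    have derM: "(M has_real_derivative M' r) (at r)" if "r > \<epsilon>" for r
      unfolding M_def[abs_def] M'_def
      by (rule slice_integral_has_derivative[where D="\<lambda>l x. W l x \<bullet> w x + w x \<bullet> W l x", OF e0 _ _ that])
        (intro has_partials_inner hw continuous_intros cw cW; assumption)+
    have bM': "M' r \<le> 2 * s * M r + E r / s" if r: "r > \<epsilon>" and s: "s > 0" for r s
    proof -
      have "M' r \<le> integral cell (\<lambda>q. (2 * s) * (w (?c r q) \<bullet> w (?c r q)) + G (?c r q) * (1 / s))"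
        unfolding M'_def
      proof (rule integral_le[OF _ ilin[OF r]])
        show "(\<lambda>q. cos (fst q) * (W 1 (?c r q) \<bullet> w (?c r q) + w (?c r q) \<bullet> W 1 (?c r q))
            + sin (fst q) * (W 2 (?c r q) \<bullet> w (?c r q) + w (?c r q) \<bullet> W 2 (?c r q))) integrable_on cell"
          by (intro integrable_continuous continuous_intros slice[OF cw r] slice[OF cW r])
        fix q :: "real \<times> real"
        let ?x = "?c r q"
        have "\<bar>W j ?x \<bullet> w ?x + w ?x \<bullet> W j ?x\<bar> \<le> s * (w ?x \<bullet> w ?x) + (norm (W j ?x))\<^sup>2 * (1 / s)" for j
          using Cauchy_Schwarz_ineq2[of "w ?x" "W j ?x"] Wle[OF s, of ?x j] by (simp add: inner_commute[of "W j ?x"])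
        note a = this
        define i where "i = 1 / s"
        define A where "A = w ?x \<bullet> w ?x"
        have g: "((norm (W 1 ?x))\<^sup>2 + (norm (W 2 ?x))\<^sup>2) * i \<le> G ?x * i"
          using G12[of ?x] s by (intro mult_right_mono order.trans[OF _ G12]) (auto simp: i_def)
        let ?X = "\<lambda>j. W j ?x \<bullet> w ?x + w ?x \<bullet> W j ?x"
        have "cos (fst q) * ?X 1 + sin (fst q) * ?X 2 \<le> \<bar>?X 1\<bar> + \<bar>?X 2\<bar>"
          by (rule order.trans[OF abs_ge_self cs])
        also have "\<dots> \<le> (s * A + (norm (W 1 ?x))\<^sup>2 * i) + (s * A + (norm (W 2 ?x))\<^sup>2 * i)"
          using add_mono[OF a[of 1] a[of 2]] unfolding A_def i_def .
        also have "\<dots> = (2 * s) * A + ((norm (W 1 ?x))\<^sup>2 + (norm (W 2 ?x))\<^sup>2) * i"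
          by (simp add: algebra_simps)
        also have "\<dots> \<le> (2 * s) * A + G ?x * i" by (rule add_left_mono[OF g])
        finally show "cos (fst q) * ?X 1 + sin (fst q) * ?X 2 \<le> (2 * s) * (w ?x \<bullet> w ?x) + G ?x * (1 / s)"
          unfolding A_def i_def .
      qed
      also have "\<dots> = 2 * s * M r + E r / s" unfolding lin[OF r] by simp
      finally show ?thesis .
    qed
    have Mpos: "M r \<ge> 0" if "r > \<epsilon>" for r
      unfolding M_def by (rule integral_nonneg[OF iM[OF that]]) simp
    have Epos: "E r \<ge> 0" if "r > \<epsilon>" for r
      unfolding E_def by (rule integral_nonneg[OF iG[OF that] G0])
    have M0: "(M \<longlongrightarrow> 0) (at_right \<epsilon>)"
      unfolding M_def[abs_def] w_def power2_norm_eq_inner[symmetric]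
      by (rule integral_cell_tendsto_0[OF e0 cu ub]) (use S S' in blast)+
    have limw: "(w \<longlongrightarrow> 0) (filtercomap radius at_top)"
    proof -
      have "(u \<longlongrightarrow> 0) (filtercomap radius at_top)" "(u' \<longlongrightarrow> 0) (filtercomap radius at_top)" using S S' by blast+
      from tendsto_diff[OF this] show ?thesis by (simp add: w_def[abs_def])
    qed
    have "\<forall>\<^sub>F x in filtercomap radius at_top. dist (w x) 0 < 1" by (rule tendstoD[OF limw]) simp
    then obtain R0 where R0: "\<And>x. radius x \<ge> R0 \<Longrightarrow> norm (w x) < 1"
      unfolding eventually_filtercomap eventually_at_top_linorder by auto
    \<comment> \<open>Far out |w| < 1 by decay, so M is at most the area of the cell.\<close>
    have Mbd: "M r \<le> integral cell (\<lambda>q. 1)" if "r \<ge> max R0 (\<epsilon> + 1)" for r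
    proof -
      have r: "r > \<epsilon>" "r \<ge> R0" using that by auto
      show ?thesis unfolding M_def
      proof (rule integral_le[OF iM[OF r(1)]])
        fix q :: "real \<times> real"
        have "norm (w (?c r q)) \<le> 1" using R0[of "?c r q"] r \<epsilon> by (simp add: radius_cyl less_imp_le)
        then show "w (?c r q) \<bullet> w (?c r q) \<le> 1" by (simp add: power_le_one flip: power2_norm_eq_inner)
      qed (rule integrable_const)
    qed
    have Econt: "continuous_on {\<epsilon><..} E"
      unfolding E_def[abs_def]
    proof (rule integral_continuous_on_param)
      show "continuous_on ({\<epsilon><..} \<times> cell) (\<lambda>(r, q). G (?c r q))"
        unfolding case_prod_unfold by (intro continuous_on_comp_cyl[OF e0 cG] continuous_intros) auto
    qed
    have cellsub: "Omega_cell \<epsilon> \<subseteq> Omega \<epsilon>" by (auto simp: Omega_cell_def)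
    have intG: "set_integrable lborel (Omega_cell \<epsilon>) G"
    proof -
      have "set_integrable lborel (Omega_cell \<epsilon>) (\<lambda>x. (norm (W j x))\<^sup>2)" for j
        unfolding W_def
        by (rule set_integrable_norm_diff_square[OF Omega_cell_measurable continuous_on_subset[OF cpu(1) cellsub]
              continuous_on_subset[OF cpu(2) cellsub]]) (use S S' in blast)+
      moreover have "set_integrable lborel (Omega_cell \<epsilon>) (\<lambda>x. (norm (h x))\<^sup>2)"
        unfolding h_def
        by (rule set_integrable_norm_diff_square[OF Omega_cell_measurable continuous_on_subset[OF cp(1) cellsub]
              continuous_on_subset[OF cp(2) cellsub]]) (use S S' in blast)+
      ultimately show ?thesis unfolding G_def[abs_def] sum_3 by (intro set_integral_add(1))
    qed
    have B: "integral {a..b} (\<lambda>r. r * E r) \<le> integral (Omega_cell \<epsilon>) G" if "\<epsilon> < a" "a \<le> b" for a b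
      unfolding E_def by (rule polar_energy_bound[OF \<epsilon> cG G0 intG that])
    have "\<Phi> r = 0" if "r > \<epsilon>" for r
      by (rule energy_vanishes[OF \<epsilon> der\<Phi> pos\<Phi> b\<Phi> derM bM' Mpos M0 Mbd Econt Epos B that])
    then have "((\<lambda>_. 0) has_real_derivative \<Phi>' r0) (at r0)"
      using r0 by (intro has_field_derivative_transform_within_open[OF der\<Phi>[OF r0] open_greaterThan[of \<epsilon>]]) auto
    then show "\<Phi>' r0 = 0" using DERIV_unique DERIV_const by blast
  qed
  have W0: "W j (cyl r \<theta> z) = 0" if r: "r > \<epsilon>" and c: "(\<theta>, z) \<in> cell" for j r \<theta> z
  proof -
    let ?f = "\<lambda>q. r * (\<Sum>j\<in>UNIV. VD j j (?c r q))"
    have cf: "continuous_on cell ?f" by (intro continuous_intros slice[OF cVD r])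
    have pf: "?f q \<ge> 0" for q using r \<epsilon> by (simp add: sumVD[OF inO[OF r]] sum_nonneg)
    \<comment> \<open>The cell has nonempty interior, so a continuous nonnegative integrand with
      integral zero vanishes on all of it, including its edges.\<close>
    have "box (0::real, -1::real) (2 * pi, 1) \<noteq> {}" by (auto simp: box_ne_empty Basis_prod_def)
    then have "?f (\<theta>, z) = 0"
      using integral_cbox_eq_0_iff[OF cf] pf \<Phi>'0[OF r] c unfolding \<Phi>'_def by blast
    then have "(\<Sum>j\<in>UNIV. (norm (W j (cyl r \<theta> z)))\<^sup>2) = 0"
      using r \<epsilon> sumVD[OF inO[OF r], of "(\<theta>, z)"] by simp
    then show ?thesis by (simp add: sum_nonneg_eq_0_iff)
  qed
  have limw: "(w \<longlongrightarrow> 0) (filtercomap radius at_top)"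
  proof -
    have "(u \<longlongrightarrow> 0) (filtercomap radius at_top)" "(u' \<longlongrightarrow> 0) (filtercomap radius at_top)" using S S' by blast+
    from tendsto_diff[OF this] show ?thesis by (simp add: w_def[abs_def])
  qed
  have "w x = 0" if x: "x \<in> Omega \<epsilon>" for x
  proof -
    obtain \<theta> where \<theta>: "0 \<le> \<theta>" "\<theta> \<le> 2 * pi" "x = cyl (radius x) \<theta> (x $ 3)" "radius x > \<epsilon>"
      using Omega_cyl_cases[OF x e0] by blast
    \<comment> \<open>The number of periods that moves the height of \<open>x\<close> into [-1, 1],
      where \<open>W0\<close> applies.\<close>
    define n where "n = \<lfloor>(x $ 3 + 1) / 2\<rfloor>"
    have n: "-1 \<le> x $ 3 - 2 * of_int n" "x $ 3 - 2 * of_int n \<le> 1"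
      using of_int_floor_le[of "(x $ 3 + 1) / 2"] real_of_int_floor_add_one_gt[of "(x $ 3 + 1) / 2"]
      unfolding n_def by (simp_all add: field_simps)
    have "w (cyl (radius x) \<theta> (x $ 3 - 2 * of_int n)) = 0"
      by (rule zero_if_radial_derivative_0[OF e0 hw _ limw \<theta>(4)]) (use W0 n \<theta> in \<open>auto simp: cell_eq\<close>)
    moreover have "cyl (radius x) \<theta> (x $ 3 - 2 * of_int n) + axis 3 (2 * of_int n) = x"
      by (subst (3) \<theta>(3)) (simp add: vec_eq_3 cyl_components axis_def)
    ultimately show ?thesis using periodic_int[of w "cyl (radius x) \<theta> (x $ 3 - 2 * of_int n)" n, OF perw] by simp
  qed
  moreover have "w x = 0" if "x \<notin> Omega \<epsilon>" for x using S S' that by (simp add: w_def)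
  ultimately have "w x = 0" for x by blast
  then show ?thesis by (auto simp: w_def fun_eq_iff)
qed

text \<open>Once the velocities agree, the momentum equation equates the pressure gradients, and
  decay at infinity removes the remaining constant.\<close>

lemma stokes_solution_unique:
  assumes \<epsilon>: "\<epsilon> > 0" and ub: "continuous_on UNIV ubar"
    and sol: "stokes_solution \<epsilon> ubar u p" and sol': "stokes_solution \<epsilon> ubar u' p'"
  shows "u = u'" "p = p'"
proof -
  show u: "u = u'" by (rule stokes_velocity_unique[OF assms])
  have e0: "0 \<le> \<epsilon>" using \<epsilon> by simp
  note S = sol[unfolded stokes_solution_def] and S' = sol'[unfolded stokes_solution_def]
  have C: "Ck_on 1 (Omega \<epsilon>) p" "Ck_on 1 (Omega \<epsilon>) p'" using S S' by blast+
  have h: "has_partials (\<lambda>x. p x - p' x) (\<lambda>j. pderiv_at j p x - pderiv_at j p' x) x" if "x \<in> Omega \<epsilon>" for x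
    by (intro has_partials_diff Ck_on_1_partials[OF open_Omega _ that] C)
  have Q: "pderiv_at j p x - pderiv_at j p' x = 0" if x: "x \<in> Omega \<epsilon>" for x j
  proof -
    have "- laplacian u' x + gradient p x = 0" using S x unfolding u by blast
    moreover have "- laplacian u' x + gradient p' x = 0" using S' x by blast
    ultimately have "gradient p x = gradient p' x" by (metis add_left_cancel)
    then have "gradient p x $ j = gradient p' x $ j" by simp
    then show ?thesis by (simp add: gradient_def)
  qed
  have "(p \<longlongrightarrow> 0) (filtercomap radius at_top)" "(p' \<longlongrightarrow> 0) (filtercomap radius at_top)" using S S' by blast+
  from tendsto_diff[OF this] have lim: "((\<lambda>x. p x - p' x) \<longlongrightarrow> 0) (filtercomap radius at_top)" by simp
  have "p x - p' x = 0" if x: "x \<in> Omega \<epsilon>" for x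
  proof -
    obtain \<theta> where \<theta>: "x = cyl (radius x) \<theta> (x $ 3)" "radius x > \<epsilon>"
      using Omega_cyl_cases[OF x e0] by blast
    have "p (cyl (radius x) \<theta> (x $ 3)) - p' (cyl (radius x) \<theta> (x $ 3)) = 0"
      by (rule zero_if_radial_derivative_0[OF e0 h _ lim \<theta>(2)]) (simp_all add: Q cyl_in_Omega[OF e0])
    then show ?thesis by (simp flip: \<theta>(1))
  qed
  moreover have "p x - p' x = 0" if "x \<notin> Omega \<epsilon>" for x using S S' that by simp
  ultimately show "p = p'" by (auto simp: fun_eq_iff)
qed

section \<open>The eigenvalues\<close>

lemma continuous_on_fourier_mode: "continuous_on S (fourier_mode k v)"
proof -
  have "fourier_mode k v = (\<lambda>z. \<chi> i. cis (pi * of_int k * z) * v $ i)"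
    by (simp add: fourier_mode_def fun_eq_iff vec_eq_iff)
  moreover have "continuous_on S (\<lambda>z. \<chi> i. cis (pi * of_int k * z) * v $ i)"
    by (intro continuous_on_vec_lambda continuous_intros)
  ultimately show ?thesis by simp
qed

lemma integral_cis_eq_0:
  fixes v :: "complex^3"
  assumes "n \<noteq> 0"
  shows "(LINT z:{-1..1}|lborel. cis (pi * of_int n * z) *s v) = 0"
proof -
  let ?c = "pi * real_of_int n"
  have c: "?c \<noteq> 0" using assms by simp
  have e: "cis (?c * 1) = cis (?c * - 1)"
    using cis_multiple_2pi[of "of_int n"] cis_mult[of "?c * - 1" "2 * pi * of_int n"] by (simp add: algebra_simps)
  have "((\<lambda>z. cis (?c * z)) has_integral (cis (?c * 1) / (\<i> * ?c) - cis (?c * - 1) / (\<i> * ?c))) {-1..1}"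
  proof (rule fundamental_theorem_of_calculus)
    fix z :: real
    have "((\<lambda>z. ?c * z) has_derivative (\<lambda>h. ?c * h)) (at z within {-1..1})"
      by (intro has_derivative_mult_right has_derivative_ident)
    from has_derivative_cis[OF this]
    have "((\<lambda>z. cis (?c * z)) has_vector_derivative ?c *\<^sub>R (\<i> * cis (?c * z))) (at z within {-1..1})"
      unfolding has_vector_derivative_def by (simp add: mult.commute)
    from has_vector_derivative_divide[OF this, of "\<i> * ?c"]
    show "((\<lambda>z. cis (?c * z) / (\<i> * ?c)) has_vector_derivative cis (?c * z)) (at z within {-1..1})"
      using c by (simp add: scaleR_conv_of_real)
  qed simp
  then have I: "((\<lambda>z. cis (?c * z)) has_integral 0) {-1..1}" unfolding e by simp
  have "bounded_linear (\<lambda>a::complex. a *s v)"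
    unfolding linear_conv_bounded_linear[symmetric]
    by (rule linearI) (auto simp: vec_eq_iff distrib_right)
  from has_integral_linear[OF I this] have "((\<lambda>z. cis (?c * z) *s v) has_integral 0) {-1..1}"
    by (simp add: o_def)
  moreover have "set_integrable lborel {-1..1} (\<lambda>z. cis (?c * z) *s v)"
    using borel_integrable_atLeastAtMost'[OF continuous_on_fourier_mode[of _ n v]]
    unfolding fourier_mode_def .
  ultimately show ?thesis
    using set_borel_integral_eq_integral(2) integral_unique by metis
qed

text \<open>By orthogonality only the coefficient with m = k can be nonzero, so the weighted sum
  lives on one index; k different from 0 gives mean zero.\<close>

lemma fourier_mode_in_H_half_0:
  assumes "k \<noteq> 0" shows "fourier_mode k v \<in> H_half_0"
proof -
  have per: "fourier_mode k v (z + 2) = fourier_mode k v z" for z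
    using cis_multiple_2pi[of "of_int k"]
    by (simp add: fourier_mode_def distrib_left mult_ac flip: cis_mult)
  have meas: "fourier_mode k v \<in> borel_measurable borel"
    by (intro borel_measurable_continuous_onI continuous_on_fourier_mode)
  have int: "set_integrable lborel {-1..1} (\<lambda>z. (norm (fourier_mode k v z))\<^sup>2)"
    by (intro borel_integrable_atLeastAtMost' continuous_on_power continuous_on_norm continuous_on_fourier_mode)
  have coeff: "fourier_coeff (fourier_mode k v) m = 0" if "m \<noteq> k" for m
  proof -
    have "cis (- pi * of_int m * z) *s fourier_mode k v z = cis (pi * of_int (k - m) * z) *s v" for z
      unfolding fourier_mode_def vector_smult_assoc cis_mult by (simp add: algebra_simps)
    then show ?thesis unfolding fourier_coeff_def using integral_cis_eq_0[of "k - m" v] that by simp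
  qed
  have "(\<lambda>m::int. sqrt (1 + (of_int m)\<^sup>2) * (norm (fourier_coeff (fourier_mode k v) m))\<^sup>2) summable_on UNIV
     \<longleftrightarrow> (\<lambda>m::int. sqrt (1 + (of_int m)\<^sup>2) * (norm (fourier_coeff (fourier_mode k v) m))\<^sup>2) summable_on {k}"
    by (rule summable_on_cong_neutral) (auto simp: coeff)
  moreover have "(LINT z:{-1..1}|lborel. fourier_mode k v z) = 0"
    unfolding fourier_mode_def by (rule integral_cis_eq_0[OF assms])
  ultimately show ?thesis
    unfolding H_half_0_def H_half_def using per meas int by simp
qed

lemma pairing_scale: "pairing (\<lambda>z. c *s f z) \<phi> = c * pairing f \<phi>"
  unfolding pairing_def by (simp add: mult.assoc flip: sum_distrib_left)

text \<open>At every radius beyond \<epsilon> the force density is already a scalar c(r) times the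
  mode, so for every test function the limit of the pairings is the limit of c times a fixed number.
  Uniqueness evaluates the \<open>THE\<close>.\<close>

lemma L_inv_fourier_mode:
  assumes \<epsilon>: "\<epsilon> > 0" and k: "k \<noteq> 0"
    and sol: "stokes_solution \<epsilon> (fourier_mode k v) u p"
    and force: "\<And>r z. r > \<epsilon> \<Longrightarrow> force_density \<epsilon> u p r z = c r *s fourier_mode k v z"
    and lim: "(c \<longlongrightarrow> l) (at_right \<epsilon>)"
  shows "L_inv \<epsilon> (fourier_mode k v) = functional_of (\<lambda>z. l *s fourier_mode k v z)"
proof -
  have "(THE (u, p). stokes_solution \<epsilon> (fourier_mode k v) u p) = (u, p)"
  proof (rule the_equality)
    show "case (u, p) of (u, p) \<Rightarrow> stokes_solution \<epsilon> (fourier_mode k v) u p" using sol by simp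
    fix x assume "case x of (u, p) \<Rightarrow> stokes_solution \<epsilon> (fourier_mode k v) u p"
    then show "x = (u, p)"
      using stokes_solution_unique[OF \<epsilon> continuous_on_fourier_mode _ sol] by (cases x) auto
  qed
  then have L: "L_inv \<epsilon> (fourier_mode k v) = (\<lambda>\<phi>\<in>H_half. Lim (at_right \<epsilon>) (\<lambda>r. pairing (force_density \<epsilon> u p r) \<phi>))"
    using fourier_mode_in_H_half_0[OF k, of v] by (simp add: L_inv_def)
  have "Lim (at_right \<epsilon>) (\<lambda>r. pairing (force_density \<epsilon> u p r) \<phi>) = pairing (\<lambda>z. l *s fourier_mode k v z) \<phi>" for \<phi>
  proof (rule tendsto_Lim)
    have "((\<lambda>r. c r * pairing (fourier_mode k v) \<phi>) \<longlongrightarrow> l * pairing (fourier_mode k v) \<phi>) (at_right \<epsilon>)"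
      by (intro tendsto_intros lim)
    moreover have "\<forall>\<^sub>F r in at_right \<epsilon>. c r * pairing (fourier_mode k v) \<phi> = pairing (force_density \<epsilon> u p r) \<phi>"
    proof (rule eventually_at_rightI[of \<epsilon> "\<epsilon> + 1"])
      fix r assume "r \<in> {\<epsilon><..<\<epsilon> + 1}"
      then have "force_density \<epsilon> u p r = (\<lambda>z. c r *s fourier_mode k v z)" using force by auto
      then show "c r * pairing (fourier_mode k v) \<phi> = pairing (force_density \<epsilon> u p r) \<phi>"
        by (simp add: pairing_scale)
    qed simp
    ultimately show "((\<lambda>r. pairing (force_density \<epsilon> u p r) \<phi>) \<longlongrightarrow> pairing (\<lambda>z. l *s fourier_mode k v z) \<phi>) (at_right \<epsilon>)"
      unfolding pairing_scale by (rule Lim_transform_eventually)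
  qed simp
  then show ?thesis unfolding L functional_of_def by simp
qed

text \<open>With x = pi \<epsilon> a the prefactor is 4 pi x, and the two bounds are d < K_1^2 and
  2x K_1^2 < (2x + 1) d after clearing the denominator.\<close>

lemma tangential_eigenvalue_bounds:
  fixes \<epsilon> a :: real
  assumes "\<epsilon> > 0" "a > 0"
  defines "K0 \<equiv> bessel_K 0 (pi * \<epsilon> * a)" and "K1 \<equiv> bessel_K 1 (pi * \<epsilon> * a)"
  defines "lam \<equiv> 4 * pi\<^sup>2 * \<epsilon> * a * K1\<^sup>2 / (2 * K0 * K1 + pi * \<epsilon> * a * (K0\<^sup>2 - K1\<^sup>2))"
  shows "4 * pi\<^sup>2 * \<epsilon> * a < lam" "lam < 4 * pi\<^sup>2 * \<epsilon> * a + 2 * pi"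
proof -
  have x: "pi * \<epsilon> * a > 0" using assms(1,2) by simp
  define d where "d = 2 * K0 * K1 + pi * \<epsilon> * a * (K0\<^sup>2 - K1\<^sup>2)"
  have d: "0 < d" "d < K1\<^sup>2" "2 * (pi * \<epsilon> * a) * K1\<^sup>2 < (2 * (pi * \<epsilon> * a) + 1) * d"
    using tangential_ratio_bounds[OF x] by (simp_all only: d_def K0_def K1_def)
  have "4 * pi\<^sup>2 * \<epsilon> * a * d < 4 * pi\<^sup>2 * \<epsilon> * a * K1\<^sup>2"
    using d(2) assms(1,2) by (intro mult_strict_left_mono) auto
  then show "4 * pi\<^sup>2 * \<epsilon> * a < lam"
    unfolding lam_def d_def[symmetric] pos_less_divide_eq[OF d(1)] .
  have "2 * pi * (2 * (pi * \<epsilon> * a) * K1\<^sup>2) < 2 * pi * ((2 * (pi * \<epsilon> * a) + 1) * d)"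
    by (intro mult_strict_left_mono d(3)) simp
  then have "4 * pi\<^sup>2 * \<epsilon> * a * K1\<^sup>2 < (4 * pi\<^sup>2 * \<epsilon> * a + 2 * pi) * d"
    by (simp add: algebra_simps power2_eq_square)
  then show "lam < 4 * pi\<^sup>2 * \<epsilon> * a + 2 * pi"
    unfolding lam_def d_def[symmetric] pos_divide_less_eq[OF d(1)] .
qed

text \<open>With x = pi \<epsilon> a the prefactor is 2 pi x, and the two bounds are 3d < 2n and 2x
  n < 3 (x + 1) d after clearing the denominator.\<close>

lemma normal_eigenvalue_bounds:
  fixes \<epsilon> a :: real
  assumes "\<epsilon> > 0" "a > 0"
  defines "K0 \<equiv> bessel_K 0 (pi * \<epsilon> * a)" and "K1 \<equiv> bessel_K 1 (pi * \<epsilon> * a)" and "K2 \<equiv> bessel_K 2 (pi * \<epsilon> * a)"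
  defines "lam \<equiv> 2 * pi\<^sup>2 * \<epsilon> * a *
     ((4 * K1\<^sup>2 * K2 + pi * \<epsilon> * a * K1 * (K1\<^sup>2 - K0 * K2))
      / (2 * K0 * K1 * K2 + pi * \<epsilon> * a * (K1\<^sup>2 * (K0 + K2) - 2 * K0\<^sup>2 * K2)))"
  shows "3 * pi\<^sup>2 * \<epsilon> * a < lam" "lam < 3 * pi\<^sup>2 * \<epsilon> * a + 3 * pi"
proof -
  have x: "pi * \<epsilon> * a > 0" using assms(1,2) by simp
  define d where "d = 2 * K0 * K1 * K2 + pi * \<epsilon> * a * (K1\<^sup>2 * (K0 + K2) - 2 * K0\<^sup>2 * K2)"
  define n where "n = 4 * K1\<^sup>2 * K2 + pi * \<epsilon> * a * K1 * (K1\<^sup>2 - K0 * K2)"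
  have d: "0 < d" "3 * d < 2 * n" "2 * (pi * \<epsilon> * a) * n < 3 * (pi * \<epsilon> * a + 1) * d"
    using normal_ratio_bounds[OF x] by (simp_all only: d_def n_def K0_def K1_def K2_def)
  have lam: "lam = 2 * pi\<^sup>2 * \<epsilon> * a * n / d"
    unfolding lam_def d_def[symmetric] n_def[symmetric] by simp
  have "pi\<^sup>2 * \<epsilon> * a * (3 * d) < pi\<^sup>2 * \<epsilon> * a * (2 * n)"
    using d(2) assms(1,2) by (intro mult_strict_left_mono) auto
  then have "3 * pi\<^sup>2 * \<epsilon> * a * d < 2 * pi\<^sup>2 * \<epsilon> * a * n" by (simp only: mult_ac)
  then show "3 * pi\<^sup>2 * \<epsilon> * a < lam" unfolding lam pos_less_divide_eq[OF d(1)] .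
  have "pi * (2 * (pi * \<epsilon> * a) * n) < pi * (3 * (pi * \<epsilon> * a + 1) * d)"
    by (intro mult_strict_left_mono d(3)) simp
  then have "2 * pi\<^sup>2 * \<epsilon> * a * n < (3 * pi\<^sup>2 * \<epsilon> * a + 3 * pi) * d"
    by (simp add: algebra_simps power2_eq_square)
  then show "lam < 3 * pi\<^sup>2 * \<epsilon> * a + 3 * pi" unfolding lam pos_divide_less_eq[OF d(1)] .
qed

theorem proposition1p3:
  fixes \<epsilon> :: real and k :: int
  assumes "\<epsilon> > 0" and "k \<noteq> 0"
  shows "let a = \<bar>real_of_int k\<bar>;
             K0 = bessel_K 0 (pi * \<epsilon> * a);
             K1 = bessel_K 1 (pi * \<epsilon> * a);
             K2 = bessel_K 2 (pi * \<epsilon> * a);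
             lam_t = 4 * pi\<^sup>2 * \<epsilon> * a * K1\<^sup>2
                    / (2 * K0 * K1 + pi * \<epsilon> * a * (K0\<^sup>2 - K1\<^sup>2));
             lam_n = 2 * pi\<^sup>2 * \<epsilon> * a *
                    ((4 * K1\<^sup>2 * K2 + pi * \<epsilon> * a * K1 * (K1\<^sup>2 - K0 * K2))
                     / (2 * K0 * K1 * K2 + pi * \<epsilon> * a * (K1\<^sup>2 * (K0 + K2) - 2 * K0\<^sup>2 * K2)))
         in L_inv \<epsilon> (fourier_mode k (axis 3 1))
              = functional_of (\<lambda>z. complex_of_real lam_t *s fourier_mode k (axis 3 1) z)
          \<and> (\<forall>j\<in>{1, 2}. L_inv \<epsilon> (fourier_mode k (axis j 1))
              = functional_of (\<lambda>z. complex_of_real lam_n *s fourier_mode k (axis j 1) z))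
          \<and> 4 * pi\<^sup>2 * \<epsilon> * a < lam_t \<and> lam_t < 4 * pi\<^sup>2 * \<epsilon> * a + 2 * pi
          \<and> 3 * pi\<^sup>2 * \<epsilon> * a < lam_n \<and> lam_n < 3 * pi\<^sup>2 * \<epsilon> * a + 3 * pi"
proof -
  define a where "a = \<bar>real_of_int k\<bar>"
  have a: "a > 0" using assms(2) by (simp add: a_def)
  have "L_inv \<epsilon> (fourier_mode k (axis 3 1)) = functional_of (\<lambda>z. complex_of_real
      (4 * pi\<^sup>2 * \<epsilon> * a * (bessel_K 1 (pi * \<epsilon> * a))\<^sup>2
        / (2 * bessel_K 0 (pi * \<epsilon> * a) * bessel_K 1 (pi * \<epsilon> * a)
           + pi * \<epsilon> * a * ((bessel_K 0 (pi * \<epsilon> * a))\<^sup>2 - (bessel_K 1 (pi * \<epsilon> * a))\<^sup>2)))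
      *s fourier_mode k (axis 3 1) z)"
    using tangential_solution[OF assms(2,1)] L_inv_fourier_mode[OF assms] unfolding a_def by blast
  moreover have "L_inv \<epsilon> (fourier_mode k (axis j 1)) = functional_of (\<lambda>z. complex_of_real
      (2 * pi\<^sup>2 * \<epsilon> * a * ((4 * (bessel_K 1 (pi * \<epsilon> * a))\<^sup>2 * bessel_K 2 (pi * \<epsilon> * a)
         + pi * \<epsilon> * a * bessel_K 1 (pi * \<epsilon> * a)
           * ((bessel_K 1 (pi * \<epsilon> * a))\<^sup>2 - bessel_K 0 (pi * \<epsilon> * a) * bessel_K 2 (pi * \<epsilon> * a)))
       / (2 * bessel_K 0 (pi * \<epsilon> * a) * bessel_K 1 (pi * \<epsilon> * a) * bessel_K 2 (pi * \<epsilon> * a)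
         + pi * \<epsilon> * a * ((bessel_K 1 (pi * \<epsilon> * a))\<^sup>2 * (bessel_K 0 (pi * \<epsilon> * a) + bessel_K 2 (pi * \<epsilon> * a))
           - 2 * (bessel_K 0 (pi * \<epsilon> * a))\<^sup>2 * bessel_K 2 (pi * \<epsilon> * a)))))
      *s fourier_mode k (axis j 1) z)" if "j \<in> {1, 2}" for j
  proof -
    have j: "j = 1 \<or> j = 2" using that by blast
    show ?thesis
      using normal_solution[OF assms(2,1) j] L_inv_fourier_mode[OF assms] unfolding a_def by blast
  qed
  ultimately show ?thesis
    using tangential_eigenvalue_bounds[OF assms(1) a] normal_eigenvalue_bounds[OF assms(1) a]
    unfolding Let_def a_def[symmetric] by (intro conjI ballI)
qed

end
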